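(* The relative entropy of recovery $D_{\rm rec}^B$ is monotonically nonincreasing under $\Omega^\rightarrow$: for every $\rho\in\mathcal{S}_{\rm all}$ and every $\mathcal{E}\in\Omega^\rightarrow$, $$D_{\rm rec}^B(\rho)\ \geq\ D_{\rm rec}^B(\mathcal{E}(\rho)).$$
   Context: All Hilbert spaces are finite-dimensional. A quantum operation is a linear completely positive trace-preserving (CPTP) map; its input and output Hilbert spaces may differ. Maps act as the identity on systems not mentioned. Three parties Alice, Bob and Eve hold systems $A$, $B$ and $E$ (each possibly composed of several subsystems). $\mathcal{S}_{\rm all}$ is the set of all density operators on $\mathcal{H}^A\otimes\mathcal{H}^B\otimes\mathcal{H}^E$, for arbitrary finite-dimensional spaces. $\Omega^\rightarrow$ is the set of all operations that are compositions of operations from the following classes: - $\mathbb{L}_A$, $\mathbb{L}_B$: arbitrary local quantum operations by Alice on $A$, respectively by Bob on $B$. - $\mathbb{R}_E$: local reversible operations by Eve, i.e. quantum operations $\mathcal{V}$ on $E$ for which there is a quantum operation $\mathcal{V}^*$ on Eve's system such that $\mathcal{V}^*\circ\mathcal{V}$ is the identity on states on the input space of $\mathcal{V}$. - $\mathbb{P}_A$: broadcasting of a classical message by Alice. It maps a state $\sum_m p_m|m\rangle\langle m|^{C_A}\otimes\rho_m^{ABE}$, with $C_A$ a register held by Alice ($\{p_m\}$ a probability distribution, $\{|m\rangle\}$ orthonormal), to $\sum_m p_m|m\rangle\langle m|^{C_B}\otimes|m\rangle\langle m|^{C_E}\otimes\rho_m^{ABE}$, with registers $C_B$ held by Bob and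 $C_E$ held by Eve. - $\mathbb{Q}_{AE}$, $\mathbb{Q}_{BE}$: quantum communication from Alice to Eve (resp. Bob to Eve), i.e. a subsystem $Q$ held by Alice (resp. Bob) becomes part of Eve's system. (Broadcasting of classical messages by Bob is not included.) The relative entropy of recovery is $D_{\rm rec}^B(\rho):=\inf_{\mathcal{R}}D(\rho^{ABE}\|\mathcal{R}(\rho^{AE}))$, where the infimum is over all quantum operations $\mathcal{R}$ from $E$ to $BE$, $\rho^{AE}={\rm Tr}_B[\rho^{ABE}]$, and $D(\rho\|\sigma)={\rm Tr}[\rho(\log\rho-\log\sigma)]$ is the quantum relative entropy ($+\infty$ if the support of $\rho$ is not contained in that of $\sigma$). $A$, $B$, $E$ denote everything held by Alice, Bob and Eve, respectively, in the state under consideration. *)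

theory Defs
  imports
    "HOL-Library.Extended_Real"
    "HOL.Transcendental"
    "Jordan_Normal_Form.Schur_Decomposition"
    "Jordan_Normal_Form.Matrix_Kernel"
begin

section \<open>States\<close>

text \<open>
  An \<open>n\<close>-dimensional Hilbert space is \<open>\<complex>\<^sup>n\<close>, and its operators are the \<open>n \<times> n\<close> complex matrices.
  A tensor product of spaces of dimensions \<open>d\<^sub>1, \<dots>, d\<^sub>k\<close> has dimension \<open>d\<^sub>1 * \<dots> * d\<^sub>k\<close> and its basis
  is ordered lexicographically, so that \<open>|i\<rangle> \<otimes> |j\<rangle>\<close> (with \<open>j\<close> ranging below \<open>q\<close>) is the
  basis vector with index \<open>i * q + j\<close>. With this convention the tensor product is associative on
  the nose. Since \<open>u \<bullet>c v\<close> is conjugate-linear in \<open>v\<close>, the number \<open>\<langle>v|A|v\<rangle>\<close> is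
  \<open>(A *\<^sub>v v) \<bullet>c v\<close>; the order on the complex numbers used below is the one in which
  \<open>0 \<le> z\<close> says that \<open>z\<close> is a nonnegative real.
\<close>

definition mat_trace :: "complex mat \<Rightarrow> complex" where
  "mat_trace A = (\<Sum>i<dim_row A. A $$ (i, i))"

definition psd :: "nat \<Rightarrow> complex mat \<Rightarrow> bool" where
  "psd n A \<longleftrightarrow> A \<in> carrier_mat n n \<and> (\<forall>v \<in> carrier_vec n. 0 \<le> (A *\<^sub>v v) \<bullet>c v)"

definition density_ops :: "nat \<Rightarrow> complex mat set" where
  "density_ops n = {\<rho>. psd n \<rho> \<and> mat_trace \<rho> = 1}"

definition kron :: "complex mat \<Rightarrow> complex mat \<Rightarrow> complex mat" where
  "kron A B = mat (dim_row A * dim_row B) (dim_col A * dim_col B)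
     (\<lambda>(i, j). A $$ (i div dim_row B, j div dim_col B) * B $$ (i mod dim_row B, j mod dim_col B))"

definition proj :: "complex vec \<Rightarrow> complex mat" where
  "proj v = mat (dim_vec v) (dim_vec v) (\<lambda>(i, j). v $ i * cnj (v $ j))"

definition mat_sum :: "nat \<Rightarrow> nat \<Rightarrow> (nat \<Rightarrow> complex mat) \<Rightarrow> complex mat" where
  "mat_sum d n f = mat d d (\<lambda>ij. \<Sum>m<n. f m $$ ij)"

text \<open>\<open>Tr\<^sub>B\<close> for an operator on \<open>A \<otimes> B \<otimes> E\<close>, where the spaces have dimensions \<open>a, b, e\<close>.\<close>

definition ptrace_mid :: "nat \<Rightarrow> nat \<Rightarrow> nat \<Rightarrow> complex mat \<Rightarrow> complex mat" where
  "ptrace_mid a b e X = mat (a * e) (a * e)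
     (\<lambda>(i, j). \<Sum>t<b. X $$ ((i div e * b + t) * e + i mod e, (j div e * b + t) * e + j mod e))"

text \<open>
  Reordering of tensor factors: an operator on \<open>P \<otimes> Q \<otimes> R \<otimes> S\<close> (dimensions \<open>p, q, r, s\<close>) as an
  operator on \<open>P \<otimes> R \<otimes> Q \<otimes> S\<close>. The function \<open>swap_index q r s\<close> sends the index of
  \<open>|x\<rangle>|y\<rangle>|z\<rangle>|w\<rangle>\<close> in the latter space to that of \<open>|x\<rangle>|z\<rangle>|y\<rangle>|w\<rangle>\<close> in the former.
\<close>

definition swap_index :: "nat \<Rightarrow> nat \<Rightarrow> nat \<Rightarrow> nat \<Rightarrow> nat" where
  "swap_index q r s i =
     (let w = i mod s; z = i div s mod q; y = i div s div q mod r; x = i div s div q div r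
      in ((x * q + z) * r + y) * s + w)"

definition swap_mid :: "nat \<Rightarrow> nat \<Rightarrow> nat \<Rightarrow> nat \<Rightarrow> complex mat \<Rightarrow> complex mat" where
  "swap_mid p q r s X = mat (p * r * q * s) (p * r * q * s)
     (\<lambda>(i, j). X $$ (swap_index q r s i, swap_index q r s j))"


section \<open>Quantum operations\<close>

text \<open>
  \<open>apply_on p n m q F\<close> is \<open>id\<^sub>p \<otimes> F \<otimes> id\<^sub>q\<close> for a linear map \<open>F\<close> from \<open>n \<times> n\<close> to \<open>m \<times> m\<close>
  matrices: \<open>F\<close> is applied to each of the \<open>n \<times> n\<close> blocks that one gets by fixing the row and the
  column indices of the outer two factors.
\<close>

definition apply_on ::
  "nat \<Rightarrow> nat \<Rightarrow> nat \<Rightarrow> nat \<Rightarrow> (complex mat \<Rightarrow> complex mat) \<Rightarrow> complex mat \<Rightarrow> complex mat" where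
  "apply_on p n m q F X = mat (p * m * q) (p * m * q)
     (\<lambda>(i, j). F (mat n n (\<lambda>(k, l). X $$ ((i div q div m * n + k) * q + i mod q,
                                          (j div q div m * n + l) * q + j mod q)))
               $$ (i div q mod m, j div q mod m))"

definition linear_map :: "nat \<Rightarrow> nat \<Rightarrow> (complex mat \<Rightarrow> complex mat) \<Rightarrow> bool" where
  "linear_map n m F \<longleftrightarrow>
     (\<forall>X \<in> carrier_mat n n. F X \<in> carrier_mat m m) \<and>
     (\<forall>X \<in> carrier_mat n n. \<forall>Y \<in> carrier_mat n n. F (X + Y) = F X + F Y) \<and>
     (\<forall>X \<in> carrier_mat n n. \<forall>c. F (c \<cdot>\<^sub>m X) = c \<cdot>\<^sub>m F X)"

definition completely_positive :: "nat \<Rightarrow> nat \<Rightarrow> (complex mat \<Rightarrow> complex mat) \<Rightarrow> bool" where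
  "completely_positive n m F \<longleftrightarrow>
     (\<forall>k X. psd (k * n) X \<longrightarrow> psd (k * m) (apply_on k n m 1 F X))"

definition trace_preserving :: "nat \<Rightarrow> (complex mat \<Rightarrow> complex mat) \<Rightarrow> bool" where
  "trace_preserving n F \<longleftrightarrow> (\<forall>X \<in> carrier_mat n n. mat_trace (F X) = mat_trace X)"

definition cptp :: "nat \<Rightarrow> nat \<Rightarrow> (complex mat \<Rightarrow> complex mat) \<Rightarrow> bool" where
  "cptp n m F \<longleftrightarrow> linear_map n m F \<and> completely_positive n m F \<and> trace_preserving n F"

definition reversible :: "nat \<Rightarrow> nat \<Rightarrow> (complex mat \<Rightarrow> complex mat) \<Rightarrow> bool" where
  "reversible n m V \<longleftrightarrow>
     cptp n m V \<and> (\<exists>V'. cptp m n V' \<and> (\<forall>\<rho> \<in> density_ops n. V' (V \<rho>) = \<rho>))"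

text \<open>The index formulas above act on product operators as they should.\<close>

lemma div_mod_less: "i < p * q \<Longrightarrow> i div q < p \<and> i mod q < (q::nat)"
  by (metis less_mult_imp_div_less mod_less_divisor mult_0_right neq0_conv not_less0)

lemma kron_carrier: "A \<in> carrier_mat a a \<Longrightarrow> B \<in> carrier_mat b b \<Longrightarrow> kron A B \<in> carrier_mat (a*b) (a*b)"
  by (auto simp: kron_def)

lemma mixed_radix_less: assumes "i < a" "k < b" shows "i * b + k < a * (b::nat)"
proof -
  have "i * b + k < Suc i * b" using assms by simp
  also have "\<dots> \<le> a * b" using assms by (intro mult_le_mono1) simp
  finally show ?thesis .
qed

lemma kron_index: assumes "A \<in> carrier_mat a a" "B \<in> carrier_mat b b" "i < a" "j < a" "k < b" "l < b"
  shows "kron A B $$ (i * b + k, j * b + l) = A $$ (i,j) * B $$ (k,l)"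
proof -
  have "i * b + k < a * b" "j * b + l < a * b"
    using assms by (simp_all add: mixed_radix_less)
  then show ?thesis using assms by (simp add: kron_def)
qed

lemma apply_on_kron:
  assumes A: "A \<in> carrier_mat p p" and X: "X \<in> carrier_mat n n" and B: "B \<in> carrier_mat q q"
    and F: "linear_map n m F"
  shows "apply_on p n m q F (kron (kron A X) B) = kron (kron A (F X)) B"
proof (rule eq_matI)
  have FX: "F X \<in> carrier_mat m m" using F X by (auto simp: linear_map_def)
  note k = kron_carrier[OF kron_carrier[OF A FX] B] kron_carrier[OF A X] kron_carrier[OF A FX]
  fix i j assume ij: "i < dim_row (kron (kron A (F X)) B)" "j < dim_col (kron (kron A (F X)) B)"
  then have ij: "i < p * m * q" "j < p * m * q" using k by auto
  let ?M = "mat n n (\<lambda>(r, l). kron (kron A X) B $$ ((i div q div m * n + r) * q + i mod q,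
                                          (j div q div m * n + l) * q + j mod q))"
  have d: "i div q < p * m" "j div q < p * m" "i mod q < q" "j mod q < q"
    "i div q div m < p" "i div q mod m < m" "j div q div m < p" "j div q mod m < m"
    using ij by (auto dest: div_mod_less)
  define c where "c = A $$ (i div q div m, j div q div m) * B $$ (i mod q, j mod q)"
  have "?M = c \<cdot>\<^sub>m X"
    using d X by (intro eq_matI) (auto simp: kron_index[OF k(2) B] kron_index[OF A X] mixed_radix_less c_def)
  then have "F ?M = c \<cdot>\<^sub>m F X" using F X by (auto simp: linear_map_def)
  then have "apply_on p n m q F (kron (kron A X) B) $$ (i,j) = c * F X $$ (i div q mod m, j div q mod m)"
    using ij d FX by (simp add: apply_on_def)
  also have "\<dots> = kron (kron A (F X)) B $$ ((i div q div m * m + i div q mod m) * q + i mod q, (j div q div m * m + j div q mod m) * q + j mod q)"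
    using d by (subst kron_index[OF k(3) B]; (subst kron_index[OF A FX])?) (auto simp: mixed_radix_less c_def simp del: div_mult_mod_eq)
  also have "\<dots> = kron (kron A (F X)) B $$ (i,j)" by simp
  finally show "apply_on p n m q F (kron (kron A X) B) $$ (i,j) = kron (kron A (F X)) B $$ (i,j)" .
qed (use assms in \<open>auto simp: apply_on_def kron_def linear_map_def\<close>)

lemma ptrace_kron:
  assumes A: "A \<in> carrier_mat a a" and B: "B \<in> carrier_mat b b" and C: "C \<in> carrier_mat e e"
  shows "ptrace_mid a b e (kron (kron A B) C) = mat_trace B \<cdot>\<^sub>m kron A C"
proof (rule eq_matI)
  fix i j assume "i < dim_row (mat_trace B \<cdot>\<^sub>m kron A C)" "j < dim_col (mat_trace B \<cdot>\<^sub>m kron A C)"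
  then have ij: "i < a * e" "j < a * e" using A C by (auto simp: kron_def)
  then have d: "i div e < a" "j div e < a" "i mod e < e" "j mod e < e" by (auto dest: div_mod_less)
  show "ptrace_mid a b e (kron (kron A B) C) $$ (i,j) = (mat_trace B \<cdot>\<^sub>m kron A C) $$ (i,j)"
  proof -
    have "(mat_trace B \<cdot>\<^sub>m kron A C) $$ (i,j) = mat_trace B * (A $$ (i div e, j div e) * C $$ (i mod e, j mod e))"
      using ij A C by (simp add: kron_def)
    then show ?thesis
    using ij d B by (auto simp: ptrace_mid_def kron_index[OF kron_carrier[OF A B] C] kron_index[OF A B] mixed_radix_less
       mat_trace_def sum_distrib_right sum_distrib_left intro!: sum.cong)
  qed
qed (use assms in \<open>auto simp: ptrace_mid_def kron_def\<close>)

lemma swap_kron: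
  assumes A: "A \<in> carrier_mat p p" and B: "B \<in> carrier_mat q q" and C: "C \<in> carrier_mat r r" and D: "D \<in> carrier_mat s s"
  shows "swap_mid p q r s (kron (kron (kron A B) C) D) = kron (kron (kron A C) B) D"
proof (rule eq_matI)
  note AB = kron_carrier[OF A B] note ABC = kron_carrier[OF AB C]
  note AC = kron_carrier[OF A C] note ACB = kron_carrier[OF AC B]
  fix i j assume "i < dim_row (kron (kron (kron A C) B) D)" "j < dim_col (kron (kron (kron A C) B) D)"
  then have ij: "i < p * r * q * s" "j < p * r * q * s" using kron_carrier[OF ACB D] by auto
  have *: "\<exists>x y z w. i = ((x * r + y) * q + z) * s + w \<and> x < p \<and> y < r \<and> z < q \<and> w < s" if "i < p * r * q * s" for i
  proof -
    from that have "i div s < p * r * q" "i mod s < s" by (auto dest: div_mod_less)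
    moreover then have "i div s div q < p * r" "i div s mod q < q" by (auto dest: div_mod_less)
    moreover then have "i div s div q div r < p" "i div s div q mod r < r" by (auto dest: div_mod_less)
    ultimately show ?thesis
      by (intro exI[of _ "i div s div q div r"] exI[of _ "i div s div q mod r"] exI[of _ "i div s mod q"] exI[of _ "i mod s"]) simp
  qed
  obtain x y z w where i: "i = ((x * r + y) * q + z) * s + w" "x < p" "y < r" "z < q" "w < s" using *[OF ij(1)] by blast
  obtain x' y' z' w' where j: "j = ((x' * r + y') * q + z') * s + w'" "x' < p" "y' < r" "z' < q" "w' < s" using *[OF ij(2)] by blast
  have "swap_index q r s i = ((x * q + z) * r + y) * s + w" "swap_index q r s j = ((x' * q + z') * r + y') * s + w'"
    using i j by (simp_all add: swap_index_def Let_def)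
  then show "swap_mid p q r s (kron (kron (kron A B) C) D) $$ (i,j) = kron (kron (kron A C) B) D $$ (i,j)"
    using ij apply (simp add: swap_mid_def)
    unfolding i(1) j(1) using i(2-) j(2-)
    by (simp add: kron_index[OF ABC D] kron_index[OF AB C] kron_index[OF A B] kron_index[OF ACB D] kron_index[OF AC B] kron_index[OF A C] mixed_radix_less)
qed (use assms in \<open>auto simp: swap_mid_def kron_def\<close>)


section \<open>Relative entropy of recovery\<close>

definition unitary_mat :: "nat \<Rightarrow> complex mat \<Rightarrow> bool" where
  "unitary_mat n U \<longleftrightarrow> U \<in> carrier_mat n n \<and> U * mat_adjoint U = 1\<^sub>m n \<and> mat_adjoint U * U = 1\<^sub>m n"

definition real_diag :: "nat \<Rightarrow> (nat \<Rightarrow> real) \<Rightarrow> complex mat" where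
  "real_diag n d = mat n n (\<lambda>(i, j). if i = j then complex_of_real (d i) else 0)"

text \<open>
  The logarithm of a positive semidefinite matrix through its spectral decomposition; it does not
  depend on the decomposition (lemma \<open>mat_log_unique\<close> below). As \<open>log 2 0 = 0\<close> in HOL, the
  logarithm is taken on the support and is \<open>0\<close> on the kernel, which is the usual convention
  \<open>0 log 0 = 0\<close> in the relative entropy.
\<close>

definition is_mat_log :: "nat \<Rightarrow> complex mat \<Rightarrow> complex mat \<Rightarrow> bool" where
  "is_mat_log n A L \<longleftrightarrow>
     (\<exists>U d. unitary_mat n U \<and> A = U * real_diag n d * mat_adjoint U \<and>
            L = U * real_diag n (\<lambda>i. log 2 (d i)) * mat_adjoint U)"

definition mat_log :: "nat \<Rightarrow> complex mat \<Rightarrow> complex mat" where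
  "mat_log n A = (THE L. is_mat_log n A L)"

lemma carrier_adjoint: "A \<in> carrier_mat n m \<Longrightarrow> mat_adjoint A \<in> carrier_mat m n"
  unfolding mat_adjoint_def by auto

lemma diag_left: "W \<in> carrier_mat n n \<Longrightarrow> i < n \<Longrightarrow> j < n \<Longrightarrow> (real_diag n d * W) $$ (i,j) = of_real (d i) * W $$ (i,j)"
  by (simp add: real_diag_def scalar_prod_def if_distrib[of "\<lambda>x. x * _"] cong: if_cong)

lemma diag_right: "W \<in> carrier_mat n n \<Longrightarrow> i < n \<Longrightarrow> j < n \<Longrightarrow> (W * real_diag n d) $$ (i,j) = of_real (d j) * W $$ (i,j)"
  by (simp add: real_diag_def scalar_prod_def if_distrib[of "\<lambda>x. _ * x"] mult.commute cong: if_cong)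

lemma real_diag_carrier: "real_diag n d \<in> carrier_mat n n"
  by (simp add: real_diag_def)

lemma unitary_conj_iff:
  assumes U: "unitary_mat n U" and V: "unitary_mat n V"
    and D: "D \<in> carrier_mat n n" and D': "D' \<in> carrier_mat n n"
  shows "U * D * mat_adjoint U = V * D' * mat_adjoint V \<longleftrightarrow>
         D * (mat_adjoint U * V) = (mat_adjoint U * V) * D'"
proof -
  let ?u = "mat_adjoint U" and ?v = "mat_adjoint V"
  have c: "U \<in> carrier_mat n n" "V \<in> carrier_mat n n" "?u \<in> carrier_mat n n" "?v \<in> carrier_mat n n"
    using U V by (auto simp: unitary_mat_def carrier_adjoint)
  have i: "U * ?u = 1\<^sub>m n" "?u * U = 1\<^sub>m n" "V * ?v = 1\<^sub>m n" "?v * V = 1\<^sub>m n"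
    using U V by (auto simp: unitary_mat_def)
  have ass: "X * Y * Z = X * (Y * Z)" if "X \<in> carrier_mat n n" "Y \<in> carrier_mat n n" "Z \<in> carrier_mat n n"
    for X Y Z :: "complex mat" using that by (rule assoc_mult_mat)
  show ?thesis
  proof
    assume "U * D * ?u = V * D' * ?v"
    then have "?u * (U * D * ?u) * V = ?u * (V * D' * ?v) * V" by simp
    moreover have "?u * (U * D * ?u) * V = (?u * U) * D * (?u * V)"
      using c D by (simp add: ass)
    moreover have "?u * (V * D' * ?v) * V = (?u * V) * D' * (?v * V)"
      using c D' by (simp add: ass)
    ultimately show "D * (?u * V) = (?u * V) * D'"
      using c D D' i by simp
  next
    assume *: "D * (?u * V) = (?u * V) * D'"
    have "U * D * ?u = U * (D * (?u * V)) * ?v"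
      using c D i by (simp add: ass)
    also have "\<dots> = (U * ?u) * (V * D' * ?v)"
      unfolding * using c D' by (simp add: ass)
    finally show "U * D * ?u = V * D' * ?v" using c D' i by simp
  qed
qed

lemma mat_log_unique:
  assumes "is_mat_log n A L"
  shows "mat_log n A = L"
  unfolding mat_log_def
proof (rule the_equality[where P = "is_mat_log n A", OF assms])
  fix M assume "is_mat_log n A M"
  then obtain V d' where V: "unitary_mat n V" and A': "A = V * real_diag n d' * mat_adjoint V"
    and M: "M = V * real_diag n (\<lambda>i. log 2 (d' i)) * mat_adjoint V"
    unfolding is_mat_log_def by blast
  from assms obtain U d where U: "unitary_mat n U" and A: "A = U * real_diag n d * mat_adjoint U"
    and L: "L = U * real_diag n (\<lambda>i. log 2 (d i)) * mat_adjoint U"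
    unfolding is_mat_log_def by blast
  define W where "W = mat_adjoint U * V"
  have W: "W \<in> carrier_mat n n"
    unfolding W_def using U V by (auto simp: unitary_mat_def intro!: mult_carrier_mat[of _ _ n] carrier_adjoint)
  have eq: "real_diag n d * W = W * real_diag n d'"
    unfolding W_def by (rule unitary_conj_iff[OF U V real_diag_carrier real_diag_carrier, THEN iffD1])
      (simp flip: A A')
  have "complex_of_real (d i) * W $$ (i,j) = of_real (d' j) * W $$ (i,j)" if "i < n" "j < n" for i j
    using arg_cong[OF eq, of "\<lambda>X. X $$ (i,j)"] that by (simp only: diag_left[OF W that] diag_right[OF W that])
  then have "d i = d' j \<or> W $$ (i,j) = 0" if "i < n" "j < n" for i j
    using that by (metis mult_right_cancel of_real_eq_iff)
  then have "complex_of_real (log 2 (d i)) * W $$ (i,j) = of_real (log 2 (d' j)) * W $$ (i,j)" if "i < n" "j < n" for i j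
    using that by fastforce
  then have "real_diag n (\<lambda>i. log 2 (d i)) * W = W * real_diag n (\<lambda>i. log 2 (d' i))"
    by (intro eq_matI) (use W carrier_matD[OF real_diag_carrier] in \<open>auto simp: diag_left[OF W] diag_right[OF W] simp del: index_mult_mat(1)\<close>)
  then show "M = L"
    unfolding L M W_def
    by (intro unitary_conj_iff[OF U V real_diag_carrier real_diag_carrier, THEN iffD2, symmetric])
qed

definition mat_supp :: "complex mat \<Rightarrow> complex vec set" where
  "mat_supp A = {v \<in> carrier_vec (dim_col A). \<forall>w \<in> mat_kernel A. v \<bullet>c w = 0}"

definition rel_entropy :: "nat \<Rightarrow> complex mat \<Rightarrow> complex mat \<Rightarrow> ereal" where
  "rel_entropy n \<rho> \<sigma> =
     (if mat_supp \<rho> \<subseteq> mat_supp \<sigma>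
      then ereal (Re (mat_trace (\<rho> * (mat_log n \<rho> - mat_log n \<sigma>))))
      else \<infinity>)"

definition D_rec_B :: "nat \<Rightarrow> nat \<Rightarrow> nat \<Rightarrow> complex mat \<Rightarrow> ereal" where
  "D_rec_B a b e \<rho> =
     (INF R \<in> {R. cptp e (b * e) R}.
        rel_entropy (a * b * e) \<rho> (apply_on a e (b * e) 1 R (ptrace_mid a b e \<rho>)))"


section \<open>The operations of the three parties\<close>

text \<open>
  The three parties hold systems of dimensions \<open>(a, b, e)\<close>, in the order \<open>A \<otimes> B \<otimes> E\<close>. Broadcasting
  is only defined on states that are classical on the register \<open>C\<^sub>A\<close>, so operations are partial
  maps. An operation \<open>\<E>\<close> is represented by its graph: \<open>(\<rho>, \<rho>') \<in> \<E>\<close> says that \<open>\<E>\<close> is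
  applicable to the state \<open>\<rho>\<close> and that \<open>\<E>(\<rho>) = \<rho>'\<close>.
\<close>

type_synonym operation = "(complex mat \<times> complex mat) set"

definition on_states :: "nat \<Rightarrow> (complex mat \<Rightarrow> complex mat) \<Rightarrow> operation" where
  "on_states n F = {(\<rho>, F \<rho>) | \<rho>. \<rho> \<in> density_ops n}"

definition orthonormal :: "nat \<Rightarrow> nat \<Rightarrow> (nat \<Rightarrow> complex vec) \<Rightarrow> bool" where
  "orthonormal c n v \<longleftrightarrow>
     (\<forall>i<n. v i \<in> carrier_vec c) \<and>
     (\<forall>i<n. \<forall>j<n. v i \<bullet>c v j = (if i = j then 1 else 0))"

text \<open>
  Broadcasting by Alice of a message held in the register \<open>C\<^sub>A\<close> (dimension \<open>c\<close>) in the orthonormal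
  states \<open>v 0, \<dots>, v (n - 1)\<close>. It goes from \<open>(C\<^sub>A \<otimes> A) \<otimes> B \<otimes> E\<close> to
  \<open>A \<otimes> (C\<^sub>B \<otimes> B) \<otimes> (C\<^sub>E \<otimes> E)\<close>; the two swaps bring the registers of
  \<open>C\<^sub>B \<otimes> C\<^sub>E \<otimes> A \<otimes> B \<otimes> E\<close> to their new holders.
\<close>

definition broadcast :: "nat \<Rightarrow> nat \<Rightarrow> (nat \<Rightarrow> complex vec) \<Rightarrow> nat \<Rightarrow> nat \<Rightarrow> nat \<Rightarrow> operation" where
  "broadcast c n v a b e =
     {(mat_sum (c * (a * b * e)) n
         (\<lambda>m. complex_of_real (p m) \<cdot>\<^sub>m kron (proj (v m)) (\<rho> m)),
       swap_mid (a * c) c b e (swap_mid 1 (c * c) a (b * e)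
         (mat_sum (c * c * (a * b * e)) n
           (\<lambda>m. complex_of_real (p m) \<cdot>\<^sub>m kron (kron (proj (v m)) (proj (v m))) (\<rho> m)))))
      | p \<rho>. (\<forall>m<n. 0 \<le> p m) \<and> (\<Sum>m<n. p m) = 1 \<and> (\<forall>m<n. \<rho> m \<in> density_ops (a * b * e))}"

text \<open>
  \<open>Omega_fwd (a, b, e) (a', b', e') \<E>\<close> says that \<open>\<E>\<close> belongs to \<open>\<Omega>\<^sup>\<rightarrow>\<close> and has these input and
  output dimensions. In \<open>Q_AE\<close>, Alice's system is \<open>A \<otimes> Q\<close> before and Eve's is \<open>Q \<otimes> E\<close> afterwards.
  In \<open>Q_BE\<close>, where Bob holds \<open>B \<otimes> Q\<close>, the factors already are in the right order, so that only the
  division of \<open>A \<otimes> B \<otimes> Q \<otimes> E\<close> among the parties changes and the matrix does not. That a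
  message register or a communicated subsystem sits at this particular place is no restriction, as
  the parties can permute their own subsystems by unitaries in \<open>L_A\<close>, \<open>L_B\<close> and \<open>R_E\<close>.
\<close>

inductive Omega_fwd :: "nat \<times> nat \<times> nat \<Rightarrow> nat \<times> nat \<times> nat \<Rightarrow> operation \<Rightarrow> bool" where
  L_A: "cptp a a' F \<Longrightarrow>
    Omega_fwd (a, b, e) (a', b, e) (on_states (a * b * e) (apply_on 1 a a' (b * e) F))"
| L_B: "cptp b b' F \<Longrightarrow>
    Omega_fwd (a, b, e) (a, b', e) (on_states (a * b * e) (apply_on a b b' e F))"
| R_E: "reversible e e' V \<Longrightarrow>
    Omega_fwd (a, b, e) (a, b, e') (on_states (a * b * e) (apply_on (a * b) e e' 1 V))"
| P_A: "orthonormal c n v \<Longrightarrow>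
    Omega_fwd (c * a, b, e) (a, c * b, c * e) (broadcast c n v a b e)"
| Q_AE: "Omega_fwd (a * q, b, e) (a, b, q * e) (on_states (a * q * b * e) (swap_mid a q b e))"
| Q_BE: "Omega_fwd (a, b * q, e) (a, b, q * e) (on_states (a * b * q * e) (\<lambda>\<rho>. \<rho>))"
| comp: "Omega_fwd d d' \<E> \<Longrightarrow> Omega_fwd d' d'' \<F> \<Longrightarrow> Omega_fwd d d'' (\<E> O \<F>)"

end

theory Submission
  imports Defs "Jordan_Normal_Form.Spectral_Radius"
begin

text \<open>
  For every class of operations there is a quantum operation \<open>G\<close> that describes it on the joint
  system (for broadcasting, on states classical on the register) and turns ``trace out \<open>B\<close>, then
  recover by \<open>R\<close>'' into ``apply \<open>G\<close>, trace out the new \<open>B\<close>, then recover by some \<open>R'\<close>''. Hence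
  monotonicity follows from the data processing inequality for the relative entropy.

  Data processing: for \<open>\<rho> = \<Sum>\<^sub>i p\<^sub>i |u\<^sub>i\<rangle>\<langle>u\<^sub>i|\<close> and \<open>\<sigma> = \<Sum>\<^sub>j q\<^sub>j |v\<^sub>j\<rangle>\<langle>v\<^sub>j|\<close>, put
  \<open>Q\<^sub>t(\<rho>, \<sigma>) = \<Sum>\<^sub>i\<^sub>j |\<langle>u\<^sub>i, v\<^sub>j\<rangle>|\<^sup>2 p\<^sub>i\<^sup>2 / (q\<^sub>j + t p\<^sub>i)\<close>, which equals
  \<open>sup\<^sub>X (2 Re Tr(\<rho> X) - Tr(X\<^sup>\<dagger> \<sigma> X) - t Tr(X \<rho> X\<^sup>\<dagger>))\<close>. Inserting \<open>X = F\<^sup>\<dagger>(Y)\<close>, with \<open>F\<^sup>\<dagger>\<close> the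
  Hilbert-Schmidt dual of a quantum operation \<open>F\<close>, and using the Schwarz inequality shows that
  \<open>Q\<^sub>t(F \<rho>, F \<sigma>) \<le> Q\<^sub>t(\<rho>, \<sigma>)\<close>. Integration over \<open>t\<close> gives the relative entropy, and \<open>t \<rightarrow> 0\<close> gives
  the inclusion of supports.
\<close>

section \<open>Hermitian matrices\<close>

text \<open>The variational form of Q_t contains neither an inverse of \<open>\<sigma>\<close> nor a
  function of an operator, so singular states need no limiting argument, and a linear map enters
  only through positivity of its extension by a qubit and through the trace. The supremum is
  computable because left multiplication by \<open>\<sigma>\<close> commutes with right
  multiplication by \<open>\<rho>\<close>, even though the two states do not commute; what remains
  after it is calculus with nonnegative numbers. Zero denominators are harmless: for t > 0 they
  force p_i = 0, and HOL puts 0 / 0 = 0. On the side of the recovery maps the delicate case is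
  broadcasting. It is a partial map, and a quantum operation that extends it copies the register
  coherently. Tracing out Bob's copy destroys these coherences, so the required exchange of partial
  trace and recovery holds only at states that are classical on the register. The reduction to data
  processing is therefore formulated for a single state. Identities between composite maps are
  otherwise verified on product operators and extended by linearity.\<close>

lemma adjoint_dims[simp]: "dim_row (mat_adjoint A) = dim_col A" "dim_col (mat_adjoint A) = dim_row A"
  by (auto simp: mat_adjoint_def)

lemma adjoint_index[simp]: "i < dim_col A \<Longrightarrow> j < dim_row A \<Longrightarrow> mat_adjoint A $$ (i,j) = cnj (A $$ (j,i))"
  for A :: "complex mat"
  by (simp add: mat_adjoint_def mat_of_rows_index)

lemma adjoint_adjoint[simp]: "mat_adjoint (mat_adjoint A) = (A :: complex mat)"
  by (rule eq_matI) auto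

lemma adjoint_mult:
  assumes "A \<in> carrier_mat n m" "B \<in> carrier_mat m k"
  shows "mat_adjoint (A * B) = mat_adjoint B * mat_adjoint (A :: complex mat)"
  using assms by (intro eq_matI) (auto simp: scalar_prod_def mult.commute intro!: sum.cong)

lemma quad_form:
  assumes "A \<in> carrier_mat n n" "v \<in> carrier_vec n"
  shows "(A *\<^sub>v v) \<bullet>c v = (\<Sum>i<n. \<Sum>j<n. A $$ (i,j) * v $ j * cnj (v $ i))"
  using assms by (auto simp: scalar_prod_def sum_distrib_right atLeast0LessThan intro!: sum.cong)

text \<open>Probes individual entries of \<open>A\<close>. The two summands of \<open>v\<close> add
  up when \<open>i = j\<close>, so the formula needs no case distinction, and with
  \<open>i = j\<close>, \<open>x = 1\<close>, \<open>y = 0\<close> it isolates a diagonal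
  entry.\<close>

lemma quad_form_two:
  fixes x y :: complex
  assumes A: "A \<in> carrier_mat n n" and ij: "i < n" "j < n"
  defines "v \<equiv> vec n (\<lambda>k. (if k = i then x else 0) + (if k = j then y else 0))"
  shows "(A *\<^sub>v v) \<bullet>c v = A $$ (i,i) * x * cnj x + A $$ (i,j) * y * cnj x + A $$ (j,i) * x * cnj y
    + A $$ (j,j) * y * cnj y"
proof -
  have "(A *\<^sub>v v) \<bullet>c v = (\<Sum>k<n. \<Sum>l<n. A $$ (k,l) * v $ l * cnj (v $ k))"
    by (rule quad_form[OF A]) (simp add: v_def)
  also have "\<dots> = (\<Sum>k<n. (A $$ (k,i) * x + A $$ (k,j) * y) * cnj (v $ k))"
    by (rule sum.cong) (use ij in \<open>simp_all add: v_def distrib_left sum.distrib if_distrib[of "\<lambda>x. _ * x"]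
        if_distrib[of "\<lambda>x. x * _"] distrib_right sum_distrib_right[symmetric] cong: if_cong\<close>)
  also have "\<dots> = (A $$ (i,i) * x + A $$ (i,j) * y) * cnj x + (A $$ (j,i) * x + A $$ (j,j) * y) * cnj y"
    by (use ij in \<open>simp add: v_def distrib_left sum.distrib if_distrib[of "\<lambda>x. _ * x"]
        if_distrib[of cnj] cong: if_cong\<close>)
  finally show ?thesis by (simp add: algebra_simps)
qed

text \<open>Hermiticity is not part of \<open>psd\<close>. It follows because the complex order
  forces every value of the quadratic form to be real: the coefficients (1,0), (0,1), (1,1) and
  (1,\<i>) determine the relation between opposite entries.\<close>

lemma psd_hermitian:
  assumes "psd n A" shows "mat_adjoint A = A"
proof (rule eq_matI)
  have A: "A \<in> carrier_mat n n" using assms by (simp add: psd_def)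
  fix i j assume "i < dim_row A" "j < dim_col A"
  then have ij: "i < n" "j < n" using A by auto
  have q: "0 \<le> A $$ (i,i) * x * cnj x + A $$ (i,j) * y * cnj x + A $$ (j,i) * x * cnj y
    + A $$ (j,j) * y * cnj y" for x y
    unfolding quad_form_two[OF A ij, symmetric] using assms by (simp add: psd_def)
  have "Im (A $$ (i,i)) = 0" "Im (A $$ (j,j)) = 0"
    using q[of 1 0] q[of 0 1] by (auto simp: less_eq_complex_def)
  moreover have "Im (A $$ (i,j)) + Im (A $$ (j,i)) = 0"
    using q[of 1 1] calculation by (auto simp: less_eq_complex_def)
  moreover have "Re (A $$ (i,j)) = Re (A $$ (j,i))"
    using q[of 1 \<i>] calculation by (auto simp: less_eq_complex_def)
  ultimately show "mat_adjoint A $$ (i,j) = A $$ (i,j)"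
    using ij A by (simp add: complex_eq_iff)
qed (use assms in \<open>auto simp: psd_def\<close>)

text \<open>Provides the change of basis for one deflation step of the spectral theorem.
  Gram-Schmidt returns orthogonal vectors that are not normalised, hence the division by
  \<open>r\<close>; the scalar \<open>c\<close> absorbs the norm of \<open>v\<close>.\<close>

lemma unitary_with_first_col:
  fixes v :: "complex vec"
  assumes v: "v \<in> carrier_vec n" and v0: "v \<noteq> 0\<^sub>v n"
  shows "\<exists>U c. unitary_mat n U \<and> col U 0 = c \<cdot>\<^sub>v v"
proof -
  interpret cof_vec_space n "TYPE(complex)" .
  define b where "b = basis_completion v"
  define ws where "ws = gram_schmidt n b"
  from basis_completion[OF v v0, folded b_def]
  have dist_b: "distinct b" 
    and indep: "\<not> lin_dep (set b)" and b: "set b \<subseteq> carrier_vec n" and hdb: "hd b = v" 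
    and len_b: "length b = n" by auto
  have n: "n > 0" using v v0 by (cases n) auto
  from hdb len_b n obtain vs where bv: "b = v # vs" by (cases b, auto)
  from gram_schmidt_result[OF b dist_b indep refl, folded ws_def]
  have ws: "set ws \<subseteq> carrier_vec n" "corthogonal ws" "length ws = n" 
    by (auto simp: len_b)
  from gram_schmidt_hd[OF v, of vs, folded bv] have hdws: "hd ws = v" unfolding ws_def .
  define r where "r j = csqrt (ws ! j \<bullet>c ws ! j)" for j
  have wsc: "ws ! j \<in> carrier_vec n" if "j < n" for j using ws that by auto
  have r: "r j * cnj (r j) = ws ! j \<bullet>c ws ! j" "r j \<noteq> 0" if "j < n" for j
  proof -
    have "ws ! j \<bullet>c ws ! j \<noteq> 0" using corthogonalD[OF ws(2), of j j] that ws(3) by auto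
    then show "r j \<noteq> 0" unfolding r_def by simp
    have "ws ! j \<bullet>c ws ! j \<ge> 0" by (rule conjugate_square_ge_0_vec)
    then obtain s where s: "ws ! j \<bullet>c ws ! j = complex_of_real s" "s \<ge> 0"
      by (intro that[of "Re (ws ! j \<bullet>c ws ! j)"]) (auto simp: less_eq_complex_def complex_eq_iff)
    show "r j * cnj (r j) = ws ! j \<bullet>c ws ! j"
      using s by (simp add: r_def csqrt_of_real_nonneg flip: of_real_mult)
  qed
  define U where "U = mat n n (\<lambda>(i,j). ws ! j $ i / r j)"
  have U: "U \<in> carrier_mat n n" by (simp add: U_def)
  have "mat_adjoint U * U = 1\<^sub>m n"
  proof (rule eq_matI)
    fix i j assume "i < dim_row (1\<^sub>m n)" "j < dim_col (1\<^sub>m n)"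
    then have ij: "i < n" "j < n" by auto
    have "(mat_adjoint U * U) $$ (i,j) = (\<Sum>k<n. cnj (ws ! i $ k) * ws ! j $ k) / (cnj (r i) * r j)"
      using ij by (simp add: scalar_prod_def U_def sum_divide_distrib atLeast0LessThan)
    also have "(\<Sum>k<n. cnj (ws ! i $ k) * ws ! j $ k) = ws ! j \<bullet>c ws ! i"
      using wsc[OF ij(1)] wsc[OF ij(2)] by (auto simp: scalar_prod_def atLeast0LessThan mult.commute intro!: sum.cong)
    also have "ws ! j \<bullet>c ws ! i / (cnj (r i) * r j) = (1\<^sub>m n) $$ (i,j)"
      using ij r(1)[OF ij(1)] r(2)[OF ij(1)] corthogonalD[OF ws(2), of j i] ws(3)
      by (cases "i = j") (auto simp: mult.commute divide_simps)
    finally show "(mat_adjoint U * U) $$ (i,j) = (1\<^sub>m n) $$ (i,j)" .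
  qed (use U in auto)
  moreover then have "U * mat_adjoint U = 1\<^sub>m n"
    using U by (intro mat_mult_left_right_inverse[OF carrier_adjoint[OF U] U])
  moreover have "col U 0 = (1 / r 0) \<cdot>\<^sub>v v"
  proof -
    have "ws ! 0 = v" using hdws ws(3) n by (cases ws) auto
    then show ?thesis using n v by (auto simp: U_def)
  qed
  ultimately show ?thesis unfolding unitary_mat_def using U by blast
qed

lemma unitary_mult:
  assumes "unitary_mat n U" "unitary_mat n V" shows "unitary_mat n (U * V)"
proof -
  have c: "U \<in> carrier_mat n n" "V \<in> carrier_mat n n" using assms by (auto simp: unitary_mat_def)
  note a = c[THEN carrier_adjoint]
  have "(U * V) * mat_adjoint (U * V) = U * (V * mat_adjoint V) * mat_adjoint U"
    using c a by (simp add: adjoint_mult[OF c] assoc_mult_mat[of _ n n _ n _ n])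
  moreover have "mat_adjoint (U * V) * (U * V) = mat_adjoint V * (mat_adjoint U * U) * V"
    using c a by (simp add: adjoint_mult[OF c] assoc_mult_mat[of _ n n _ n _ n])
  ultimately show ?thesis using assms c by (auto simp: unitary_mat_def)
qed

text \<open>Deflation: in an orthonormal basis that starts with an eigenvector, column 0 vanishes
  below the diagonal. Hermiticity carries these zeros over to row 0 and makes the eigenvalue real,
  so an \<open>n\<close>-dimensional Hermitian block \<open>C\<close> remains for the
  induction.\<close>

theorem spectral_theorem:
  assumes "A \<in> carrier_mat n n" "mat_adjoint A = A"
  shows "\<exists>U d. unitary_mat n U \<and> A = U * real_diag n d * mat_adjoint U"
  using assms
proof (induction n arbitrary: A)
  case 0
  then show ?case
    by (intro exI[of _ "1\<^sub>m 0"] exI[of _ "\<lambda>_. 0"]) (auto simp: unitary_mat_def intro!: eq_matI)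
next
  case (Suc n)
  note A = Suc.prems(1) and hA = Suc.prems(2)
  obtain ev where "eigenvalue A ev"
    using spectrum_non_empty[OF A] by (auto simp: spectrum_def)
  then obtain v where v: "v \<in> carrier_vec (Suc n)" "v \<noteq> 0\<^sub>v (Suc n)" "A *\<^sub>v v = ev \<cdot>\<^sub>v v"
    using A unfolding eigenvalue_def eigenvector_def by auto
  obtain W c where W: "unitary_mat (Suc n) W" and Wc: "col W 0 = c \<cdot>\<^sub>v v"
    using unitary_with_first_col[OF v(1,2)] by blast
  have Wm: "W \<in> carrier_mat (Suc n) (Suc n)" and Wa: "mat_adjoint W \<in> carrier_mat (Suc n) (Suc n)"
    using W by (auto simp: unitary_mat_def carrier_adjoint)
  define B where "B = mat_adjoint W * A * W"
  have B: "B \<in> carrier_mat (Suc n) (Suc n)" unfolding B_def using Wm Wa A by auto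
  have hB: "mat_adjoint B = B"
    unfolding B_def using Wm Wa A hA
    by (simp add: adjoint_mult[of _ "Suc n" "Suc n" _ "Suc n"] assoc_mult_mat[of _ "Suc n" "Suc n" _ "Suc n" _ "Suc n"])
  have AW: "W * B * mat_adjoint W = A"
  proof -
    have "W * B * mat_adjoint W = (W * mat_adjoint W) * A * (W * mat_adjoint W)"
      unfolding B_def using Wm Wa A by (simp add: assoc_mult_mat[of _ "Suc n" "Suc n" _ "Suc n" _ "Suc n"])
    then show ?thesis using W A by (simp add: unitary_mat_def)
  qed
  have B0: "B $$ (i,0) = (if i = 0 then ev else 0)" if "i < Suc n" for i
  proof -
    have "col B 0 = mat_adjoint W *\<^sub>v (A *\<^sub>v col W 0)"
      unfolding B_def using Wm Wa A by (auto simp: col_mult2[of _ "Suc n" "Suc n" _ "Suc n"] assoc_mult_mat[of _ "Suc n" "Suc n" _ "Suc n" _ "Suc n"] simp del: col_mult)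
    also have "A *\<^sub>v col W 0 = ev \<cdot>\<^sub>v col W 0"
      using v A by (simp add: Wc mult_mat_vec[of _ "Suc n" "Suc n"] smult_smult_assoc mult.commute)
    also have "mat_adjoint W *\<^sub>v (ev \<cdot>\<^sub>v col W 0) = ev \<cdot>\<^sub>v col (mat_adjoint W * W) 0"
      using Wm Wa by (simp add: mult_mat_vec[OF Wa, of "col W 0"] col_mult2[of _ "Suc n" "Suc n" _ "Suc n"] carrier_vecI del: col_mult)
    also have "\<dots> = ev \<cdot>\<^sub>v unit_vec (Suc n) 0" using W by (simp add: unitary_mat_def)
    finally have "col B 0 $ i = (ev \<cdot>\<^sub>v unit_vec (Suc n) 0) $ i" by simp
    then show ?thesis using that B by (auto simp: unit_vec_def)
  qed
  have B0': "B $$ (0,i) = (if i = 0 then ev else 0)" if "i < Suc n" for i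
    using B0[OF that] adjoint_index[of 0 B i] hB B that B0[of 0] by auto
  have ev: "ev = complex_of_real (Re ev)"
    using adjoint_index[of 0 B 0] hB B B0[of 0] by (simp add: complex_eq_iff)
  define C where "C = mat n n (\<lambda>(i,j). B $$ (Suc i, Suc j))"
  have "mat_adjoint C = C"
  proof (rule eq_matI)
    fix i j assume "i < dim_row C" "j < dim_col C"
    then show "mat_adjoint C $$ (i,j) = C $$ (i,j)"
      using adjoint_index[of "Suc i" B "Suc j"] hB B by (simp add: C_def)
  qed (auto simp: C_def)
  then obtain U d where U: "unitary_mat n U" and C: "C = U * real_diag n d * mat_adjoint U"
    using Suc.IH[of C] by (auto simp: C_def)
  have Um: "U \<in> carrier_mat n n" and Ua: "mat_adjoint U \<in> carrier_mat n n"
    using U by (auto simp: unitary_mat_def carrier_adjoint)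
  \<comment> \<open>\<open>bl\<close> is the block diagonal embedding. It respects products and
    adjoints, so a diagonalisation of \<open>C\<close> lifts to one of \<open>B\<close>.\<close>
  define bl where "bl x Y = four_block_mat (mat 1 1 (\<lambda>_. x)) (0\<^sub>m 1 n) (0\<^sub>m n 1) Y" for x :: complex and Y
  have bl_carrier: "bl x Y \<in> carrier_mat (Suc n) (Suc n)" if "Y \<in> carrier_mat n n" for x Y
    using that by (auto simp: bl_def)
  have bl_mult: "bl x X * bl y Y = bl (x * y) (X * Y)"
    if "X \<in> carrier_mat n n" "Y \<in> carrier_mat n n" for x y :: complex and X Y
  proof -
    have "mat 1 1 (\<lambda>_. x) * mat 1 1 (\<lambda>_. y) = mat 1 1 (\<lambda>_. x * y)"
      by (rule eq_matI) (auto simp: scalar_prod_def)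
    then show ?thesis using that unfolding bl_def
      by (subst mult_four_block_mat[where ?nr1.0=1 and ?n1.0=1 and ?n2.0=n and ?nr2.0=n and ?nc1.0=1 and ?nc2.0=n]) auto
  qed
  have bl_adj: "mat_adjoint (bl x X) = bl (cnj x) (mat_adjoint X)"
    if "X \<in> carrier_mat n n" for x :: complex and X
    unfolding bl_def using that by (intro eq_matI) auto
  have bl_one: "bl 1 (1\<^sub>m n) = (1\<^sub>m (Suc n) :: complex mat)"
    unfolding bl_def by (rule eq_matI) auto
  define V where "V = bl 1 U"
  have V: "unitary_mat (Suc n) V"
    using U unfolding unitary_mat_def V_def
    by (auto simp: bl_adj bl_mult bl_carrier Um Ua bl_one)
  have "real_diag (Suc n) (\<lambda>i. if i = 0 then Re ev else d (i - 1)) = bl ev (real_diag n d)"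
    by (rule eq_matI) (auto simp: bl_def real_diag_def ev[symmetric])
  then have "V * real_diag (Suc n) (\<lambda>i. if i = 0 then Re ev else d (i - 1)) * mat_adjoint V = bl ev C"
    unfolding V_def C using Um Ua real_diag_carrier[of n d] by (simp add: bl_adj bl_mult)
  also have "\<dots> = B"
    using B B0 B0' by (intro eq_matI) (auto simp: C_def bl_def)
  finally have VB: "V * real_diag (Suc n) (\<lambda>i. if i = 0 then Re ev else d (i - 1)) * mat_adjoint V = B" .
  let ?D = "real_diag (Suc n) (\<lambda>i. if i = 0 then Re ev else d (i - 1))"
  have Vm: "V \<in> carrier_mat (Suc n) (Suc n)" and Va: "mat_adjoint V \<in> carrier_mat (Suc n) (Suc n)"
    using V by (auto simp: unitary_mat_def carrier_adjoint)
  have "A = W * (V * ?D * mat_adjoint V) * mat_adjoint W" using AW VB by simp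
  also have "\<dots> = (W * V) * ?D * mat_adjoint (W * V)"
    using Wm Wa Vm Va real_diag_carrier[of "Suc n" "\<lambda>i. if i = 0 then Re ev else d (i - 1)"]
    by (simp add: adjoint_mult[OF Wm Vm] assoc_mult_mat[of _ "Suc n" "Suc n" _ "Suc n" _ "Suc n"])
  finally show ?case using unitary_mult[OF W V] by blast
qed

section \<open>From resolvents to entropies\<close>

text \<open>An index stands for a pair of eigenvectors and \<open>w\<close> for their squared
  overlap. Writing q + T p = p T (1 + q / (T p)) and using ln (1 + x) \<le> x leaves an error of
  order 1 / T beyond the leading term \<open>ln T\<close>.\<close>

lemma sum_ln_affine_upper:
  fixes w p q :: "'i \<Rightarrow> real"
  assumes "\<And>i. i \<in> I \<Longrightarrow> 0 \<le> w i \<and> 0 \<le> p i \<and> 0 \<le> q i"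
    and "\<And>i. i \<in> I \<Longrightarrow> w i * p i \<noteq> 0 \<Longrightarrow> q i \<noteq> 0" and T: "T > 0"
  shows "(\<Sum>i\<in>I. w i * p i * (ln (q i + T * p i) - ln (p i)))
    \<le> (\<Sum>i\<in>I. w i * p i) * ln T + (\<Sum>i\<in>I. w i * q i) / T"
proof -
  have "w i * p i * (ln (q i + T * p i) - ln (p i)) \<le> w i * p i * ln T + w i * q i / T" if "i \<in> I" for i
  proof (cases "w i * p i = 0")
    case True
    then show ?thesis using assms(1)[OF that] T by auto
  next
    case False
    then have p: "p i > 0" "q i > 0" "w i > 0"
      using assms(1)[OF that] assms(2)[OF that] by (auto simp: order_less_le)
    have pos: "1 + q i / (T * p i) > 0" using p T by (simp add: add_pos_pos)
    have "q i + T * p i = p i * T * (1 + q i / (T * p i))"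
      using p T by (simp add: field_simps)
    then have "ln (q i + T * p i) - ln (p i) = ln T + ln (1 + q i / (T * p i))"
      using p T pos by (simp add: ln_mult)
    also have "\<dots> \<le> ln T + q i / (T * p i)"
      using p T by (simp add: ln_add_one_self_le_self)
    finally have "w i * p i * (ln (q i + T * p i) - ln (p i)) \<le> w i * p i * (ln T + q i / (T * p i))"
      using p by (intro mult_left_mono) auto
    also have "\<dots> = w i * p i * ln T + w i * q i / T" using p T by (simp add: field_simps)
    finally show ?thesis .
  qed
  then have "(\<Sum>i\<in>I. w i * p i * (ln (q i + T * p i) - ln (p i))) \<le> (\<Sum>i\<in>I. w i * p i * ln T + w i * q i / T)"
    by (rule sum_mono)
  then show ?thesis by (simp add: sum.distrib sum_distrib_right sum_divide_distrib)
qed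

text \<open>Dropping \<open>q\<close> inside the logarithm gives the same leading term as the upper
  bound, so that for equal masses the leading terms cancel.\<close>

lemma sum_ln_affine_lower:
  fixes w p q :: "'i \<Rightarrow> real"
  assumes "\<And>i. i \<in> I \<Longrightarrow> 0 \<le> w i \<and> 0 \<le> p i \<and> 0 \<le> q i" and T: "T > 0"
  shows "(\<Sum>i\<in>I. w i * p i) * ln T \<le> (\<Sum>i\<in>I. w i * p i * (ln (q i + T * p i) - ln (p i)))"
  unfolding sum_distrib_right
proof (rule sum_mono)
  fix i assume i: "i \<in> I"
  show "w i * p i * ln T \<le> w i * p i * (ln (q i + T * p i) - ln (p i))"
  proof (cases "p i = 0")
    case False
    then have p: "p i > 0" "q i \<ge> 0" "w i \<ge> 0" using assms(1)[OF i] by (auto simp: order_less_le)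
    have "ln (T * p i) \<le> ln (q i + T * p i)" using p T by (subst ln_le_cancel_iff) (auto intro: add_nonneg_pos)
    then have "ln T \<le> ln (q i + T * p i) - ln (p i)" using p T by (simp add: ln_mult)
    then show ?thesis using p by (intro mult_left_mono) auto
  qed simp
qed

text \<open>The support condition keeps the argument of \<open>ln\<close> positive down to t = 0
  wherever the weight is nonzero. The derivative thus exists also at t = 0, where the entropy is
  found.\<close>

lemma sum_ln_affine_deriv:
  fixes w p q :: "'i \<Rightarrow> real"
  assumes nn: "\<And>i. i \<in> I \<Longrightarrow> 0 \<le> w i \<and> 0 \<le> p i \<and> 0 \<le> q i"
    and supp: "\<And>i. i \<in> I \<Longrightarrow> w i * p i \<noteq> 0 \<Longrightarrow> q i \<noteq> 0" and t: "t \<ge> 0"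
  shows "((\<lambda>t. \<Sum>i\<in>I. w i * p i * (ln (q i + t * p i) - ln (p i))) has_real_derivative
    (\<Sum>i\<in>I. w i * (p i)\<^sup>2 / (q i + t * p i))) (at t)"
proof (rule DERIV_sum)
  fix i assume i: "i \<in> I"
  show "((\<lambda>t. w i * p i * (ln (q i + t * p i) - ln (p i))) has_real_derivative
    w i * (p i)\<^sup>2 / (q i + t * p i)) (at t)"
  proof (cases "w i * p i = 0")
    case False
    then have "q i + t * p i > 0"
      using nn[OF i] supp[OF i] t by (intro add_pos_nonneg) (auto simp: order_less_le)
    then show ?thesis by (auto intro!: derivative_eq_intros simp: power2_eq_square)
  qed auto
qed

text \<open>A zero \<open>q' j\<close> with positive weight contributes
  \<open>w' j * p' j / t\<close>, which is unbounded as t tends to 0, whereas the support condition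
  bounds the other side by its value \<open>C\<close> at t = 0.\<close>

lemma resolvent_domination_imp_support:
  fixes w p q :: "'i \<Rightarrow> real" and w' p' q' :: "'j \<Rightarrow> real"
  assumes fin: "finite J"
    and nn: "\<And>i. i \<in> I \<Longrightarrow> 0 \<le> w i \<and> 0 \<le> p i \<and> 0 \<le> q i"
    and nn': "\<And>j. j \<in> J \<Longrightarrow> 0 \<le> w' j \<and> 0 \<le> p' j \<and> 0 \<le> q' j"
    and le: "\<And>t. t > 0 \<Longrightarrow> (\<Sum>j\<in>J. w' j * (p' j)\<^sup>2 / (q' j + t * p' j)) \<le> (\<Sum>i\<in>I. w i * (p i)\<^sup>2 / (q i + t * p i))"
    and supp: "\<And>i. i \<in> I \<Longrightarrow> w i * p i \<noteq> 0 \<Longrightarrow> q i \<noteq> 0"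
    and j: "j \<in> J" "w' j * p' j \<noteq> 0"
  shows "q' j \<noteq> 0"
proof
  assume q': "q' j = 0"
  define C where "C = (\<Sum>i\<in>I. w i * (p i)\<^sup>2 / q i)"
  have pos: "w' j * p' j > 0" "p' j > 0"
    using nn'[OF j(1)] j(2) by (auto simp: order_less_le)
  have bound: "w' j * p' j / t \<le> C" if t: "t > 0" for t
  proof -
    have "w' j * p' j / t = w' j * (p' j)\<^sup>2 / (q' j + t * p' j)"
      using pos t q' by (simp add: power2_eq_square field_simps)
    also have "\<dots> \<le> (\<Sum>j\<in>J. w' j * (p' j)\<^sup>2 / (q' j + t * p' j))"
      by (rule member_le_sum) (use fin j nn' t in auto)
    also have "\<dots> \<le> (\<Sum>i\<in>I. w i * (p i)\<^sup>2 / (q i + t * p i))" by (rule le[OF t])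
    also have "\<dots> \<le> C" unfolding C_def
    proof (rule sum_mono)
      fix i assume i: "i \<in> I"
      show "w i * (p i)\<^sup>2 / (q i + t * p i) \<le> w i * (p i)\<^sup>2 / q i"
      proof (cases "w i * p i = 0")
        case False
        then have "q i > 0" using nn[OF i] supp[OF i] by (auto simp: order_less_le)
        then show ?thesis using nn[OF i] t by (intro divide_left_mono mult_pos_pos add_pos_nonneg) auto
      qed auto
    qed
    finally show ?thesis .
  qed
  have "C > 0" using bound[of 1] pos by simp
  \<comment> \<open>At this \<open>t\<close> the bound reads \<open>2 * C \<le> C\<close>.\<close>
  then show False using bound[of "w' j * p' j / (2 * C)"] pos by (simp add: field_simps split: if_splits)
qed

text \<open>
  Since \<open>d/dt p ln ((q + t p) / p) = p\<^sup>2 / (q + t p)\<close>, the difference of the two sides grows with \<open>t\<close>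
  when \<open>q\<close> is replaced by \<open>q + t p\<close>, and it tends to \<open>0\<close> as \<open>t \<rightarrow> \<infinity>\<close> because the total masses agree.
\<close>

lemma resolvent_domination_imp_entropy_le:
  fixes w p q :: "'i \<Rightarrow> real" and w' p' q' :: "'j \<Rightarrow> real"
  assumes nn: "\<And>i. i \<in> I \<Longrightarrow> 0 \<le> w i \<and> 0 \<le> p i \<and> 0 \<le> q i"
    and nn': "\<And>j. j \<in> J \<Longrightarrow> 0 \<le> w' j \<and> 0 \<le> p' j \<and> 0 \<le> q' j"
    and le: "\<And>t. t > 0 \<Longrightarrow> (\<Sum>j\<in>J. w' j * (p' j)\<^sup>2 / (q' j + t * p' j)) \<le> (\<Sum>i\<in>I. w i * (p i)\<^sup>2 / (q i + t * p i))"
    and supp: "\<And>i. i \<in> I \<Longrightarrow> w i * p i \<noteq> 0 \<Longrightarrow> q i \<noteq> 0"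
    and supp': "\<And>j. j \<in> J \<Longrightarrow> w' j * p' j \<noteq> 0 \<Longrightarrow> q' j \<noteq> 0"
    and mass: "(\<Sum>j\<in>J. w' j * p' j) = (\<Sum>i\<in>I. w i * p i)"
  shows "(\<Sum>j\<in>J. w' j * p' j * (ln (p' j) - ln (q' j))) \<le> (\<Sum>i\<in>I. w i * p i * (ln (p i) - ln (q i)))"
proof -
  define g where "g t = (\<Sum>i\<in>I. w i * p i * (ln (q i + t * p i) - ln (p i)))
    - (\<Sum>j\<in>J. w' j * p' j * (ln (q' j + t * p' j) - ln (p' j)))" for t
  define C where "C = (\<Sum>i\<in>I. w i * q i)"
  have C: "C \<ge> 0" unfolding C_def using nn by (intro sum_nonneg) auto
  have g': "(g has_real_derivative (\<Sum>i\<in>I. w i * (p i)\<^sup>2 / (q i + t * p i))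
     - (\<Sum>j\<in>J. w' j * (p' j)\<^sup>2 / (q' j + t * p' j))) (at t)" if "t \<ge> 0" for t
    unfolding g_def using sum_ln_affine_deriv[OF nn supp that] sum_ln_affine_deriv[OF nn' supp' that]
    by (rule DERIV_diff)
  have le0: "g 0 \<le> C / T" if T: "T > 0" for T
  proof -
    have "g 0 \<le> g T"
    \<comment> \<open>The hypothesis \<open>le\<close> speaks of t > 0 only, hence the criterion for
      an open interval together with continuity at its ends.\<close>
    proof (rule DERIV_nonneg_imp_increasing_open[of 0 T g])
      show "\<exists>y. (g has_real_derivative y) (at x) \<and> 0 \<le> y" if "0 < x" "x < T" for x
        using g'[of x] le[of x] that by (intro exI conjI) auto
      show "continuous_on {0..T} g"
        by (rule continuous_at_imp_continuous_on) (use DERIV_isCont[OF g'] in auto)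
    qed (use T in simp)
    \<comment> \<open>Both sums have leading term mass times \<open>ln T\<close>; as the masses
      agree, only the error of the upper bound survives.\<close>
    also have "g T \<le> C / T"
      unfolding g_def C_def using sum_ln_affine_upper[where w=w and p=p and q=q and I=I, OF nn supp T]
        sum_ln_affine_lower[where w=w' and p=p' and q=q' and I=J, OF nn' T] mass
      by simp
    finally show ?thesis .
  qed
  have "g 0 \<le> 0"
  proof (rule ccontr)
    assume "\<not> g 0 \<le> 0"
    then have g: "g 0 > 0" by simp
    \<comment> \<open>This \<open>T\<close> turns the bound into \<open>C * g 0 / (C + 1)\<close>,
      which is smaller than \<open>g 0\<close>; the added 1 covers \<open>C = 0\<close>.\<close>
    then have "g 0 \<le> C / ((C + 1) / g 0)" using C by (intro le0) simp
    then show False using g C by (simp add: field_simps)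
  qed
  then show ?thesis by (simp add: g_def right_diff_distrib sum_subtractf)
qed

section \<open>Schwarz inequality for quantum operations\<close>

lemma trace_mult:
  assumes "A \<in> carrier_mat n m" "B \<in> carrier_mat m n"
  shows "mat_trace (A * B) = (\<Sum>i<n. \<Sum>j<m. A $$ (i,j) * B $$ (j,i))"
  using assms by (simp add: mat_trace_def scalar_prod_def atLeast0LessThan)

lemma trace_comm:
  assumes "A \<in> carrier_mat n m" "B \<in> carrier_mat m n"
  shows "mat_trace (A * B) = mat_trace (B * A)"
  unfolding trace_mult[OF assms] trace_mult[OF assms(2,1)]
  by (subst sum.swap) (simp add: mult.commute)

lemma trace_add: "A \<in> carrier_mat n n \<Longrightarrow> B \<in> carrier_mat n n \<Longrightarrow> mat_trace (A + B) = mat_trace A + mat_trace B"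
  by (simp add: mat_trace_def sum.distrib)

lemma trace_minus: "A \<in> carrier_mat n n \<Longrightarrow> B \<in> carrier_mat n n \<Longrightarrow> mat_trace (A - B) = mat_trace A - mat_trace B"
  by (simp add: mat_trace_def sum_subtractf)

lemma trace_uminus: "A \<in> carrier_mat n n \<Longrightarrow> mat_trace (- A) = - mat_trace A"
  by (simp add: mat_trace_def sum_negf)

lemma trace_smult: "A \<in> carrier_mat n n \<Longrightarrow> mat_trace (c \<cdot>\<^sub>m A) = c * mat_trace A"
  by (simp add: mat_trace_def sum_distrib_left)

lemma trace_adjoint: "A \<in> carrier_mat n n \<Longrightarrow> mat_trace (mat_adjoint A) = cnj (mat_trace A)"
  by (simp add: mat_trace_def)

lemma trace_four_block:
  assumes "A \<in> carrier_mat n n" "D \<in> carrier_mat m m"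
  shows "mat_trace (four_block_mat A B C D) = mat_trace A + mat_trace D"
proof -
  have "mat_trace (four_block_mat A B C D) = (\<Sum>i<n+m. if i < n then A $$ (i,i) else D $$ (i-n,i-n))"
    using assms by (auto simp: mat_trace_def intro!: sum.cong)
  also have "{..<n+m} = {..<n} \<union> {n..<n+m}" by auto
  also have "(\<Sum>i\<in>{..<n} \<union> {n..<n+m}. if i < n then A $$ (i,i) else D $$ (i-n,i-n))
      = (\<Sum>i<n. A $$ (i,i)) + (\<Sum>i=n..<n+m. D $$ (i-n,i-n))"
    by (subst sum.union_disjoint) auto
  also have "(\<Sum>i=n..<n+m. D $$ (i-n,i-n)) = (\<Sum>i<m. D $$ (i,i))"
    by (rule sum.reindex_bij_witness[of _ "\<lambda>i. i + n" "\<lambda>i. i - n"]) auto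
  finally show ?thesis using assms by (simp add: mat_trace_def)
qed

lemma psd_congruence:
  assumes M: "psd n M" and L: "L \<in> carrier_mat n k"
  shows "psd k (mat_adjoint L * M * L)"
  unfolding psd_def
proof (intro conjI ballI)
  have Mc: "M \<in> carrier_mat n n" using M by (simp add: psd_def)
  note La = carrier_adjoint[OF L]
  show "mat_adjoint L * M * L \<in> carrier_mat k k" using Mc L La by auto
  fix v :: "complex vec" assume v: "v \<in> carrier_vec k"
  define w where "w = M *\<^sub>v (L *\<^sub>v v)"
  have w: "w \<in> carrier_vec n" using Mc L v by (auto simp: w_def)
  have "(mat_adjoint L * M * L) *\<^sub>v v = mat_adjoint L *\<^sub>v w"
    using Mc L La v unfolding w_def by (simp add: assoc_mult_mat_vec[of _ k n _ k] assoc_mult_mat_vec[of _ k n _ n])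
  moreover have "(mat_adjoint L *\<^sub>v w) \<bullet>c v = w \<bullet>c (L *\<^sub>v v)"
  proof -
    have "(mat_adjoint L *\<^sub>v w) \<bullet>c v = (\<Sum>i<k. \<Sum>j<n. cnj (L $$ (j,i)) * w $ j * cnj (v $ i))"
      using L w v by (auto simp: scalar_prod_def sum_distrib_right atLeast0LessThan intro!: sum.cong)
    also have "\<dots> = (\<Sum>j<n. \<Sum>i<k. cnj (L $$ (j,i)) * w $ j * cnj (v $ i))" by (rule sum.swap)
    also have "\<dots> = w \<bullet>c (L *\<^sub>v v)"
      using L w v by (auto simp: scalar_prod_def sum_distrib_left atLeast0LessThan algebra_simps intro!: sum.cong)
    finally show ?thesis .
  qed
  moreover have "0 \<le> w \<bullet>c (L *\<^sub>v v)"
    unfolding w_def using M L v by (auto simp: psd_def)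
  ultimately show "0 \<le> ((mat_adjoint L * M * L) *\<^sub>v v) \<bullet>c v" by simp
qed

lemma psd_trace_nonneg:
  assumes "psd n M" shows "0 \<le> mat_trace M"
proof -
  have M: "M \<in> carrier_mat n n" using assms by (simp add: psd_def)
  have "0 \<le> M $$ (i,i)" if i: "i < n" for i
  proof -
    have "0 \<le> M $$ (i,i) * 1 * cnj 1 + M $$ (i,i) * 0 * cnj 1 + M $$ (i,i) * 1 * cnj 0 + M $$ (i,i) * 0 * cnj 0"
      unfolding quad_form_two[OF M i i, symmetric] using assms by (simp add: psd_def)
    then show ?thesis by simp
  qed
  then show ?thesis using M by (auto simp: mat_trace_def intro!: sum_nonneg)
qed

section \<open>Matrix units and the dual of a linear map\<close>

definition matrix_unit :: "nat \<Rightarrow> nat \<Rightarrow> nat \<Rightarrow> complex mat" where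
  "matrix_unit n i j = mat n n (\<lambda>(k, l). if k = i \<and> l = j then 1 else 0)"

lemma matrix_unit_carrier[simp]: "matrix_unit n i j \<in> carrier_mat n n"
  by (simp add: matrix_unit_def)

text \<open>The induction runs over the set of entries that are retained, so only the sum of two
  matrices is ever formed.\<close>

lemma linear_functional_expand:
  fixes f :: "complex mat \<Rightarrow> complex"
  assumes add: "\<And>X Y. X \<in> carrier_mat n n \<Longrightarrow> Y \<in> carrier_mat n n \<Longrightarrow> f (X + Y) = f X + f Y"
    and hom: "\<And>X c. X \<in> carrier_mat n n \<Longrightarrow> f (c \<cdot>\<^sub>m X) = c * f X"
    and X: "X \<in> carrier_mat n n"
  shows "f X = (\<Sum>i<n. \<Sum>j<n. X $$ (i,j) * f (matrix_unit n i j))"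
proof -
  define R where "R S = mat n n (\<lambda>ij. if ij \<in> S then X $$ ij else 0)" for S :: "(nat \<times> nat) set"
  have "f (R S) = (\<Sum>ij\<in>S. X $$ ij * f (matrix_unit n (fst ij) (snd ij)))"
    if "finite S" "S \<subseteq> {..<n} \<times> {..<n}" for S
    using that
  proof (induction S rule: finite_induct)
    case empty
    have "R {} = 0\<^sub>m n n" "0 \<cdot>\<^sub>m 0\<^sub>m n n = (0\<^sub>m n n :: complex mat)" by (auto simp: R_def)
    then show ?case using hom[of "0\<^sub>m n n" 0] by simp
  next
    case (insert s S)
    have "R (insert s S) = R S + X $$ s \<cdot>\<^sub>m matrix_unit n (fst s) (snd s)"
      using insert.hyps by (intro eq_matI) (auto simp: R_def matrix_unit_def)
    then have "f (R (insert s S)) = f (R S) + X $$ s * f (matrix_unit n (fst s) (snd s))"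
      by (simp add: add hom R_def)
    then show ?case using insert by simp
  qed
  from this[of "{..<n} \<times> {..<n}"]
  have "f (R ({..<n} \<times> {..<n})) = (\<Sum>i<n. \<Sum>j<n. X $$ (i,j) * f (matrix_unit n i j))"
    by (simp add: sum.cartesian_product split_def)
  moreover have "R ({..<n} \<times> {..<n}) = X" using X by (intro eq_matI) (auto simp: R_def)
  ultimately show ?thesis by simp
qed

lemma linear_mapD:
  assumes "linear_map n m F"
  shows "X \<in> carrier_mat n n \<Longrightarrow> F X \<in> carrier_mat m m"
    and "X \<in> carrier_mat n n \<Longrightarrow> Y \<in> carrier_mat n n \<Longrightarrow> F (X + Y) = F X + F Y"
    and "X \<in> carrier_mat n n \<Longrightarrow> F (c \<cdot>\<^sub>m X) = c \<cdot>\<^sub>m F X"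
  using assms by (auto simp: linear_map_def)

lemma linear_map_ext:
  assumes F: "linear_map n m F" and G: "linear_map n m G"
    and eq: "\<And>i j. i < n \<Longrightarrow> j < n \<Longrightarrow> F (matrix_unit n i j) = G (matrix_unit n i j)"
    and X: "X \<in> carrier_mat n n"
  shows "F X = G X"
proof (rule eq_matI)
  note F' = linear_mapD[OF F] and G' = linear_mapD[OF G]
  fix k l assume "k < dim_row (G X)" "l < dim_col (G X)"
  then have kl: "k < m" "l < m" using G'(1)[OF X] by auto
  have d: "dim_row (F X) = m \<and> dim_col (F X) = m \<and> dim_row (G X) = m \<and> dim_col (G X) = m" if "X \<in> carrier_mat n n" for X
    using F'(1)[OF that] G'(1)[OF that] by auto
  have "F X $$ (k,l) = (\<Sum>i<n. \<Sum>j<n. X $$ (i,j) * F (matrix_unit n i j) $$ (k,l))"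
    by (rule linear_functional_expand[of n "\<lambda>X. F X $$ (k,l)"]) (use kl X d in \<open>simp_all add: F' \<close>)
  also have "\<dots> = (\<Sum>i<n. \<Sum>j<n. X $$ (i,j) * G (matrix_unit n i j) $$ (k,l))"
    by (simp add: eq)
  also have "\<dots> = G X $$ (k,l)"
    by (rule linear_functional_expand[of n "\<lambda>X. G X $$ (k,l)", symmetric]) (use kl X d in \<open>simp_all add: G' \<close>)
  finally show "F X $$ (k,l) = G X $$ (k,l)" .
qed (use linear_mapD(1)[OF F X] linear_mapD(1)[OF G X] in auto)

text \<open>Entry \<open>(i,j)\<close> uses the transposed unit because Tr (E_ji Z) = Z_ij. The
  pairing is the bilinear one, without conjugation, so the map is linear in
  \<open>Y\<close>.\<close>

definition dual_map :: "nat \<Rightarrow> (complex mat \<Rightarrow> complex mat) \<Rightarrow> complex mat \<Rightarrow> complex mat" where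
  "dual_map n F Y = mat n n (\<lambda>(i,j). mat_trace (F (matrix_unit n j i) * Y))"

lemma trace_dual_map:
  assumes F: "linear_map n m F" and X: "X \<in> carrier_mat n n" and Y: "Y \<in> carrier_mat m m"
  shows "mat_trace (F X * Y) = mat_trace (X * dual_map n F Y)"
proof -
  note F' = linear_mapD[OF F]
  have "mat_trace (F X * Y) = (\<Sum>i<n. \<Sum>j<n. X $$ (i,j) * mat_trace (F (matrix_unit n i j) * Y))"
  proof (rule linear_functional_expand[of n "\<lambda>X. mat_trace (F X * Y)", OF _ _ X])
    fix A B :: "complex mat" and c assume A: "A \<in> carrier_mat n n" 
    note FA = F'(1)[OF A]
    show "mat_trace (F (c \<cdot>\<^sub>m A) * Y) = c * mat_trace (F A * Y)"
      using FA Y by (simp add: F'(3)[OF A] mult_smult_assoc_mat[OF FA Y] trace_smult[of _ m])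
    assume B: "B \<in> carrier_mat n n"
    show "mat_trace (F (A + B) * Y) = mat_trace (F A * Y) + mat_trace (F B * Y)"
      using FA F'(1)[OF B] Y by (simp add: F'(2)[OF A B] add_mult_distrib_mat[of _ m m _ _ m] trace_add[of _ m])
  qed
  also have "\<dots> = mat_trace (X * dual_map n F Y)"
    using X by (subst trace_mult[of _ n n]) (auto simp: dual_map_def)
  finally show ?thesis .
qed

text \<open>Row blocks turn block matrices into congruences, which is how positivity of a two by two
  block matrix is obtained and exploited below.\<close>

definition hcat :: "complex mat \<Rightarrow> complex mat \<Rightarrow> complex mat" where
  "hcat A B = mat (dim_row A) (dim_col A + dim_col B)
     (\<lambda>(i,j). if j < dim_col A then A $$ (i,j) else B $$ (i, j - dim_col A))"

lemma hcat_carrier: "A \<in> carrier_mat k n \<Longrightarrow> B \<in> carrier_mat k m \<Longrightarrow> hcat A B \<in> carrier_mat k (n + m)"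
  by (simp add: hcat_def)

lemma mult_hcat:
  assumes "M \<in> carrier_mat l k" "A \<in> carrier_mat k n" "B \<in> carrier_mat k m"
  shows "M * hcat A B = hcat (M * A) (M * B)"
  using assms by (intro eq_matI) (auto simp: hcat_def scalar_prod_def)

lemma adjoint_hcat_mult:
  assumes "A \<in> carrier_mat k n" "B \<in> carrier_mat k m" "C \<in> carrier_mat k n" "D \<in> carrier_mat k m"
  shows "mat_adjoint (hcat A B) * hcat C D =
    four_block_mat (mat_adjoint A * C) (mat_adjoint A * D) (mat_adjoint B * C) (mat_adjoint B * D)"
  using assms by (intro eq_matI) (auto simp: hcat_def scalar_prod_def)

text \<open>With the qubit as first factor, the lexicographic order places its two basis states in
  consecutive blocks of rows and columns.\<close>

lemma apply_on_four_block:
  assumes F: "linear_map n m F"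
    and c: "A \<in> carrier_mat n n" "B \<in> carrier_mat n n" "C \<in> carrier_mat n n" "D \<in> carrier_mat n n"
  shows "apply_on 2 n m 1 F (four_block_mat A B C D) = four_block_mat (F A) (F B) (F C) (F D)"
proof (rule eq_matI)
  note Fc = linear_mapD(1)[OF F]
  have Fd: "dim_row (F X) = m" "dim_col (F X) = m" if "X \<in> carrier_mat n n" for X
    using Fc[OF that] by auto
  fix i j assume "i < dim_row (four_block_mat (F A) (F B) (F C) (F D))"
    "j < dim_col (four_block_mat (F A) (F B) (F C) (F D))"
  then have ij: "i < m + m" "j < m + m" using Fd c by auto
  have d: "i div m = (if i < m then 0 else 1) \<and> i mod m = (if i < m then i else i - m)" if "i < m + m" for i
    using that by (auto simp: div_if le_mod_geq)
  have "mat n n (\<lambda>(k, l). four_block_mat A B C D $$ (i div m * n + k, j div m * n + l))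
    = (if i < m then if j < m then A else B else if j < m then C else D)"
    using c d[OF ij(1)] d[OF ij(2)] by (intro eq_matI) auto
  then show "apply_on 2 n m 1 F (four_block_mat A B C D) $$ (i, j)
      = four_block_mat (F A) (F B) (F C) (F D) $$ (i, j)"
    using ij d[OF ij(1)] d[OF ij(2)] by (auto simp: apply_on_def Fd c)
qed (use linear_mapD(1)[OF F c(1)] linear_mapD(1)[OF F c(4)] in \<open>auto simp: apply_on_def\<close>)

text \<open>
  A form of the Kadison-Schwarz inequality: positivity of \<open>id\<^sub>2 \<otimes> F\<close> on
  \<open>(1, X)\<^sup>* \<sigma> (1, X)\<close>, tested against the column \<open>(Y, -1)\<close>.
\<close>

lemma cptp_schwarz:
  assumes F: "cptp n m F" and \<sigma>: "psd n \<sigma>" and X: "X \<in> carrier_mat n n" and Y: "Y \<in> carrier_mat m m"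
  shows "2 * Re (mat_trace (F (mat_adjoint X * \<sigma>) * Y))
      \<le> Re (mat_trace (F \<sigma> * (Y * mat_adjoint Y))) + Re (mat_trace (mat_adjoint X * \<sigma> * X))"
    and "F (\<sigma> * X) = mat_adjoint (F (mat_adjoint X * \<sigma>))"
proof -
  have lin: "linear_map n m F" and tp: "trace_preserving n F" and cp: "completely_positive n m F"
    using F by (auto simp: cptp_def)
  note Fc = linear_mapD(1)[OF lin]
  have s: "\<sigma> \<in> carrier_mat n n" using \<sigma> by (simp add: psd_def)
  note Xa = carrier_adjoint[OF X] and Ya = carrier_adjoint[OF Y]
  let ?S = "four_block_mat \<sigma> (\<sigma> * X) (mat_adjoint X * \<sigma>) (mat_adjoint X * \<sigma> * X)"
  let ?L = "hcat (1\<^sub>m n) X"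
  have adj1: "mat_adjoint (1\<^sub>m k) = (1\<^sub>m k :: complex mat)" for k by (rule eq_matI) auto
  have "mat_adjoint ?L * \<sigma> * ?L = mat_adjoint ?L * (\<sigma> * ?L)"
    using s hcat_carrier[OF one_carrier_mat X] carrier_adjoint[OF hcat_carrier[OF one_carrier_mat X]]
    by (intro assoc_mult_mat) auto
  also have "\<dots> = mat_adjoint ?L * hcat \<sigma> (\<sigma> * X)"
    using s X by (simp add: mult_hcat[OF s one_carrier_mat X])
  also have "\<dots> = ?S"
    using s X Xa by (subst adjoint_hcat_mult[of _ n n _ n]) (auto simp: adj1)
  finally have "psd (n + n) ?S"
    using psd_congruence[OF \<sigma> hcat_carrier[OF one_carrier_mat X]] by simp
  then have "psd (2 * m) (apply_on 2 n m 1 F ?S)"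
    using cp unfolding completely_positive_def mult_2 by (metis mult_2)
  moreover define M where
    "M = four_block_mat (F \<sigma>) (F (\<sigma> * X)) (F (mat_adjoint X * \<sigma>)) (F (mat_adjoint X * \<sigma> * X))"
  moreover have "apply_on 2 n m 1 F ?S = M"
    unfolding M_def using s X Xa by (intro apply_on_four_block[OF lin]) auto
  ultimately have M: "psd (m + m) M" by (simp add: mult_2)
  have c1: "F \<sigma> \<in> carrier_mat m m" and c2: "F (\<sigma> * X) \<in> carrier_mat m m"
    and c3: "F (mat_adjoint X * \<sigma>) \<in> carrier_mat m m" and c4: "F (mat_adjoint X * \<sigma> * X) \<in> carrier_mat m m"
    using s X Xa by (auto intro!: Fc)
  \<comment> \<open>A positive block matrix is Hermitian, so its off-diagonal blocks are adjoint to
    each other.\<close>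
  show herm: "F (\<sigma> * X) = mat_adjoint (F (mat_adjoint X * \<sigma>))"
  proof (rule eq_matI)
    fix i j assume "i < dim_row (mat_adjoint (F (mat_adjoint X * \<sigma>)))" "j < dim_col (mat_adjoint (F (mat_adjoint X * \<sigma>)))"
    then have ij: "i < m" "j < m" using c3 by auto
    have "mat_adjoint M $$ (i, j + m) = M $$ (i, j + m)" using psd_hermitian[OF M] by simp
    then show "F (\<sigma> * X) $$ (i,j) = mat_adjoint (F (mat_adjoint X * \<sigma>)) $$ (i,j)"
      using ij c1 c2 c3 c4 by (simp add: M_def)
  qed (use c2 c3 in auto)
  let ?Z = "hcat (mat_adjoint Y) (- 1\<^sub>m m)"
  have mc: "- 1\<^sub>m m \<in> carrier_mat m m" by simp
  have Z: "?Z \<in> carrier_mat m (m + m)" using hcat_carrier[OF Ya mc] .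
  have Mc: "M \<in> carrier_mat (m + m) (m + m)" using M by (simp add: psd_def)
  have adjm: "mat_adjoint (- 1\<^sub>m m) = (- 1\<^sub>m m :: complex mat)" by (rule eq_matI) auto
  have mm: "A * - 1\<^sub>m m = - A" "- 1\<^sub>m m * A = - A" if "A \<in> carrier_mat m m" for A :: "complex mat"
    using that by auto
  have "0 \<le> mat_trace (?Z * M * mat_adjoint ?Z)"
    using psd_trace_nonneg[OF psd_congruence[OF M carrier_adjoint[OF Z]]] by simp
  also have "mat_trace (?Z * M * mat_adjoint ?Z) = mat_trace (M * (mat_adjoint ?Z * ?Z))"
  proof -
    have "?Z * M * mat_adjoint ?Z = ?Z * (M * mat_adjoint ?Z)"
      using Z Mc carrier_adjoint[OF Z] by (intro assoc_mult_mat) auto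
    moreover have "mat_trace (?Z * (M * mat_adjoint ?Z)) = mat_trace (M * mat_adjoint ?Z * ?Z)"
      using Z Mc carrier_adjoint[OF Z] by (intro trace_comm[of _ m "m+m"]) auto
    moreover have "M * mat_adjoint ?Z * ?Z = M * (mat_adjoint ?Z * ?Z)"
      using Z Mc carrier_adjoint[OF Z] by (intro assoc_mult_mat) auto
    ultimately show ?thesis by simp
  qed
  also have "mat_adjoint ?Z * ?Z = four_block_mat (Y * mat_adjoint Y) (- Y) (- mat_adjoint Y) (1\<^sub>m m)"
    using adjoint_hcat_mult[OF Ya mc Ya mc] Y Ya by (simp add: adjm mm)
  also have "M * \<dots> = four_block_mat (F \<sigma> * (Y * mat_adjoint Y) + F (\<sigma> * X) * - mat_adjoint Y)
      (F \<sigma> * - Y + F (\<sigma> * X) * 1\<^sub>m m)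
      (F (mat_adjoint X * \<sigma>) * (Y * mat_adjoint Y) + F (mat_adjoint X * \<sigma> * X) * - mat_adjoint Y)
      (F (mat_adjoint X * \<sigma>) * - Y + F (mat_adjoint X * \<sigma> * X) * 1\<^sub>m m)"
    unfolding M_def using c1 c2 c3 c4 Y Ya
    by (intro mult_four_block_mat[of _ m m _ m _ m]) auto
  also have "mat_trace \<dots> = mat_trace (F \<sigma> * (Y * mat_adjoint Y)) - mat_trace (F (\<sigma> * X) * mat_adjoint Y)
      - mat_trace (F (mat_adjoint X * \<sigma>) * Y) + mat_trace (F (mat_adjoint X * \<sigma> * X))"
    using c1 c2 c3 c4 Y Ya by (simp add: trace_four_block[of _ m _ m] trace_add[of _ m] trace_uminus[of _ m])
  \<comment> \<open>By \<open>herm\<close> the two cross terms are complex conjugates and add up to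
    twice a real part.\<close>
  also have "mat_trace (F (\<sigma> * X) * mat_adjoint Y) = cnj (mat_trace (F (mat_adjoint X * \<sigma>) * Y))"
  proof -
    have "F (\<sigma> * X) * mat_adjoint Y = mat_adjoint (Y * F (mat_adjoint X * \<sigma>))"
      unfolding herm by (rule adjoint_mult[OF Y c3, symmetric])
    then show ?thesis using Y c3 by (simp add: trace_adjoint[of _ m] trace_comm[OF Y c3])
  qed
  \<comment> \<open>Trace preservation removes \<open>F\<close> from the corner that is quadratic in
    \<open>X\<close>.\<close>
  also have "mat_trace (F (mat_adjoint X * \<sigma> * X)) = mat_trace (mat_adjoint X * \<sigma> * X)"
    using tp X Xa s by (simp add: trace_preserving_def)
  finally show "2 * Re (mat_trace (F (mat_adjoint X * \<sigma>) * Y))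
      \<le> Re (mat_trace (F \<sigma> * (Y * mat_adjoint Y))) + Re (mat_trace (mat_adjoint X * \<sigma> * X))"
    by (simp add: less_eq_complex_def)
qed

text \<open>
  The supremum over \<open>X\<close> of this functional is \<open>\<langle>\<rho>, (L\<^sub>\<sigma> + t R\<^sub>\<rho>)\<^sup>-\<^sup>1 \<rho>\<rangle>\<close>, where \<open>L\<^sub>\<sigma>\<close> and \<open>R\<^sub>\<rho>\<close> are the left and
  right multiplications; integrating over \<open>t\<close> yields the relative entropy.
\<close>

definition resolvent_form :: "real \<Rightarrow> complex mat \<Rightarrow> complex mat \<Rightarrow> complex mat \<Rightarrow> real" where
  "resolvent_form t \<rho> \<sigma> X = 2 * Re (mat_trace (\<rho> * X)) - Re (mat_trace (mat_adjoint X * \<sigma> * X))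
     - t * Re (mat_trace (X * \<rho> * mat_adjoint X))"

text \<open>For \<open>X = dual_map n F Y\<close> the linear terms agree by duality. The cross term
  of the Schwarz inequality is twice the quadratic term in \<open>X\<close>, so one copy cancels and
  the quadratic term can only be smaller at \<open>X\<close> than at \<open>Y\<close>. The term with
  \<open>\<rho>\<close> is the same statement for the adjoints of \<open>X\<close> and
  \<open>Y\<close>.\<close>

lemma resolvent_form_dual:
  assumes F: "cptp n m F" and \<rho>: "psd n \<rho>" and \<sigma>: "psd n \<sigma>" and Y: "Y \<in> carrier_mat m m" and t: "t \<ge> 0"
  shows "resolvent_form t (F \<rho>) (F \<sigma>) Y \<le> resolvent_form t \<rho> \<sigma> (dual_map n F Y)"
proof -
  have lin: "linear_map n m F" using F by (auto simp: cptp_def)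
  define X where "X = dual_map n F Y"
  have X: "X \<in> carrier_mat n n" by (simp add: X_def dual_map_def)
  note Xa = carrier_adjoint[OF X] and Ya = carrier_adjoint[OF Y]
  have r: "\<rho> \<in> carrier_mat n n" and s: "\<sigma> \<in> carrier_mat n n" using \<rho> \<sigma> by (auto simp: psd_def)
  note Fr = linear_mapD(1)[OF lin r] and Fs = linear_mapD(1)[OF lin s]
  have dual: "mat_trace (F A * Y) = mat_trace (A * X)" if "A \<in> carrier_mat n n" for A
    unfolding X_def by (rule trace_dual_map[OF lin that Y])
  have 1: "Re (mat_trace (mat_adjoint X * \<sigma> * X)) \<le> Re (mat_trace (mat_adjoint Y * F \<sigma> * Y))"
  proof -
    have "mat_trace (mat_adjoint Y * F \<sigma> * Y) = mat_trace (mat_adjoint Y * (F \<sigma> * Y))"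
      using Y Ya Fs by (simp add: assoc_mult_mat[of _ m m _ m _ m])
    also have "\<dots> = mat_trace (F \<sigma> * (Y * mat_adjoint Y))"
      using Y Ya Fs by (subst trace_comm[of _ m m]) (auto simp: assoc_mult_mat[of _ m m _ m _ m])
    finally show ?thesis
      using cptp_schwarz(1)[OF F \<sigma> X Y] dual[of "mat_adjoint X * \<sigma>"] s Xa by simp
  qed
  have 2: "Re (mat_trace (X * \<rho> * mat_adjoint X)) \<le> Re (mat_trace (Y * F \<rho> * mat_adjoint Y))"
  proof -
    have "mat_trace (Y * F \<rho> * mat_adjoint Y) = mat_trace (Y * (F \<rho> * mat_adjoint Y))"
      using Y Ya Fr by (simp add: assoc_mult_mat[of _ m m _ m _ m])
    also have "\<dots> = mat_trace (F \<rho> * (mat_adjoint Y * Y))"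
      using Y Ya Fr by (subst trace_comm[of _ m m]) (auto simp: assoc_mult_mat[of _ m m _ m _ m])
    finally have a: "mat_trace (Y * F \<rho> * mat_adjoint Y) = mat_trace (F \<rho> * (mat_adjoint Y * Y))" .
    have Fc: "F (\<rho> * mat_adjoint X) \<in> carrier_mat m m" using r Xa by (intro linear_mapD(1)[OF lin]) auto
    \<comment> \<open>Duality is available for \<open>Y\<close>, whereas this term pairs with the
      adjoint of \<open>Y\<close>; complex conjugation of the trace leads back to
      \<open>Y\<close>.\<close>
    have "F (X * \<rho>) = mat_adjoint (F (\<rho> * mat_adjoint X))"
      using cptp_schwarz(2)[OF F \<rho> Xa Ya] by simp
    then have "F (X * \<rho>) * mat_adjoint Y = mat_adjoint (Y * F (\<rho> * mat_adjoint X))"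
      using adjoint_mult[OF Y Fc] by simp
    then have "mat_trace (F (X * \<rho>) * mat_adjoint Y) = cnj (mat_trace (Y * F (\<rho> * mat_adjoint X)))"
      using trace_adjoint[of "Y * F (\<rho> * mat_adjoint X)" m] Y Fc by simp
    also have "mat_trace (Y * F (\<rho> * mat_adjoint X)) = mat_trace (\<rho> * mat_adjoint X * X)"
      using dual[of "\<rho> * mat_adjoint X"] trace_comm[OF Y Fc] r Xa by simp
    also have "\<dots> = mat_trace (X * \<rho> * mat_adjoint X)"
      using trace_comm[of "\<rho> * mat_adjoint X" n n X] X Xa r by (simp add: assoc_mult_mat[of _ n n _ n _ n])
    finally show ?thesis
      using cptp_schwarz(1)[OF F \<rho> Xa Ya] a by simp
  qed
  from 2 have "t * Re (mat_trace (X * \<rho> * mat_adjoint X)) \<le> t * Re (mat_trace (Y * F \<rho> * mat_adjoint Y))"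
    using t by (rule mult_left_mono)
  with 1 show ?thesis unfolding resolvent_form_def X_def[symmetric] using dual[OF r] by simp
qed

section \<open>Data processing inequality\<close>

lemma psd_spectral:
  assumes "psd n A"
  shows "\<exists>U d. unitary_mat n U \<and> (\<forall>i<n. 0 \<le> d i) \<and> A = U * real_diag n d * mat_adjoint U"
proof -
  have A: "A \<in> carrier_mat n n" using assms by (simp add: psd_def)
  obtain U d where U: "unitary_mat n U" and eq: "A = U * real_diag n d * mat_adjoint U"
    using spectral_theorem[OF A psd_hermitian[OF assms]] by blast
  have Um: "U \<in> carrier_mat n n" and Ua: "mat_adjoint U \<in> carrier_mat n n"
    and UU: "mat_adjoint U * U = 1\<^sub>m n"
    using U by (auto simp: unitary_mat_def carrier_adjoint)
  note Dc = real_diag_carrier[of n d]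
  have "mat_adjoint U * A * U = (mat_adjoint U * U) * real_diag n d * (mat_adjoint U * U)"
    unfolding eq using Um Ua Dc by (simp add: assoc_mult_mat[of _ n n _ n _ n])
  also have "\<dots> = real_diag n d" using Dc by (simp add: UU)
  finally have D: "psd n (real_diag n d)" using psd_congruence[OF assms Um] by simp
  have "0 \<le> d i" if i: "i < n" for i
  proof -
    have "0 \<le> real_diag n d $$ (i,i) * 1 * cnj 1 + real_diag n d $$ (i,i) * 0 * cnj 1
        + real_diag n d $$ (i,i) * 1 * cnj 0 + real_diag n d $$ (i,i) * 0 * cnj 0"
      unfolding quad_form_two[OF Dc i i, symmetric] using D by (simp add: psd_def)
    then show ?thesis using i by (simp add: real_diag_def less_eq_complex_def)
  qed
  then show ?thesis using U eq by blast
qed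

lemma cmod_square: "z * cnj z = complex_of_real ((cmod z)\<^sup>2)"
  using complex_norm_square[of z] by simp

lemma trace_conj_diag:
  assumes "M \<in> carrier_mat n m"
  shows "mat_trace (M * real_diag m p * mat_adjoint M) = (\<Sum>j<n. \<Sum>i<m. of_real (p i * (cmod (M $$ (j,i)))\<^sup>2))"
proof -
  have "M * real_diag m p \<in> carrier_mat n m" using assms real_diag_carrier by auto
  then have "mat_trace (M * real_diag m p * mat_adjoint M) = (\<Sum>j<n. \<Sum>i<m. (M * real_diag m p) $$ (j,i) * cnj (M $$ (j,i)))"
    using assms carrier_adjoint[OF assms] by (subst trace_mult[of _ n m]) auto
  also have "\<dots> = (\<Sum>j<n. \<Sum>i<m. of_real (p i * (cmod (M $$ (j,i)))\<^sup>2))"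
  proof (intro sum.cong refl)
    fix j i assume "j \<in> {..<n}" "i \<in> {..<m}"
    then have "(M * real_diag m p) $$ (j,i) = of_real (p i) * M $$ (j,i)"
      using assms by (simp add: real_diag_def scalar_prod_def if_distrib[of "\<lambda>x. _ * x"] mult.commute cong: if_cong)
    then show "(M * real_diag m p) $$ (j,i) * cnj (M $$ (j,i)) = of_real (p i * (cmod (M $$ (j,i)))\<^sup>2)"
      by (simp only: mult.assoc cmod_square of_real_mult)
  qed
  finally show ?thesis .
qed

lemma unitary_row_norm:
  assumes "unitary_mat n W" "i < n"
  shows "(\<Sum>j<n. (cmod (W $$ (i,j)))\<^sup>2) = 1"
proof -
  have W: "W \<in> carrier_mat n n" and "W * mat_adjoint W = 1\<^sub>m n" using assms by (auto simp: unitary_mat_def)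
  then have "(1\<^sub>m n :: complex mat) $$ (i,i) = (W * mat_adjoint W) $$ (i,i)" by simp
  also have "\<dots> = (\<Sum>j<n. W $$ (i,j) * cnj (W $$ (i,j)))"
    using W assms by (simp add: scalar_prod_def atLeast0LessThan)
  also have "\<dots> = of_real (\<Sum>j<n. (cmod (W $$ (i,j)))\<^sup>2)"
    by (simp add: cmod_square del: of_real_power)
  finally show ?thesis using assms by (metis index_one_mat(1) of_real_eq_1_iff)
qed

lemma real_diag_mult_vec:
  "x \<in> carrier_vec n \<Longrightarrow> i < n \<Longrightarrow> (real_diag n d *\<^sub>v x) $ i = of_real (d i) * x $ i"
  by (simp add: real_diag_def scalar_prod_def if_distrib[of "\<lambda>x. x * _"] cong: if_cong)

lemma mult_mat_zero_vec: "A \<in> carrier_mat n m \<Longrightarrow> A *\<^sub>v 0\<^sub>v m = 0\<^sub>v n"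
  by (intro eq_vecI) (auto simp: scalar_prod_def)

lemma mat_kernel_spectral:
  assumes U: "unitary_mat n U"
  shows "w \<in> mat_kernel (U * real_diag n d * mat_adjoint U) \<longleftrightarrow>
    w \<in> carrier_vec n \<and> (\<forall>i<n. of_real (d i) * (mat_adjoint U *\<^sub>v w) $ i = 0)"
proof -
  have Um: "U \<in> carrier_mat n n" and Ua: "mat_adjoint U \<in> carrier_mat n n" and UU: "mat_adjoint U * U = 1\<^sub>m n"
    using U by (auto simp: unitary_mat_def carrier_adjoint)
  note Dc = real_diag_carrier[of n d]
  have "U * real_diag n d * mat_adjoint U *\<^sub>v w = 0\<^sub>v n \<longleftrightarrow> (\<forall>i<n. of_real (d i) * (mat_adjoint U *\<^sub>v w) $ i = 0)"
    if w: "w \<in> carrier_vec n"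
  proof -
    define x where "x = real_diag n d *\<^sub>v (mat_adjoint U *\<^sub>v w)"
    have x: "x \<in> carrier_vec n" using Dc Ua w by (auto simp: x_def)
    have "U * real_diag n d * mat_adjoint U *\<^sub>v w = U *\<^sub>v x"
      unfolding x_def using Um Ua Dc w by (simp add: assoc_mult_mat_vec[of _ n n _ n])
    moreover have "U *\<^sub>v x = 0\<^sub>v n \<longleftrightarrow> x = 0\<^sub>v n"
    proof
      assume 0: "U *\<^sub>v x = 0\<^sub>v n"
      have "x = (mat_adjoint U * U) *\<^sub>v x" using x by (simp add: UU)
      also have "\<dots> = mat_adjoint U *\<^sub>v 0\<^sub>v n" using Um Ua x by (simp only: assoc_mult_mat_vec 0)
      also have "\<dots> = 0\<^sub>v n" by (rule mult_mat_zero_vec[OF Ua])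
      finally show "x = 0\<^sub>v n" .
    qed (simp add: mult_mat_zero_vec[OF Um])
    moreover have "x = 0\<^sub>v n \<longleftrightarrow> (\<forall>i<n. x $ i = 0)"
      using x by (auto intro!: eq_vecI)
    moreover have "x $ i = of_real (d i) * (mat_adjoint U *\<^sub>v w) $ i" if "i < n" for i
      unfolding x_def using that Ua w by (intro real_diag_mult_vec) auto
    ultimately show ?thesis by simp
  qed
  then show ?thesis using Um Ua Dc by (auto simp: mat_kernel_def)
qed

lemma adjoint_mult_vec_index:
  fixes U :: "complex mat"
  assumes "U \<in> carrier_mat n m" "w \<in> carrier_vec n" "i < m"
  shows "(mat_adjoint U *\<^sub>v w) $ i = cnj (col U i \<bullet>c w)"
  using assms by (simp add: scalar_prod_def)

text \<open>The weights \<open>overlap ij * p (fst ij)\<close> and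
  \<open>overlap ij * q (snd ij)\<close> are the (unnormalised) Nussbaum-Szkola distributions of the
  pair, which replace two noncommuting operators by classical data. A locale is used because data
  processing needs them for the input pair and for the output pair.\<close>

locale spectral_pair =
  fixes n :: nat and U V \<rho> \<sigma> :: "complex mat" and p q :: "nat \<Rightarrow> real"
  assumes U: "unitary_mat n U" and V: "unitary_mat n V"
    and \<rho>: "\<rho> = U * real_diag n p * mat_adjoint U" and \<sigma>: "\<sigma> = V * real_diag n q * mat_adjoint V"
    and p_nonneg: "\<And>i. i < n \<Longrightarrow> 0 \<le> p i" and q_nonneg: "\<And>i. i < n \<Longrightarrow> 0 \<le> q i"
begin

definition W where "W = mat_adjoint U * V"

definition overlap :: "nat \<times> nat \<Rightarrow> real" where "overlap ij = (cmod (W $$ ij))\<^sup>2"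

abbreviation "pairs \<equiv> {..<n} \<times> {..<n}"

lemma carriers:
  "U \<in> carrier_mat n n" "V \<in> carrier_mat n n" "mat_adjoint U \<in> carrier_mat n n" "mat_adjoint V \<in> carrier_mat n n"
  "W \<in> carrier_mat n n" "mat_adjoint W \<in> carrier_mat n n" "\<rho> \<in> carrier_mat n n" "\<sigma> \<in> carrier_mat n n" "real_diag n d \<in> carrier_mat n n"
  unfolding W_def \<rho> \<sigma> using U V real_diag_carrier[of n]
  by (auto simp: unitary_mat_def intro!: carrier_adjoint mult_carrier_mat[of _ n n])

lemma units: "mat_adjoint U * U = 1\<^sub>m n" "mat_adjoint V * V = 1\<^sub>m n"
    "U * mat_adjoint U = 1\<^sub>m n" "V * mat_adjoint V = 1\<^sub>m n"
  using U V by (auto simp: unitary_mat_def)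

lemma cancel:
  assumes "Z \<in> carrier_mat n n"
  shows "mat_adjoint U * (U * Z) = Z" "mat_adjoint V * (V * Z) = Z"
    "U * (mat_adjoint U * Z) = Z" "V * (mat_adjoint V * Z) = Z"
  using assms carriers units by (simp_all add: assoc_mult_mat[of _ n n _ n _ n, symmetric])

lemma W_unitary: "unitary_mat n W"
proof -
  have "unitary_mat n (mat_adjoint U)" using U by (auto simp: unitary_mat_def carrier_adjoint)
  then show ?thesis unfolding W_def using V by (rule unitary_mult)
qed

lemma overlap_nonneg: "0 \<le> overlap ij" by (simp add: overlap_def)

lemma nonneg: "ij \<in> pairs \<Longrightarrow> 0 \<le> overlap ij \<and> 0 \<le> p (fst ij) \<and> 0 \<le> q (snd ij)"
  by (auto simp: overlap_nonneg p_nonneg q_nonneg)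

text \<open>Rows of a unitary have norm one, so a sum over eigenvalues of \<open>\<rho>\<close> may
  be spread over all pairs.\<close>

lemma sum_overlap: "(\<Sum>ij\<in>pairs. overlap ij * f (fst ij)) = (\<Sum>i<n. f i)"
proof -
  have "(\<Sum>ij\<in>pairs. overlap ij * f (fst ij)) = (\<Sum>i<n. (\<Sum>j<n. overlap (i,j)) * f i)"
    by (simp add: sum.cartesian_product split_def sum_distrib_right)
  also have "\<dots> = (\<Sum>i<n. f i)" 
    by (rule sum.cong) (auto simp: overlap_def unitary_row_norm[OF W_unitary])
  finally show ?thesis .
qed

lemma trace_rho_diag: "mat_trace (U * real_diag n d * mat_adjoint U) = (\<Sum>i<n. of_real (d i))"
proof -
  have "mat_trace (U * real_diag n d * mat_adjoint U) = mat_trace (mat_adjoint U * (U * real_diag n d))"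
    using carriers by (intro trace_comm[of _ n n]) auto
  also have "\<dots> = (\<Sum>i<n. of_real (d i))"
    by (simp add: cancel real_diag_carrier) (simp add: mat_trace_def real_diag_def)
  finally show ?thesis .
qed

lemma trace_rho: "mat_trace \<rho> = (\<Sum>ij\<in>pairs. of_real (overlap ij * p (fst ij)))"
  using arg_cong[OF sum_overlap[of p], of complex_of_real] by (simp add: \<rho> trace_rho_diag)

text \<open>In the coordinates \<open>V * M * mat_adjoint U\<close>, left multiplication by
  \<open>\<sigma>\<close> and right multiplication by \<open>\<rho>\<close> are both diagonal, with
  eigenvalues \<open>q j\<close> and \<open>p i\<close>. The form therefore splits into independent
  scalar quadratics, one for each entry of \<open>M\<close>.\<close>

lemma resolvent_form_spectral:
  assumes M: "M \<in> carrier_mat n n"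
  shows "resolvent_form t \<rho> \<sigma> (V * M * mat_adjoint U) =
    (\<Sum>(i,j)\<in>pairs. 2 * p i * Re (W $$ (i,j) * M $$ (j,i)) - (q j + t * p i) * (cmod (M $$ (j,i)))\<^sup>2)"
proof -
  let ?X = "V * M * mat_adjoint U"
  note c = carriers M carrier_adjoint[OF M] mult_carrier_mat[of _ n n _ n]
  note as = assoc_mult_mat[of _ n n _ n _ n] mult_carrier_mat[of _ n n _ n]
  have Xa: "mat_adjoint ?X = U * mat_adjoint M * mat_adjoint V"
    using c by (simp add: adjoint_mult[of _ n n _ n] as)
  have 1: "mat_trace (\<rho> * ?X) = (\<Sum>i<n. \<Sum>j<n. of_real (p i) * (W $$ (i,j) * M $$ (j,i)))"
  proof -
    have "\<rho> * ?X = U * (real_diag n p * (W * M) * mat_adjoint U)"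
      unfolding \<rho> W_def using c by (simp add: as)
    then have "mat_trace (\<rho> * ?X) = mat_trace ((real_diag n p * (W * M) * mat_adjoint U) * U)"
      by (simp only:, intro trace_comm[of _ n n]; simp add: c)
    also have "(real_diag n p * (W * M) * mat_adjoint U) * U = (real_diag n p * W) * M"
      using c by (simp add: as units)
    also have "mat_trace \<dots> = (\<Sum>i<n. \<Sum>j<n. (real_diag n p * W) $$ (i,j) * M $$ (j,i))"
      by (intro trace_mult; simp add: c)
    also have "\<dots> = (\<Sum>i<n. \<Sum>j<n. of_real (p i) * (W $$ (i,j) * M $$ (j,i)))"
      by (intro sum.cong refl) (simp add: diag_left[OF carriers(5)] mult.assoc del: index_mult_mat(1))
    finally show ?thesis .
  qed
  have 2: "mat_trace (mat_adjoint ?X * \<sigma> * ?X) = (\<Sum>i<n. \<Sum>j<n. of_real (q j * (cmod (M $$ (j,i)))\<^sup>2))"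
  proof -
    have "mat_adjoint ?X * \<sigma> * ?X = U * (mat_adjoint M * real_diag n q * M * mat_adjoint U)"
      unfolding Xa \<sigma> using c by (simp add: as cancel)
    then have "mat_trace (mat_adjoint ?X * \<sigma> * ?X) = mat_trace ((mat_adjoint M * real_diag n q * M * mat_adjoint U) * U)"
      by (simp only:, intro trace_comm[of _ n n]; simp add: c)
    also have "(mat_adjoint M * real_diag n q * M * mat_adjoint U) * U = mat_adjoint M * real_diag n q * mat_adjoint (mat_adjoint M)"
      using c by (simp add: as units)
    also have "mat_trace \<dots> = (\<Sum>i<n. \<Sum>j<n. of_real (q j * (cmod (mat_adjoint M $$ (i,j)))\<^sup>2))"
      using trace_conj_diag[OF c(11)] .
    finally show ?thesis using M by simp
  qed
  have 3: "mat_trace (?X * \<rho> * mat_adjoint ?X) = (\<Sum>i<n. \<Sum>j<n. of_real (p i * (cmod (M $$ (j,i)))\<^sup>2))"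
  proof -
    have "?X * \<rho> * mat_adjoint ?X = V * (M * real_diag n p * mat_adjoint M * mat_adjoint V)"
      unfolding Xa \<rho> using c by (simp add: as cancel)
    then have "mat_trace (?X * \<rho> * mat_adjoint ?X) = mat_trace ((M * real_diag n p * mat_adjoint M * mat_adjoint V) * V)"
      by (simp only:, intro trace_comm[of _ n n]; simp add: c)
    also have "(M * real_diag n p * mat_adjoint M * mat_adjoint V) * V = M * real_diag n p * mat_adjoint M"
      using c by (simp add: as units)
    also have "mat_trace \<dots> = (\<Sum>j<n. \<Sum>i<n. of_real (p i * (cmod (M $$ (j,i)))\<^sup>2))"
      by (rule trace_conj_diag[OF M])
    finally show ?thesis by (subst sum.swap) simp
  qed
  show ?thesis
    unfolding resolvent_form_def 1 2 3
    by (simp add: sum.cartesian_product[symmetric] sum_distrib_left sum_subtractf[symmetric] algebra_simps sum.distrib)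
qed

text \<open>Completing the square separately for every pair of eigenvectors bounds each scalar
  quadratic by its maximum.\<close>

lemma resolvent_form_le:
  assumes X: "X \<in> carrier_mat n n" and t: "t > 0"
  shows "resolvent_form t \<rho> \<sigma> X \<le> (\<Sum>ij\<in>pairs. overlap ij * (p (fst ij))\<^sup>2 / (q (snd ij) + t * p (fst ij)))"
proof -
  define M where "M = mat_adjoint V * X * U"
  have M: "M \<in> carrier_mat n n" using carriers X by (auto simp: M_def)
  have "X = V * M * mat_adjoint U"
    unfolding M_def using carriers X by (simp add: assoc_mult_mat[of _ n n _ n _ n] mult_carrier_mat[of _ n n _ n] cancel units)
  then have "resolvent_form t \<rho> \<sigma> X =
    (\<Sum>(i,j)\<in>pairs. 2 * p i * Re (W $$ (i,j) * M $$ (j,i)) - (q j + t * p i) * (cmod (M $$ (j,i)))\<^sup>2)"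
    using resolvent_form_spectral[OF M] by simp
  also have "\<dots> \<le> (\<Sum>ij\<in>pairs. overlap ij * (p (fst ij))\<^sup>2 / (q (snd ij) + t * p (fst ij)))"
  proof (rule sum_mono)
    fix ij assume "ij \<in> pairs"
    then obtain i j where ij_eq: "ij = (i,j)" and ij: "i < n" "j < n" by auto
    define w m where "w = W $$ (i,j)" and "m = M $$ (j,i)"
    define r where "r = q j + t * p i"
    have pq: "p i \<ge> 0" "q j \<ge> 0" using ij by (auto simp: p_nonneg q_nonneg)
    then have r: "r \<ge> 0" using t by (simp add: r_def)
    have "2 * p i * Re (w * m) - r * (cmod m)\<^sup>2 \<le> (cmod w)\<^sup>2 * (p i)\<^sup>2 / r"
    \<comment> \<open>As t > 0, \<open>r = 0\<close> forces \<open>p i = 0\<close>, and both sides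
      vanish because division by zero yields 0.\<close>
    proof (cases "r = 0")
      case True
      then have "p i = 0" using pq t by (auto simp: r_def add_nonneg_eq_0_iff)
      then show ?thesis using True by simp
    next
      case False
      have "Re (w * m) \<le> cmod w * cmod m" by (metis complex_Re_le_cmod norm_mult)
      then have "p i * Re (w * m) \<le> p i * (cmod w * cmod m)" using pq by (intro mult_left_mono) auto
      moreover have "0 \<le> (cmod w * p i - r * cmod m)\<^sup>2 / r" using r by simp
      then have "2 * (p i * (cmod w * cmod m)) - r * (cmod m)\<^sup>2 \<le> (cmod w)\<^sup>2 * (p i)\<^sup>2 / r"
        using False r by (simp add: power2_eq_square field_simps)
      ultimately show ?thesis by linarith
    qed
    then show "(case ij of (i,j) \<Rightarrow> 2 * p i * Re (W $$ (i, j) * M $$ (j, i)) - (q j + t * p i) * (cmod (M $$ (j, i)))\<^sup>2)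
       \<le> overlap ij * (p (fst ij))\<^sup>2 / (q (snd ij) + t * p (fst ij))"
      by (simp add: ij_eq w_def m_def r_def overlap_def)
  qed
  finally show ?thesis .
qed

text \<open>\<open>M\<close> collects the maximisers of the scalar quadratics. Attainment is what is
  needed for the output pair, whose optimal \<open>Y\<close> is pulled back by
  \<open>dual_map\<close>; for the input pair the upper bound suffices.\<close>

lemma resolvent_form_attained:
  assumes t: "t > 0"
  shows "\<exists>X \<in> carrier_mat n n. resolvent_form t \<rho> \<sigma> X =
    (\<Sum>ij\<in>pairs. overlap ij * (p (fst ij))\<^sup>2 / (q (snd ij) + t * p (fst ij)))"
proof -
  define M where "M = mat n n (\<lambda>(j,i). cnj (W $$ (i,j)) * of_real (p i / (q j + t * p i)))"
  have M: "M \<in> carrier_mat n n" by (simp add: M_def)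
  have "resolvent_form t \<rho> \<sigma> (V * M * mat_adjoint U)
     = (\<Sum>ij\<in>pairs. overlap ij * (p (fst ij))\<^sup>2 / (q (snd ij) + t * p (fst ij)))"
    unfolding resolvent_form_spectral[OF M]
  proof (rule sum.cong[OF refl])
    fix ij assume "ij \<in> pairs"
    then obtain i j where ij_eq: "ij = (i,j)" and ij: "i < n" "j < n" by auto
    define r where "r = q j + t * p i"
    have pq: "p i \<ge> 0" "q j \<ge> 0" using ij by (auto simp: p_nonneg q_nonneg)
    have "M $$ (j,i) = cnj (W $$ (i,j)) * of_real (p i / r)" using ij by (simp add: M_def r_def)
    then have 1: "W $$ (i,j) * M $$ (j,i) = of_real (overlap (i,j) * (p i / r))"
      and 2: "(cmod (M $$ (j,i)))\<^sup>2 = overlap (i,j) * (p i / r)\<^sup>2"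
      by (simp_all only: mult.assoc[symmetric] cmod_square overlap_def of_real_mult)
        (simp_all add: norm_mult power_mult_distrib norm_divide power_divide)
    have "2 * p i * (overlap (i,j) * (p i / r)) - r * (overlap (i,j) * (p i / r)\<^sup>2) = overlap (i,j) * (p i)\<^sup>2 / r"
      by (cases "r = 0") (simp_all add: power2_eq_square field_simps)
    then show "(case ij of (i,j) \<Rightarrow> 2 * p i * Re (W $$ (i, j) * M $$ (j, i)) - (q j + t * p i) * (cmod (M $$ (j, i)))\<^sup>2)
       = overlap ij * (p (fst ij))\<^sup>2 / (q (snd ij) + t * p (fst ij))"
      unfolding ij_eq prod.case fst_conv snd_conv 1 2 r_def[symmetric] by (simp only: Re_complex_of_real)
  qed
  then show ?thesis using carriers M by (intro bexI[of _ "V * M * mat_adjoint U"]) auto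
qed

text \<open>Inclusion of supports is reverse inclusion of kernels. An eigenvector of
  \<open>\<rho>\<close> with nonzero eigenvalue must be orthogonal to every kernel eigenvector of
  \<open>\<sigma>\<close>, which is the condition on the overlaps. Conversely, expanding a kernel
  vector of \<open>\<sigma>\<close> in the columns of \<open>V\<close> shows that
  \<open>\<rho>\<close> annihilates it.\<close>

lemma supp_subset_iff:
  "mat_supp \<rho> \<subseteq> mat_supp \<sigma> \<longleftrightarrow> (\<forall>ij\<in>pairs. overlap ij * p (fst ij) \<noteq> 0 \<longrightarrow> q (snd ij) \<noteq> 0)"
proof (intro iffI ballI impI)
  fix ij assume sub: "mat_supp \<rho> \<subseteq> mat_supp \<sigma>" and "ij \<in> pairs" and nz: "overlap ij * p (fst ij) \<noteq> 0"
  then obtain i j where ij: "ij = (i,j)" "i < n" "j < n" by auto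
  have "col U i \<in> mat_supp \<rho>"
    using nz ij carriers(1,7)
    by (auto simp: mat_supp_def \<rho> mat_kernel_spectral[OF U] adjoint_mult_vec_index[of U n n] simp del: index_mult_mat_vec) blast
  then have supp: "col U i \<in> mat_supp \<sigma>" using sub by blast
  show "q (snd ij) \<noteq> 0"
  proof
    assume q: "q (snd ij) = 0"
    have "mat_adjoint V *\<^sub>v col V j = col (mat_adjoint V * V) j"
      using carriers ij by (simp add: col_mult2[of _ n n _ n] del: col_mult)
    also have "\<dots> = unit_vec n j" using ij by (simp add: units)
    finally have "col V j \<in> mat_kernel \<sigma>"
      using ij q carriers by (auto simp: \<sigma> mat_kernel_spectral[OF V])
    then have "col U i \<bullet>c col V j = 0" using supp by (auto simp: mat_supp_def)
    moreover have "W $$ (i,j) = cnj (col U i \<bullet>c col V j)"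
      using ij carriers by (simp add: W_def scalar_prod_def)
    ultimately show False using nz ij by (simp add: overlap_def)
  qed
next
  assume *: "\<forall>ij\<in>pairs. overlap ij * p (fst ij) \<noteq> 0 \<longrightarrow> q (snd ij) \<noteq> 0"
  have "w \<in> mat_kernel \<rho>" if "w \<in> mat_kernel \<sigma>" for w
  proof -
    define c where "c = mat_adjoint V *\<^sub>v w"
    have w: "w \<in> carrier_vec n" and qc: "\<And>j. j < n \<Longrightarrow> of_real (q j) * c $ j = 0"
      using that by (auto simp: \<sigma> mat_kernel_spectral[OF V] c_def)
    have c: "c \<in> carrier_vec n" using carriers w by (simp add: c_def)
    have "mat_adjoint U *\<^sub>v w = W *\<^sub>v c"
    proof -
      have "W *\<^sub>v c = mat_adjoint U *\<^sub>v ((V * mat_adjoint V) *\<^sub>v w)"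
        unfolding W_def c_def using carriers w
        by (simp add: assoc_mult_mat_vec[of _ n n _ n])
      then show ?thesis using w by (simp add: units)
    qed
    moreover have "of_real (p i) * (W *\<^sub>v c) $ i = 0" if i: "i < n" for i
    proof -
      have "of_real (p i) * (W *\<^sub>v c) $ i = (\<Sum>j<n. of_real (p i) * (W $$ (i,j) * c $ j))"
        using i c carriers(5) by (simp add: scalar_prod_def sum_distrib_left atLeast0LessThan)
      also have "\<dots> = 0"
      proof (rule sum.neutral, rule ballI)
        fix j assume j: "j \<in> {..<n}"
        show "of_real (p i) * (W $$ (i,j) * c $ j) = 0"
          using bspec[OF *, of "(i,j)"] i j qc[of j] by (auto simp: overlap_def)
      qed
      finally show ?thesis .
    qed
    ultimately show ?thesis using w by (simp add: \<rho> mat_kernel_spectral[OF U])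
  qed
  then show "mat_supp \<rho> \<subseteq> mat_supp \<sigma>"
    using carriers(7,8) by (auto simp: mat_supp_def)
qed

text \<open>The term with \<open>mat_log n \<rho>\<close> involves only the eigenvalues of
  \<open>\<rho>\<close>; \<open>sum_overlap\<close> brings it to the index set of the cross term.
  The divisor \<open>ln 2\<close> comes from the logarithm to base 2.\<close>

lemma rel_entropy_spectral:
  assumes "mat_supp \<rho> \<subseteq> mat_supp \<sigma>"
  shows "rel_entropy n \<rho> \<sigma> = ereal ((\<Sum>ij\<in>pairs. overlap ij * p (fst ij) * (ln (p (fst ij)) - ln (q (snd ij)))) / ln 2)"
proof -
  let ?lp = "real_diag n (\<lambda>i. log 2 (p i))" and ?lq = "real_diag n (\<lambda>i. log 2 (q i))"
  note as = assoc_mult_mat[of _ n n _ n _ n] mult_carrier_mat[of _ n n _ n]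
  have lr: "mat_log n \<rho> = U * ?lp * mat_adjoint U" and ls: "mat_log n \<sigma> = V * ?lq * mat_adjoint V"
    using U V \<rho> \<sigma> unfolding is_mat_log_def by (blast intro!: mat_log_unique[unfolded is_mat_log_def])+
  have "\<rho> * (mat_log n \<rho> - mat_log n \<sigma>) = \<rho> * mat_log n \<rho> - \<rho> * mat_log n \<sigma>"
    unfolding lr ls by (intro mult_minus_distrib_mat[of _ n n _ n]; simp add: carriers as)
  then have "mat_trace (\<rho> * (mat_log n \<rho> - mat_log n \<sigma>)) = mat_trace (\<rho> * mat_log n \<rho>) - mat_trace (\<rho> * mat_log n \<sigma>)"
    by (simp only:, intro trace_minus[of _ n]; simp add: lr ls carriers as)
  also have "mat_trace (\<rho> * mat_log n \<rho>) = of_real (\<Sum>ij\<in>pairs. overlap ij * (p (fst ij) * log 2 (p (fst ij))))"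
  proof -
    have "real_diag n p * ?lp = real_diag n (\<lambda>i. p i * log 2 (p i))"
      by (rule eq_matI) (auto simp: real_diag_def scalar_prod_def if_distrib[of "\<lambda>x. x * _"] cong: if_cong)
    moreover have "\<rho> * mat_log n \<rho> = U * (real_diag n p * ?lp) * mat_adjoint U"
      unfolding lr unfolding \<rho> by (simp add: as carriers cancel)
    ultimately show ?thesis using sum_overlap[of "\<lambda>i. p i * log 2 (p i)"] by (simp add: trace_rho_diag)
  qed
  also have "mat_trace (\<rho> * mat_log n \<sigma>) = of_real (\<Sum>ij\<in>pairs. overlap ij * (p (fst ij) * log 2 (q (snd ij))))"
  proof -
    have "\<rho> * mat_log n \<sigma> = U * (real_diag n p * (W * ?lq * mat_adjoint V))"
      unfolding ls \<rho> W_def using carriers by (simp add: as)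
    then have "mat_trace (\<rho> * mat_log n \<sigma>) = mat_trace (real_diag n p * (W * ?lq * mat_adjoint V) * U)"
      by (simp only:, intro trace_comm[of _ n n]; simp add: carriers as)
    also have "real_diag n p * (W * ?lq * mat_adjoint V) * U = (real_diag n p * (W * ?lq)) * mat_adjoint W"
      unfolding W_def using carriers by (simp add: as adjoint_mult[of _ n n _ n])
    also have "mat_trace \<dots> = (\<Sum>i<n. \<Sum>j<n. (real_diag n p * (W * ?lq)) $$ (i,j) * mat_adjoint W $$ (j,i))"
      by (intro trace_mult; simp add: as carriers)
    also have "\<dots> = (\<Sum>i<n. \<Sum>j<n. of_real (overlap (i,j) * (p i * log 2 (q j))))"
    proof (intro sum.cong refl)
      fix i j assume ij: "i \<in> {..<n}" "j \<in> {..<n}"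
      have "W * ?lq \<in> carrier_mat n n" using carriers by auto
      then have "(real_diag n p * (W * ?lq)) $$ (i,j) = of_real (p i) * (of_real (log 2 (q j)) * W $$ (i,j))"
        using ij by (simp only: diag_left diag_right[OF carriers(5)] lessThan_iff)
      moreover have "mat_adjoint W $$ (j,i) = cnj (W $$ (i,j))" using ij carriers(5) by simp
      moreover have "W $$ (i,j) * cnj (W $$ (i,j)) = of_real (overlap (i,j))"
        by (simp only: cmod_square overlap_def)
      ultimately show "(real_diag n p * (W * ?lq)) $$ (i,j) * mat_adjoint W $$ (j,i) = of_real (overlap (i,j) * (p i * log 2 (q j)))"
        by (simp add: mult_ac)
    qed
    finally show ?thesis by (simp add: sum.cartesian_product split_def)
  qed
  finally have "Re (mat_trace (\<rho> * (mat_log n \<rho> - mat_log n \<sigma>))) =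
     (\<Sum>ij\<in>pairs. overlap ij * p (fst ij) * (ln (p (fst ij)) - ln (q (snd ij)))) / ln 2"
    by (simp add: log_def sum_divide_distrib sum_subtractf[symmetric] algebra_simps diff_divide_distrib)
  then show ?thesis using assms by (simp add: rel_entropy_def)
qed

end

lemma cptp_psd:
  assumes F: "cptp n m F" and A: "psd n A"
  shows "psd m (F A)"
proof -
  have Ac: "A \<in> carrier_mat n n" using A by (simp add: psd_def)
  have Fc: "F A \<in> carrier_mat m m" using F Ac linear_mapD(1) by (auto simp: cptp_def)
  have "mat n n (($$) A) = A" using Ac by (intro eq_matI) auto
  then have "apply_on 1 n m 1 F A = F A"
    using Ac Fc by (intro eq_matI) (auto simp: apply_on_def)
  then show ?thesis
    using F A unfolding cptp_def completely_positive_def by (metis mult_1)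
qed

theorem data_processing:
  assumes F: "cptp n m F" and \<rho>: "psd n \<rho>" and \<sigma>: "psd n \<sigma>"
  shows "rel_entropy m (F \<rho>) (F \<sigma>) \<le> rel_entropy n \<rho> \<sigma>"
proof (cases "mat_supp \<rho> \<subseteq> mat_supp \<sigma>")
  case supp: True
  obtain U p where Up: "unitary_mat n U" "\<forall>i<n. 0 \<le> p i" "\<rho> = U * real_diag n p * mat_adjoint U"
    using psd_spectral[OF \<rho>] by blast
  obtain V q where Vq: "unitary_mat n V" "\<forall>i<n. 0 \<le> q i" "\<sigma> = V * real_diag n q * mat_adjoint V"
    using psd_spectral[OF \<sigma>] by blast
  obtain U' p' where Up': "unitary_mat m U'" "\<forall>i<m. 0 \<le> p' i" "F \<rho> = U' * real_diag m p' * mat_adjoint U'"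
    using psd_spectral[OF cptp_psd[OF F \<rho>]] by blast
  obtain V' q' where Vq': "unitary_mat m V'" "\<forall>i<m. 0 \<le> q' i" "F \<sigma> = V' * real_diag m q' * mat_adjoint V'"
    using psd_spectral[OF cptp_psd[OF F \<sigma>]] by blast
  interpret i: spectral_pair n U V \<rho> \<sigma> p q by unfold_locales (use Up Vq in auto)
  interpret o: spectral_pair m U' V' "F \<rho>" "F \<sigma>" p' q' by unfold_locales (use Up' Vq' in auto)
  have le: "(\<Sum>ij\<in>o.pairs. o.overlap ij * (p' (fst ij))\<^sup>2 / (q' (snd ij) + t * p' (fst ij)))
     \<le> (\<Sum>ij\<in>i.pairs. i.overlap ij * (p (fst ij))\<^sup>2 / (q (snd ij) + t * p (fst ij)))" if t: "t > 0" for t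
  proof -
    obtain Y where Y: "Y \<in> carrier_mat m m" and eq: "resolvent_form t (F \<rho>) (F \<sigma>) Y =
        (\<Sum>ij\<in>o.pairs. o.overlap ij * (p' (fst ij))\<^sup>2 / (q' (snd ij) + t * p' (fst ij)))"
      using o.resolvent_form_attained[OF t] by blast
    have "resolvent_form t (F \<rho>) (F \<sigma>) Y \<le> resolvent_form t \<rho> \<sigma> (dual_map n F Y)"
      using t by (intro resolvent_form_dual[OF F \<rho> \<sigma> Y]) simp
    also have "\<dots> \<le> (\<Sum>ij\<in>i.pairs. i.overlap ij * (p (fst ij))\<^sup>2 / (q (snd ij) + t * p (fst ij)))"
      by (rule i.resolvent_form_le[OF _ t]) (simp add: dual_map_def)
    finally show ?thesis using eq by simp
  qed
  have s: "q (snd ij) \<noteq> 0" if "ij \<in> i.pairs" "i.overlap ij * p (fst ij) \<noteq> 0" for ij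
    using supp that unfolding i.supp_subset_iff by blast
  have s': "q' (snd ij) \<noteq> 0" if "ij \<in> o.pairs" "o.overlap ij * p' (fst ij) \<noteq> 0" for ij
    by (rule resolvent_domination_imp_support[where w = i.overlap and p = "\<lambda>ij. p (fst ij)" and q = "\<lambda>ij. q (snd ij)"
      and I = i.pairs and w' = o.overlap and p' = "\<lambda>ij. p' (fst ij)" and q' = "\<lambda>ij. q' (snd ij)" and J = o.pairs, OF _ i.nonneg o.nonneg le s that]) auto
  then have supp': "mat_supp (F \<rho>) \<subseteq> mat_supp (F \<sigma>)"
    unfolding o.supp_subset_iff by blast
  \<comment> \<open>Trace preservation yields the equality of masses that cancels the divergent
    terms as t grows.\<close>
  have "mat_trace (F \<rho>) = mat_trace \<rho>"
    using F i.carriers(7) by (simp add: cptp_def trace_preserving_def)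
  then have "complex_of_real (\<Sum>ij\<in>o.pairs. o.overlap ij * p' (fst ij)) = of_real (\<Sum>ij\<in>i.pairs. i.overlap ij * p (fst ij))"
    by (simp add: o.trace_rho i.trace_rho)
  then have mass: "(\<Sum>ij\<in>o.pairs. o.overlap ij * p' (fst ij)) = (\<Sum>ij\<in>i.pairs. i.overlap ij * p (fst ij))"
    by (simp only: of_real_eq_iff)
  have "(\<Sum>ij\<in>o.pairs. o.overlap ij * p' (fst ij) * (ln (p' (fst ij)) - ln (q' (snd ij))))
      \<le> (\<Sum>ij\<in>i.pairs. i.overlap ij * p (fst ij) * (ln (p (fst ij)) - ln (q (snd ij))))"
    by (rule resolvent_domination_imp_entropy_le[where w = i.overlap and p = "\<lambda>ij. p (fst ij)" and q = "\<lambda>ij. q (snd ij)"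
      and I = i.pairs and w' = o.overlap and p' = "\<lambda>ij. p' (fst ij)" and q' = "\<lambda>ij. q' (snd ij)" and J = o.pairs, OF i.nonneg o.nonneg le s s' mass])
  then show ?thesis
    unfolding i.rel_entropy_spectral[OF supp] o.rel_entropy_spectral[OF supp'] by (simp add: divide_right_mono)
qed (simp add: rel_entropy_def)

section \<open>Quantum operations on subsystems\<close>

lemma kron_dims[simp]: "dim_row (kron A B) = dim_row A * dim_row B" "dim_col (kron A B) = dim_col A * dim_col B"
  by (simp_all add: kron_def)

lemma kron_index':
  "i < dim_row A * dim_row B \<Longrightarrow> j < dim_col A * dim_col B \<Longrightarrow>
    kron A B $$ (i,j) = A $$ (i div dim_row B, j div dim_col B) * B $$ (i mod dim_row B, j mod dim_col B)"
  by (simp add: kron_def)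

lemma sum_lessThan_mult:
  fixes f :: "nat \<Rightarrow> nat \<Rightarrow> 'a :: comm_monoid_add"
  shows "(\<Sum>k<a * b. f (k div b) (k mod b)) = (\<Sum>i<a. \<Sum>j<b. f i j)"
proof -
  have "(\<Sum>i<a. \<Sum>j<b. f i j) = (\<Sum>(i,j)\<in>{..<a} \<times> {..<b}. f i j)"
    by (simp add: sum.cartesian_product)
  also have "\<dots> = (\<Sum>k<a * b. f (k div b) (k mod b))"
    by (rule sum.reindex_bij_witness[of _ "\<lambda>k. (k div b, k mod b)" "\<lambda>(i,j). i * b + j"])
      (auto simp: mixed_radix_less dest: div_mod_less)
  finally show ?thesis by simp
qed

lemma kron_mult:
  assumes "A \<in> carrier_mat a b" "B \<in> carrier_mat c d" "C \<in> carrier_mat b x" "D \<in> carrier_mat d y"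
  shows "kron A B * kron C D = kron (A * C) (B * D)"
proof (rule eq_matI)
  fix i j assume "i < dim_row (kron (A * C) (B * D))" "j < dim_col (kron (A * C) (B * D))"
  then have ij: "i < a * c" "j < x * y" using assms by auto
  then have d: "i div c < a" "i mod c < c" "j div y < x" "j mod y < y" by (auto dest: div_mod_less)
  have "(kron A B * kron C D) $$ (i,j) = (\<Sum>k<b * d. kron A B $$ (i,k) * kron C D $$ (k,j))"
    using assms ij by (auto simp: scalar_prod_def atLeast0LessThan)
  also have "\<dots> = (\<Sum>k<b * d. (A $$ (i div c, k div d) * B $$ (i mod c, k mod d)) * (C $$ (k div d, j div y) * D $$ (k mod d, j mod y)))"
    by (rule sum.cong[OF refl]) (use assms ij in \<open>auto simp: kron_index'\<close>)
  also have "\<dots> = (\<Sum>k<b. \<Sum>l<d. (A $$ (i div c, k) * B $$ (i mod c, l)) * (C $$ (k, j div y) * D $$ (l, j mod y)))"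
    by (rule sum_lessThan_mult)
  also have "\<dots> = (\<Sum>k<b. A $$ (i div c, k) * C $$ (k, j div y)) * (\<Sum>l<d. B $$ (i mod c, l) * D $$ (l, j mod y))"
    by (simp add: sum_product mult_ac)
  also have "\<dots> = kron (A * C) (B * D) $$ (i,j)"
    using assms ij d by (simp add: kron_index' scalar_prod_def atLeast0LessThan)
  finally show "(kron A B * kron C D) $$ (i,j) = kron (A * C) (B * D) $$ (i,j)" .
qed (use assms in auto)

lemma adjoint_kron: "mat_adjoint (kron A B) = kron (mat_adjoint A) (mat_adjoint B)"
proof (rule eq_matI)
  fix i j assume "i < dim_row (kron (mat_adjoint A) (mat_adjoint B))" "j < dim_col (kron (mat_adjoint A) (mat_adjoint B))"
  then have ij: "i < dim_col A * dim_col B" "j < dim_row A * dim_row B" by auto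
  then have "i div dim_col B < dim_col A" "i mod dim_col B < dim_col B" "j div dim_row B < dim_row A" "j mod dim_row B < dim_row B"
    by (auto dest: div_mod_less)
  then show "mat_adjoint (kron A B) $$ (i,j) = kron (mat_adjoint A) (mat_adjoint B) $$ (i,j)"
    using ij by (simp add: kron_index')
qed auto

lemma adjoint_one[simp]: "mat_adjoint (1\<^sub>m k) = (1\<^sub>m k :: complex mat)"
  by (rule eq_matI) auto

lemma kron_one: "kron (1\<^sub>m 1) A = A" "kron A (1\<^sub>m 1) = A"
  by (rule eq_matI; simp add: kron_def)+

lemma kron_assoc: "kron (kron A B) C = kron A (kron B C)"
proof (rule eq_matI)
  fix i j assume "i < dim_row (kron A (kron B C))" "j < dim_col (kron A (kron B C))"
  then have ij: "i < dim_row A * dim_row B * dim_row C" "j < dim_col A * dim_col B * dim_col C"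
    by (simp_all add: mult.assoc)
  have *: "x div c div b = x div (b * c) \<and> x div c mod b = x mod (b * c) div c \<and> x mod c = x mod (b * c) mod c"
    for x b c :: nat
  proof -
    have "x mod (b * c) = c * (x div c mod b) + x mod c" by (metis mod_mult2_eq mult.commute)
    moreover have "x div c div b = x div (b * c)" by (metis div_mult2_eq mult.commute)
    ultimately show ?thesis by (cases "c = 0") auto
  qed
  have d: "i div dim_row C < dim_row A * dim_row B" "j div dim_col C < dim_col A * dim_col B"
    using ij by (auto dest: div_mod_less)
  have i2: "i < dim_row A * (dim_row B * dim_row C)" "j < dim_col A * (dim_col B * dim_col C)"
    using ij by (simp_all add: mult.assoc)
  then have e: "i mod (dim_row B * dim_row C) < dim_row B * dim_row C" "j mod (dim_col B * dim_col C) < dim_col B * dim_col C"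
    by (auto dest: div_mod_less)
  show "kron (kron A B) C $$ (i,j) = kron A (kron B C) $$ (i,j)"
    using ij i2 d e *[of i "dim_row C" "dim_row B"] *[of j "dim_col C" "dim_col B"]
    by (simp add: kron_index')
qed (simp_all add: mult.assoc)

lemma kron_add:
  assumes "X \<in> carrier_mat n n" "Y \<in> carrier_mat n n"
  shows "kron A (X + Y) = kron A X + kron A Y"
proof (rule eq_matI)
  fix i j assume "i < dim_row (kron A X + kron A Y)" "j < dim_col (kron A X + kron A Y)"
  then have ij: "i < dim_row A * n" "j < dim_col A * n" using assms by auto
  then show "kron A (X + Y) $$ (i,j) = (kron A X + kron A Y) $$ (i,j)"
    using assms div_mod_less[OF ij(1)] div_mod_less[OF ij(2)] by (simp add: kron_index' algebra_simps)
qed (use assms in auto)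

lemma kron_smult: "kron A (c \<cdot>\<^sub>m X) = c \<cdot>\<^sub>m kron A X"
proof (rule eq_matI)
  fix i j assume "i < dim_row (c \<cdot>\<^sub>m kron A X)" "j < dim_col (c \<cdot>\<^sub>m kron A X)"
  then have ij: "i < dim_row A * dim_row X" "j < dim_col A * dim_col X" by auto
  then show "kron A (c \<cdot>\<^sub>m X) $$ (i,j) = (c \<cdot>\<^sub>m kron A X) $$ (i,j)"
    using div_mod_less[OF ij(1)] div_mod_less[OF ij(2)] by (simp add: kron_index' algebra_simps)
qed auto

lemma linear_map_kron: "A \<in> carrier_mat a a \<Longrightarrow> linear_map n (a * n) (kron A)"
  unfolding linear_map_def by (auto simp: kron_add kron_smult intro: kron_carrier)

lemma trace_kron:
  assumes "A \<in> carrier_mat a a" "B \<in> carrier_mat b b"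
  shows "mat_trace (kron A B) = mat_trace A * mat_trace B"
proof -
  have "mat_trace (kron A B) = (\<Sum>k<a * b. A $$ (k div b, k div b) * B $$ (k mod b, k mod b))"
    using assms by (auto simp: mat_trace_def kron_index' intro!: sum.cong)
  also have "\<dots> = (\<Sum>i<a. \<Sum>j<b. A $$ (i,i) * B $$ (j,j))" by (rule sum_lessThan_mult)
  also have "\<dots> = mat_trace A * mat_trace B" using assms by (simp add: mat_trace_def sum_product)
  finally show ?thesis .
qed

section \<open>Extensionality of linear maps on product operators\<close>

lemma matrix_unit_kron:
  assumes "i < a * b" "j < a * b"
  shows "matrix_unit (a * b) i j = kron (matrix_unit a (i div b) (j div b)) (matrix_unit b (i mod b) (j mod b))"
proof (rule eq_matI)
  have *: "x = y \<longleftrightarrow> x div b = y div b \<and> x mod b = y mod b" for x y :: nat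
    by (metis div_mult_mod_eq)
  fix k l assume "k < dim_row (kron (matrix_unit a (i div b) (j div b)) (matrix_unit b (i mod b) (j mod b)))"
    "l < dim_col (kron (matrix_unit a (i div b) (j div b)) (matrix_unit b (i mod b) (j mod b)))"
  then have kl: "k < a * b" "l < a * b" by (auto simp: matrix_unit_def)
  then show "matrix_unit (a * b) i j $$ (k,l) = kron (matrix_unit a (i div b) (j div b)) (matrix_unit b (i mod b) (j mod b)) $$ (k,l)"
    using div_mod_less[OF kl(1)] div_mod_less[OF kl(2)] *[of k i] *[of l j]
    by (auto simp: matrix_unit_def kron_index')
qed (auto simp: matrix_unit_def)

text \<open>Matrix units of a tensor product are products of matrix units. Identities between
  reorderings, partial traces and local maps can thus be checked on product operators, where the
  index formulas have already been evaluated.\<close>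

lemma linear_map_ext_kron2:
  assumes F: "linear_map N m F" and G: "linear_map N m G" and N: "N = a * b"
    and eq: "\<And>A B. A \<in> carrier_mat a a \<Longrightarrow> B \<in> carrier_mat b b \<Longrightarrow> F (kron A B) = G (kron A B)"
    and X: "X \<in> carrier_mat N N"
  shows "F X = G X"
  by (rule linear_map_ext[OF F G _ X]) (simp add: N matrix_unit_kron eq)

lemma linear_map_ext_kron3:
  assumes F: "linear_map N m F" and G: "linear_map N m G" and N: "N = a * b * c"
    and eq: "\<And>A B C. A \<in> carrier_mat a a \<Longrightarrow> B \<in> carrier_mat b b \<Longrightarrow> C \<in> carrier_mat c c \<Longrightarrow>
      F (kron (kron A B) C) = G (kron (kron A B) C)"
    and X: "X \<in> carrier_mat N N"
  shows "F X = G X"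
proof (rule linear_map_ext[OF F G _ X])
  fix i j assume "i < N" "j < N"
  then show "F (matrix_unit N i j) = G (matrix_unit N i j)"
    using div_mod_less[of i "a * b" c] div_mod_less[of j "a * b" c]
    unfolding N by (simp add: matrix_unit_kron[of _ "a * b" c] matrix_unit_kron[of _ a b] eq)
qed

lemma linear_map_ext_kron4:
  assumes F: "linear_map N m F" and G: "linear_map N m G" and N: "N = a * b * c * d"
    and eq: "\<And>A B C D. A \<in> carrier_mat a a \<Longrightarrow> B \<in> carrier_mat b b \<Longrightarrow> C \<in> carrier_mat c c \<Longrightarrow> D \<in> carrier_mat d d \<Longrightarrow>
      F (kron (kron (kron A B) C) D) = G (kron (kron (kron A B) C) D)"
    and X: "X \<in> carrier_mat N N"
  shows "F X = G X"
proof (rule linear_map_ext[OF F G _ X])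
  fix i j assume "i < N" "j < N"
  then show "F (matrix_unit N i j) = G (matrix_unit N i j)"
    using div_mod_less[of i "a * b * c" d] div_mod_less[of j "a * b * c" d]
      div_mod_less[of "i div d" "a * b" c] div_mod_less[of "j div d" "a * b" c]
    unfolding N by (simp add: matrix_unit_kron[of _ "a * b * c" d] matrix_unit_kron[of _ "a * b" c] matrix_unit_kron[of _ a b] eq)
qed

lemma linear_map_ext_kron5:
  assumes F: "linear_map N m F" and G: "linear_map N m G" and N: "N = a * b * c * d * e"
    and eq: "\<And>A B C D E. A \<in> carrier_mat a a \<Longrightarrow> B \<in> carrier_mat b b \<Longrightarrow> C \<in> carrier_mat c c \<Longrightarrow> D \<in> carrier_mat d d \<Longrightarrow>
      E \<in> carrier_mat e e \<Longrightarrow> F (kron (kron (kron (kron A B) C) D) E) = G (kron (kron (kron (kron A B) C) D) E)"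
    and X: "X \<in> carrier_mat N N"
  shows "F X = G X"
proof (rule linear_map_ext[OF F G _ X])
  fix i j assume "i < N" "j < N"
  then show "F (matrix_unit N i j) = G (matrix_unit N i j)"
    using div_mod_less[of i "a * b * c * d" e] div_mod_less[of j "a * b * c * d" e]
      div_mod_less[of "i div e" "a * b * c" d] div_mod_less[of "j div e" "a * b * c" d]
      div_mod_less[of "i div e div d" "a * b" c] div_mod_less[of "j div e div d" "a * b" c]
    unfolding N by (simp add: matrix_unit_kron[of _ "a * b * c * d" e] matrix_unit_kron[of _ "a * b * c" d]
        matrix_unit_kron[of _ "a * b" c] matrix_unit_kron[of _ a b] eq)
qed

section \<open>Calculus of maps acting on tensor factors\<close>

lemma linear_map_comp: "linear_map n m F \<Longrightarrow> linear_map m l G \<Longrightarrow> linear_map n l (\<lambda>X. G (F X))"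
  by (simp add: linear_map_def)

lemma block_index_less:
  assumes "i < p * m * q" "k < n"
  shows "(i div q div m * n + k) * q + i mod q < p * n * (q::nat)"
  using assms div_mod_less[of i "p * m" q] div_mod_less[of "i div q" p m] by (simp add: mixed_radix_less)

lemma linear_map_apply_on:
  assumes F: "linear_map n m F"
  shows "linear_map (p * n * q) (p * m * q) (apply_on p n m q F)"
  unfolding linear_map_def
proof (intro conjI ballI allI)
  let ?N = "p * n * q" and ?M = "p * m * q"
  let ?bl = "\<lambda>X i j. mat n n (\<lambda>(k, l). X $$ ((i div q div m * n + k) * q + i mod q,
                                          (j div q div m * n + l) * q + j mod q))"
  note F' = linear_mapD[OF F]
  have Fd: "dim_row (F (?bl X i j)) = m" "dim_col (F (?bl X i j)) = m" for X i j
    using F'(1)[of "?bl X i j"] by auto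
  have mm: "i div q mod m < m" if "i < ?M" for i
    using div_mod_less[of i "p * m" q] div_mod_less[of "i div q" p m] that by simp
  fix X Y :: "complex mat" and c :: complex
  assume X: "X \<in> carrier_mat ?N ?N"
  show "apply_on p n m q F X \<in> carrier_mat ?M ?M" by (simp add: apply_on_def)
  show "apply_on p n m q F (c \<cdot>\<^sub>m X) = c \<cdot>\<^sub>m apply_on p n m q F X"
  proof (rule eq_matI)
    fix i j assume "i < dim_row (c \<cdot>\<^sub>m apply_on p n m q F X)" "j < dim_col (c \<cdot>\<^sub>m apply_on p n m q F X)"
    then have ij: "i < ?M" "j < ?M" by (auto simp: apply_on_def)
    have "?bl (c \<cdot>\<^sub>m X) i j = c \<cdot>\<^sub>m ?bl X i j"
      using X block_index_less[OF ij(1)] block_index_less[OF ij(2)] by (intro eq_matI) auto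
    then show "apply_on p n m q F (c \<cdot>\<^sub>m X) $$ (i,j) = (c \<cdot>\<^sub>m apply_on p n m q F X) $$ (i,j)"
      using ij mm by (simp add: apply_on_def F' Fd)
  qed (auto simp: apply_on_def)
  assume Y: "Y \<in> carrier_mat ?N ?N"
  show "apply_on p n m q F (X + Y) = apply_on p n m q F X + apply_on p n m q F Y"
  proof (rule eq_matI)
    fix i j assume "i < dim_row (apply_on p n m q F X + apply_on p n m q F Y)"
      "j < dim_col (apply_on p n m q F X + apply_on p n m q F Y)"
    then have ij: "i < ?M" "j < ?M" by (auto simp: apply_on_def)
    have "?bl (X + Y) i j = ?bl X i j + ?bl Y i j"
      using X Y block_index_less[OF ij(1)] block_index_less[OF ij(2)] by (intro eq_matI) auto
    then show "apply_on p n m q F (X + Y) $$ (i,j) = (apply_on p n m q F X + apply_on p n m q F Y) $$ (i,j)"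
      using ij mm by (simp add: apply_on_def F' Fd)
  qed (auto simp: apply_on_def)
qed

lemma swap_index_less:
  assumes "i < p * r * q * s" shows "swap_index q r s i < p * q * r * s"
  using assms div_mod_less[of i "p * r * q" s] div_mod_less[of "i div s" "p * r" q] div_mod_less[of "i div s div q" p r]
  by (simp add: swap_index_def Let_def mixed_radix_less)

lemma linear_map_swap: "linear_map (p * q * r * s) (p * r * q * s) (swap_mid p q r s)"
  unfolding linear_map_def
  by (intro conjI ballI allI; (intro eq_matI)?) (auto simp: swap_mid_def swap_index_less)

lemma ptrace_index_less:
  assumes "i < a * e" "t < b" shows "(i div e * b + t) * e + i mod e < a * b * (e::nat)"
  using assms div_mod_less[of i a e] by (simp add: mixed_radix_less)

lemma linear_map_ptrace: "linear_map (a * b * e) (a * e) (ptrace_mid a b e)"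
  unfolding linear_map_def
  by (intro conjI ballI allI; (intro eq_matI)?)
    (auto simp: ptrace_mid_def ptrace_index_less sum.distrib sum_distrib_left)

lemma apply_on_kron_left:
  "X \<in> carrier_mat n n \<Longrightarrow> B \<in> carrier_mat q q \<Longrightarrow> linear_map n m F \<Longrightarrow>
    apply_on 1 n m q F (kron X B) = kron (F X) B"
  using apply_on_kron[OF one_carrier_mat, of X n B q m F 1, unfolded kron_one] by simp

lemma apply_on_kron_right:
  "A \<in> carrier_mat p p \<Longrightarrow> X \<in> carrier_mat n n \<Longrightarrow> linear_map n m F \<Longrightarrow>
    apply_on p n m 1 F (kron A X) = kron A (F X)"
  using apply_on_kron[of A p X n, OF _ _ one_carrier_mat, of m F 1, unfolded kron_one] by simp

text \<open>Merges spectators. It reduces complete positivity of an extended map to positivity with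
  a larger spectator, and it lets a map on a part of the system be read as one on the whole.\<close>

lemma apply_on_apply_on:
  assumes F: "linear_map n m F" and X: "X \<in> carrier_mat (k * p * n * q) (k * p * n * q)"
  shows "apply_on k (p * n * q) (p * m * q) 1 (apply_on p n m q F) X = apply_on (k * p) n m q F X"
proof (rule linear_map_ext_kron4[OF _ _ refl _ X])
  note Fp = linear_map_apply_on[OF F, of p q]
  show "linear_map (k * p * n * q) (k * p * m * q) (apply_on k (p * n * q) (p * m * q) 1 (apply_on p n m q F))"
    using linear_map_apply_on[OF Fp, of k 1] by (simp add: mult.assoc)
  show "linear_map (k * p * n * q) (k * p * m * q) (apply_on (k * p) n m q F)"
    by (rule linear_map_apply_on[OF F])
  fix K A Y B :: "complex mat"
  assume c: "K \<in> carrier_mat k k" "A \<in> carrier_mat p p" "Y \<in> carrier_mat n n" "B \<in> carrier_mat q q"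
  have "apply_on k (p * n * q) (p * m * q) 1 (apply_on p n m q F) (kron K (kron (kron A Y) B))
      = kron K (kron (kron A (F Y)) B)"
    by (subst apply_on_kron_right[OF c(1) _ Fp]) (use c in \<open>auto intro: kron_carrier simp: apply_on_kron[OF _ _ _ F]\<close>)
  moreover have "apply_on (k * p) n m q F (kron (kron (kron K A) Y) B) = kron (kron (kron K A) (F Y)) B"
    by (rule apply_on_kron[OF kron_carrier[OF c(1,2)] c(3,4) F])
  ultimately show "apply_on k (p * n * q) (p * m * q) 1 (apply_on p n m q F) (kron (kron (kron K A) Y) B)
      = apply_on (k * p) n m q F (kron (kron (kron K A) Y) B)"
    by (simp add: kron_assoc)
qed

lemma apply_on_comp:
  assumes F: "linear_map n m F" and G: "linear_map m l G" and X: "X \<in> carrier_mat (p * n) (p * n)"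
  shows "apply_on p m l 1 G (apply_on p n m 1 F X) = apply_on p n l 1 (\<lambda>X. G (F X)) X"
proof (rule linear_map_ext_kron2[OF _ _ refl _ X])
  note GF = linear_map_comp[OF F G]
  show "linear_map (p * n) (p * l) (\<lambda>X. apply_on p m l 1 G (apply_on p n m 1 F X))"
    using linear_map_comp[OF linear_map_apply_on[OF F, of p 1] linear_map_apply_on[OF G, of p 1]] by simp
  show "linear_map (p * n) (p * l) (apply_on p n l 1 (\<lambda>X. G (F X)))"
    using linear_map_apply_on[OF GF, of p 1] by simp
  fix A Y :: "complex mat" assume c: "A \<in> carrier_mat p p" "Y \<in> carrier_mat n n"
  show "apply_on p m l 1 G (apply_on p n m 1 F (kron A Y)) = apply_on p n l 1 (\<lambda>X. G (F X)) (kron A Y)"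
    by (simp only: apply_on_kron_right[OF c F] apply_on_kron_right[OF c(1) linear_mapD(1)[OF F c(2)] G] apply_on_kron_right[OF c GF])
qed

lemma apply_on_swap:
  assumes X: "X \<in> carrier_mat (k * p * q * r * s) (k * p * q * r * s)"
  shows "apply_on k (p * q * r * s) (p * r * q * s) 1 (swap_mid p q r s) X = swap_mid (k * p) q r s X"
proof (rule linear_map_ext_kron5[OF _ _ refl _ X])
  note L = linear_map_swap[of p q r s]
  show "linear_map (k * p * q * r * s) (k * p * r * q * s) (apply_on k (p * q * r * s) (p * r * q * s) 1 (swap_mid p q r s))"
    using linear_map_apply_on[OF L, of k 1] by (simp add: mult.assoc)
  show "linear_map (k * p * q * r * s) (k * p * r * q * s) (swap_mid (k * p) q r s)"
    by (rule linear_map_swap)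
  fix K A B C D :: "complex mat"
  assume c: "K \<in> carrier_mat k k" "A \<in> carrier_mat p p" "B \<in> carrier_mat q q" "C \<in> carrier_mat r r" "D \<in> carrier_mat s s"
  have "apply_on k (p * q * r * s) (p * r * q * s) 1 (swap_mid p q r s) (kron K (kron (kron (kron A B) C) D))
      = kron K (kron (kron (kron A C) B) D)"
    by (subst apply_on_kron_right[OF c(1) _ L]) (use c in \<open>auto intro: kron_carrier simp: swap_kron\<close>)
  moreover have "swap_mid (k * p) q r s (kron (kron (kron (kron K A) B) C) D) = kron (kron (kron (kron K A) C) B) D"
    by (rule swap_kron[OF kron_carrier[OF c(1,2)] c(3-5)])
  ultimately show "apply_on k (p * q * r * s) (p * r * q * s) 1 (swap_mid p q r s) (kron (kron (kron (kron K A) B) C) D)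
     = swap_mid (k * p) q r s (kron (kron (kron (kron K A) B) C) D)"
    by (simp add: kron_assoc)
qed

lemma apply_on_ptrace:
  assumes X: "X \<in> carrier_mat (k * a * b * e) (k * a * b * e)"
  shows "apply_on k (a * b * e) (a * e) 1 (ptrace_mid a b e) X = ptrace_mid (k * a) b e X"
proof (rule linear_map_ext_kron4[OF _ _ refl _ X])
  note L = linear_map_ptrace[of a b e]
  show "linear_map (k * a * b * e) (k * a * e) (apply_on k (a * b * e) (a * e) 1 (ptrace_mid a b e))"
    using linear_map_apply_on[OF L, of k 1] by (simp add: mult.assoc)
  show "linear_map (k * a * b * e) (k * a * e) (ptrace_mid (k * a) b e)"
    by (rule linear_map_ptrace)
  fix K A B C :: "complex mat"
  assume c: "K \<in> carrier_mat k k" "A \<in> carrier_mat a a" "B \<in> carrier_mat b b" "C \<in> carrier_mat e e"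
  have "apply_on k (a * b * e) (a * e) 1 (ptrace_mid a b e) (kron K (kron (kron A B) C))
      = mat_trace B \<cdot>\<^sub>m kron K (kron A C)"
    by (subst apply_on_kron_right[OF c(1) _ L]) (use c in \<open>auto intro: kron_carrier simp: ptrace_kron kron_smult\<close>)
  moreover have "ptrace_mid (k * a) b e (kron (kron (kron K A) B) C) = mat_trace B \<cdot>\<^sub>m kron (kron K A) C"
    by (rule ptrace_kron[OF kron_carrier[OF c(1,2)] c(3-4)])
  ultimately show "apply_on k (a * b * e) (a * e) 1 (ptrace_mid a b e) (kron (kron (kron K A) B) C)
     = ptrace_mid (k * a) b e (kron (kron (kron K A) B) C)"
    by (simp add: kron_assoc)
qed

text \<open>Complete positivity provides for a spectator on the left only; the swap moves the right
  spectator there and back.\<close>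

lemma apply_on_by_swap:
  assumes F: "linear_map n m F" and X: "X \<in> carrier_mat (p * n * q) (p * n * q)"
  shows "apply_on p n m q F X = swap_mid p q m 1 (apply_on (p * q) n m 1 F (swap_mid p n q 1 X))"
proof (rule linear_map_ext_kron3[OF _ _ refl _ X])
  show "linear_map (p * n * q) (p * m * q) (apply_on p n m q F)" by (rule linear_map_apply_on[OF F])
  show "linear_map (p * n * q) (p * m * q) (\<lambda>X. swap_mid p q m 1 (apply_on (p * q) n m 1 F (swap_mid p n q 1 X)))"
    by (rule linear_map_comp[OF linear_map_comp[OF linear_map_swap[of p n q 1, unfolded mult_1_right]
        linear_map_apply_on[OF F, of "p * q" 1, unfolded mult_1_right]] linear_map_swap[of p q m 1, unfolded mult_1_right]])
  fix A Y B :: "complex mat" assume c: "A \<in> carrier_mat p p" "Y \<in> carrier_mat n n" "B \<in> carrier_mat q q"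
  note s = swap_kron[OF _ _ _ one_carrier_mat[of 1], unfolded kron_one]
  have "swap_mid p q m 1 (apply_on (p * q) n m 1 F (swap_mid p n q 1 (kron (kron A Y) B))) = kron (kron A (F Y)) B"
    by (simp only: s[OF c] apply_on_kron_right[OF kron_carrier[OF c(1,3)] c(2) F] s[OF c(1,3) linear_mapD(1)[OF F c(2)]])
  then show "apply_on p n m q F (kron (kron A Y) B)
     = swap_mid p q m 1 (apply_on (p * q) n m 1 F (swap_mid p n q 1 (kron (kron A Y) B)))"
    using apply_on_kron[OF c F] by simp
qed

lemma apply_on_id:
  assumes F: "\<And>Y. Y \<in> carrier_mat n n \<Longrightarrow> F Y = Y" and X: "X \<in> carrier_mat (p * n) (p * n)"
  shows "apply_on p n n 1 F X = X"
proof -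
  have L: "linear_map n n F" by (simp add: linear_map_def F)
  show ?thesis
  proof (rule linear_map_ext_kron2[OF _ _ refl _ X])
    show "linear_map (p * n) (p * n) (apply_on p n n 1 F)" using linear_map_apply_on[OF L, of p 1] by simp
    show "linear_map (p * n) (p * n) (\<lambda>X. X)" by (simp add: linear_map_def)
  qed (simp add: apply_on_kron_right[OF _ _ L, unfolded One_nat_def] F)
qed

section \<open>Positivity and quantum operations built from reordering, tracing and
  extension\<close>

lemma mult_index:
  "A \<in> carrier_mat m n \<Longrightarrow> B \<in> carrier_mat n l \<Longrightarrow> i < m \<Longrightarrow> j < l \<Longrightarrow>
    (A * B) $$ (i,j) = (\<Sum>k<n. A $$ (i,k) * B $$ (k,j))"
  by (simp add: scalar_prod_def atLeast0LessThan)

text \<open>Reindexing is congruence by the 0-1 matrix whose column \<open>i\<close> has its one in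
  row \<open>f i\<close>. This covers permutations of tensor factors and the submatrices that make
  up a partial trace.\<close>

lemma psd_reindex:
  assumes X: "psd n X" and f: "\<And>i. i < m \<Longrightarrow> f i < n"
  shows "psd m (mat m m (\<lambda>(i,j). X $$ (f i, f j)))"
proof -
  define L :: "complex mat" where "L = mat n m (\<lambda>(k,i). if k = f i then 1 else 0)"
  have L: "L \<in> carrier_mat n m" and Xc: "X \<in> carrier_mat n n" using X by (auto simp: L_def psd_def)
  have "mat_adjoint L * X * L = mat m m (\<lambda>(i,j). X $$ (f i, f j))"
  proof (rule eq_matI)
    fix i j assume "i < dim_row (mat m m (\<lambda>(i,j). X $$ (f i, f j)))" "j < dim_col (mat m m (\<lambda>(i,j). X $$ (f i, f j)))"
    then have ij: "i < m" "j < m" by auto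
    have "(mat_adjoint L * X) $$ (i,k) = X $$ (f i, k)" if "k < n" for k
      using ij f that L Xc by (simp add: scalar_prod_def L_def if_distrib[of cnj] if_distrib[of "\<lambda>x. x * _"] cong: if_cong)
    moreover have "mat_adjoint L * X \<in> carrier_mat m n" using L Xc carrier_adjoint[OF L] by auto
    then have "(mat_adjoint L * X * L) $$ (i,j) = (\<Sum>k<n. (mat_adjoint L * X) $$ (i,k) * L $$ (k,j))"
      using ij L by (intro mult_index) auto
    ultimately show "(mat_adjoint L * X * L) $$ (i,j) = mat m m (\<lambda>(i,j). X $$ (f i, f j)) $$ (i,j)"
      using ij f by (simp add: L_def if_distrib[of "\<lambda>x. _ * x"] del: index_mult_mat(1) cong: if_cong)
  qed (use L in auto)
  then show ?thesis using psd_congruence[OF X L] by simp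
qed

lemma psd_mat_sum:
  assumes "\<And>t. t < N \<Longrightarrow> psd n (f t)"
  shows "psd n (mat_sum n N f)"
  unfolding psd_def
proof (intro conjI ballI)
  show c: "mat_sum n N f \<in> carrier_mat n n" by (simp add: mat_sum_def)
  fix v :: "complex vec" assume v: "v \<in> carrier_vec n"
  have "(mat_sum n N f *\<^sub>v v) \<bullet>c v = (\<Sum>i<n. \<Sum>j<n. \<Sum>t<N. f t $$ (i,j) * v $ j * cnj (v $ i))"
    unfolding quad_form[OF c v] by (simp add: mat_sum_def sum_distrib_right)
  also have "\<dots> = (\<Sum>i<n. \<Sum>t<N. \<Sum>j<n. f t $$ (i,j) * v $ j * cnj (v $ i))"
    by (intro sum.cong refl sum.swap)
  also have "\<dots> = (\<Sum>t<N. \<Sum>i<n. \<Sum>j<n. f t $$ (i,j) * v $ j * cnj (v $ i))" by (rule sum.swap)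
  also have "\<dots> = (\<Sum>t<N. (f t *\<^sub>v v) \<bullet>c v)"
    using assms v by (intro sum.cong refl quad_form[symmetric]) (auto simp: psd_def)
  also have "0 \<le> \<dots>" using assms v by (intro sum_nonneg) (simp add: psd_def)
  finally show "0 \<le> (mat_sum n N f *\<^sub>v v) \<bullet>c v" .
qed

lemma psd_swap: "psd (p * q * r * s) X \<Longrightarrow> psd (p * r * q * s) (swap_mid p q r s X)"
  unfolding swap_mid_def by (rule psd_reindex[OF _ swap_index_less])

lemma psd_ptrace:
  assumes "psd (a * b * e) X" shows "psd (a * e) (ptrace_mid a b e X)"
proof -
  have "ptrace_mid a b e X = mat_sum (a * e) b (\<lambda>t. mat (a * e) (a * e)
      (\<lambda>(i, j). X $$ ((i div e * b + t) * e + i mod e, (j div e * b + t) * e + j mod e)))"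
    by (rule eq_matI) (auto simp: ptrace_mid_def mat_sum_def)
  then show ?thesis
    using psd_reindex[OF assms ptrace_index_less, of "a * e"] by (auto intro!: psd_mat_sum)
qed

lemma psd_apply_on:
  assumes F: "cptp n m F" and X: "psd (p * n * q) X"
  shows "psd (p * m * q) (apply_on p n m q F X)"
proof -
  have L: "linear_map n m F" and cp: "completely_positive n m F" using F by (auto simp: cptp_def)
  have "psd (p * q * n) (swap_mid p n q 1 X)" using psd_swap[of p n q 1 X] X by simp
  then have "psd (p * q * m) (apply_on (p * q) n m 1 F (swap_mid p n q 1 X))"
    using cp by (simp add: completely_positive_def)
  then show ?thesis
    using psd_swap[of p q m 1] X by (subst apply_on_by_swap[OF L]) (auto simp: psd_def)
qed

text \<open>The trace in the guise of a map to 1 by 1 matrices, so that trace identities too can be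
  checked on product operators.\<close>

lemma linear_map_trace: "linear_map n 1 (\<lambda>X. mat 1 1 (\<lambda>_. mat_trace X))"
  unfolding linear_map_def
  by (intro conjI ballI allI; (intro eq_matI)?) (auto simp: trace_add trace_smult)

lemma mat_1_1_eq: "mat 1 1 (\<lambda>_. x) = mat 1 1 (\<lambda>_. y) \<longleftrightarrow> x = y"
proof
  assume "mat 1 1 (\<lambda>_. x) = mat 1 1 (\<lambda>_. y)"
  then have "mat 1 1 (\<lambda>_. x) $$ (0,0) = mat 1 1 (\<lambda>_. y) $$ (0,0)" by (rule arg_cong)
  then show "x = y" by simp
qed simp

lemma cptpI:
  assumes "linear_map n m F" "\<And>k X. psd (k * n) X \<Longrightarrow> psd (k * m) (apply_on k n m 1 F X)"
    "\<And>X. X \<in> carrier_mat n n \<Longrightarrow> mat_trace (F X) = mat_trace X"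
  shows "cptp n m F"
  using assms by (simp add: cptp_def completely_positive_def trace_preserving_def)

lemma cptp_comp:
  assumes F: "cptp n m F" and G: "cptp m l G"
  shows "cptp n l (\<lambda>X. G (F X))"
proof (rule cptpI)
  have L: "linear_map n m F" "linear_map m l G" using F G by (auto simp: cptp_def)
  show "linear_map n l (\<lambda>X. G (F X))" by (rule linear_map_comp[OF L])
  show "mat_trace (G (F X)) = mat_trace X" if "X \<in> carrier_mat n n" for X
    using F G that linear_mapD(1)[OF L(1) that] by (simp add: cptp_def trace_preserving_def)
  fix k X assume X: "psd (k * n) X"
  have "psd (k * l) (apply_on k m l 1 G (apply_on k n m 1 F X))"
    using F G X by (simp add: cptp_def completely_positive_def)
  then show "psd (k * l) (apply_on k n l 1 (\<lambda>X. G (F X)) X)"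
    using apply_on_comp[OF L, of X k] X by (simp add: psd_def)
qed

lemma cptp_apply_on:
  assumes F: "cptp n m F"
  shows "cptp (p * n * q) (p * m * q) (apply_on p n m q F)"
proof (rule cptpI)
  have L: "linear_map n m F" using F by (simp add: cptp_def)
  show "linear_map (p * n * q) (p * m * q) (apply_on p n m q F)" by (rule linear_map_apply_on[OF L])
  fix k X assume X: "psd (k * (p * n * q)) X"
  then have "psd (k * p * n * q) X" by (simp add: mult.assoc)
  then have "psd (k * p * m * q) (apply_on (k * p) n m q F X)" by (rule psd_apply_on[OF F])
  then show "psd (k * (p * m * q)) (apply_on k (p * n * q) (p * m * q) 1 (apply_on p n m q F) X)"
    using apply_on_apply_on[OF L, of X k p q] X by (simp add: psd_def mult.assoc)
next
  have L: "linear_map n m F" and tp: "trace_preserving n F" using F by (auto simp: cptp_def)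
  note Lp = linear_map_apply_on[OF L, of p q]
  fix X :: "complex mat" assume X: "X \<in> carrier_mat (p * n * q) (p * n * q)"
  have "mat 1 1 (\<lambda>_. mat_trace (apply_on p n m q F X)) = mat 1 1 (\<lambda>_. mat_trace X)"
  proof (rule linear_map_ext_kron3[OF linear_map_comp[OF Lp linear_map_trace] linear_map_trace refl _ X])
    fix A Y B :: "complex mat" assume c: "A \<in> carrier_mat p p" "Y \<in> carrier_mat n n" "B \<in> carrier_mat q q"
    have "mat_trace (F Y) = mat_trace Y" using tp c by (simp add: trace_preserving_def)
    then show "mat 1 1 (\<lambda>_. mat_trace (apply_on p n m q F (kron (kron A Y) B))) = mat 1 1 (\<lambda>_. mat_trace (kron (kron A Y) B))"
      using c linear_mapD(1)[OF L c(2)] kron_carrier[OF c(1,2)] kron_carrier[OF c(1) linear_mapD(1)[OF L c(2)]]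
      by (simp add: apply_on_kron[OF c L] trace_kron)
  qed
  then show "mat_trace (apply_on p n m q F X) = mat_trace X" by (simp only: mat_1_1_eq)
qed

lemma cptp_swap: "cptp (p * q * r * s) (p * r * q * s) (swap_mid p q r s)"
proof (rule cptpI)
  show "linear_map (p * q * r * s) (p * r * q * s) (swap_mid p q r s)" by (rule linear_map_swap)
  fix k X assume X: "psd (k * (p * q * r * s)) X"
  then have "psd (k * p * q * r * s) X" by (simp add: mult.assoc)
  then have "psd (k * p * r * q * s) (swap_mid (k * p) q r s X)" by (rule psd_swap)
  then show "psd (k * (p * r * q * s)) (apply_on k (p * q * r * s) (p * r * q * s) 1 (swap_mid p q r s) X)"
    using apply_on_swap[of X k p q r s] X by (simp add: psd_def mult.assoc)
next
  fix X :: "complex mat" assume X: "X \<in> carrier_mat (p * q * r * s) (p * q * r * s)"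
  have "mat 1 1 (\<lambda>_. mat_trace (swap_mid p q r s X)) = mat 1 1 (\<lambda>_. mat_trace X)"
  proof (rule linear_map_ext_kron4[OF linear_map_comp[OF linear_map_swap linear_map_trace] linear_map_trace refl _ X])
    fix A B C D :: "complex mat"
    assume c: "A \<in> carrier_mat p p" "B \<in> carrier_mat q q" "C \<in> carrier_mat r r" "D \<in> carrier_mat s s"
    note k = kron_carrier[OF c(1,2)] kron_carrier[OF c(1,3)]
    show "mat 1 1 (\<lambda>_. mat_trace (swap_mid p q r s (kron (kron (kron A B) C) D))) = mat 1 1 (\<lambda>_. mat_trace (kron (kron (kron A B) C) D))"
      using c k kron_carrier[OF k(1) c(3)] kron_carrier[OF k(2) c(2)]
      by (simp add: swap_kron[OF c] trace_kron mult.commute mult.left_commute)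
  qed
  then show "mat_trace (swap_mid p q r s X) = mat_trace X" by (simp only: mat_1_1_eq)
qed

lemma cptp_ptrace: "cptp (a * b * e) (a * e) (ptrace_mid a b e)"
proof (rule cptpI)
  show "linear_map (a * b * e) (a * e) (ptrace_mid a b e)" by (rule linear_map_ptrace)
  fix k X assume X: "psd (k * (a * b * e)) X"
  then have "psd (k * a * b * e) X" by (simp add: mult.assoc)
  then have "psd (k * a * e) (ptrace_mid (k * a) b e X)" by (rule psd_ptrace)
  then show "psd (k * (a * e)) (apply_on k (a * b * e) (a * e) 1 (ptrace_mid a b e) X)"
    using apply_on_ptrace[of X k a b e] X by (simp add: psd_def mult.assoc)
next
  fix X :: "complex mat" assume X: "X \<in> carrier_mat (a * b * e) (a * b * e)"
  have "mat 1 1 (\<lambda>_. mat_trace (ptrace_mid a b e X)) = mat 1 1 (\<lambda>_. mat_trace X)"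
  proof (rule linear_map_ext_kron3[OF linear_map_comp[OF linear_map_ptrace linear_map_trace] linear_map_trace refl _ X])
    fix A B C :: "complex mat"
    assume c: "A \<in> carrier_mat a a" "B \<in> carrier_mat b b" "C \<in> carrier_mat e e"
    show "mat 1 1 (\<lambda>_. mat_trace (ptrace_mid a b e (kron (kron A B) C))) = mat 1 1 (\<lambda>_. mat_trace (kron (kron A B) C))"
      using c kron_carrier[OF c(1,2)] kron_carrier[OF c(1,3)]
      by (simp add: ptrace_kron[OF c] trace_kron trace_smult[of _ "a * e"] mult.commute mult.left_commute)
  qed
  then show "mat_trace (ptrace_mid a b e X) = mat_trace X" by (simp only: mat_1_1_eq)
qed

lemma linear_map_conjugation:
  assumes W: "W \<in> carrier_mat m n"
  shows "linear_map n m (\<lambda>X. W * X * mat_adjoint W)"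
proof -
  note Wa = carrier_adjoint[OF W]
  show ?thesis
    unfolding linear_map_def
    using W Wa by (auto simp: mult_add_distrib_mat[OF W] add_mult_distrib_mat[of _ m n _ _ m]
        mult_smult_distrib[OF W] mult_smult_assoc_mat[of _ m n _ m])
qed

text \<open>Extending the conjugation by a spectator gives conjugation with
  \<open>kron (1\<^sub>m k) W\<close>, which is a congruence; \<open>iso\<close> gives the
  trace.\<close>

lemma cptp_isometry:
  assumes W: "W \<in> carrier_mat m n" and iso: "mat_adjoint W * W = 1\<^sub>m n"
  shows "cptp n m (\<lambda>X. W * X * mat_adjoint W)"
proof (rule cptpI)
  note Wa = carrier_adjoint[OF W]
  note L = linear_map_conjugation[OF W]
  show "linear_map n m (\<lambda>X. W * X * mat_adjoint W)" by (rule L)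
  show "mat_trace (W * X * mat_adjoint W) = mat_trace X" if X: "X \<in> carrier_mat n n" for X
  proof -
    have "mat_trace (W * X * mat_adjoint W) = mat_trace (mat_adjoint W * (W * X))"
      using W Wa X by (intro trace_comm[of _ m n]) auto
    also have "mat_adjoint W * (W * X) = X"
      using W Wa X iso by (simp add: assoc_mult_mat[of _ n m _ n _ n, symmetric])
    finally show ?thesis .
  qed
  fix k X assume X: "psd (k * n) X"
  define Z where "Z = kron (1\<^sub>m k) W"
  have Z: "Z \<in> carrier_mat (k * m) (k * n)" using W by (auto simp: Z_def)
  have "apply_on k n m 1 (\<lambda>X. W * X * mat_adjoint W) X = Z * X * mat_adjoint Z"
  proof (rule linear_map_ext_kron2[OF _ linear_map_conjugation[OF Z] refl])
    show "linear_map (k * n) (k * m) (apply_on k n m 1 (\<lambda>X. W * X * mat_adjoint W))"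
      using linear_map_apply_on[OF L, of k 1] by simp
    show "X \<in> carrier_mat (k * n) (k * n)" using X by (simp add: psd_def)
    fix A Y :: "complex mat" assume c: "A \<in> carrier_mat k k" "Y \<in> carrier_mat n n"
    have "Z * kron A Y = kron A (W * Y)"
      unfolding Z_def using c by (simp add: kron_mult[OF one_carrier_mat W c])
    moreover have "kron A (W * Y) * mat_adjoint Z = kron A (W * Y * mat_adjoint W)"
      unfolding Z_def adjoint_kron
      using c W Wa by (simp add: kron_mult[of A k k "W * Y" m n "1\<^sub>m k" k "mat_adjoint W" m])
    ultimately show "apply_on k n m 1 (\<lambda>X. W * X * mat_adjoint W) (kron A Y) = Z * kron A Y * mat_adjoint Z"
      using apply_on_kron_right[OF c L] by simp
  qed
  then show "psd (k * m) (apply_on k n m 1 (\<lambda>X. W * X * mat_adjoint W) X)"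
    using psd_congruence[OF X carrier_adjoint[OF Z]] by simp
qed

section \<open>Monotonicity for each class of operations\<close>

lemma cptp_density_ops: "cptp n m F \<Longrightarrow> \<rho> \<in> density_ops n \<Longrightarrow> F \<rho> \<in> density_ops m"
  using cptp_psd[of n m F \<rho>] by (simp add: density_ops_def cptp_def trace_preserving_def psd_def[of n \<rho>])

text \<open>Each candidate \<open>R\<close> of the infimum for \<open>\<rho>\<close> is matched by a
  candidate for \<open>G \<rho>\<close> that is no worse. The intertwining is demanded at the given
  \<open>\<rho>\<close> alone, which leaves room for broadcasting.\<close>

lemma D_rec_B_cptp_mono:
  assumes \<rho>: "\<rho> \<in> density_ops (a * b * e)" and G: "cptp (a * b * e) (a' * b' * e') G"
    and intertwine: "\<And>R. cptp e (b * e) R \<Longrightarrow> \<exists>R'. cptp e' (b' * e') R' \<and>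
      G (apply_on a e (b * e) 1 R (ptrace_mid a b e \<rho>)) = apply_on a' e' (b' * e') 1 R' (ptrace_mid a' b' e' (G \<rho>))"
  shows "D_rec_B a' b' e' (G \<rho>) \<le> D_rec_B a b e \<rho>"
  unfolding D_rec_B_def
proof (rule INF_greatest)
  fix R assume "R \<in> {R. cptp e (b * e) R}"
  then have R: "cptp e (b * e) R" by simp
  let ?\<sigma> = "apply_on a e (b * e) 1 R (ptrace_mid a b e \<rho>)"
  have p: "psd (a * b * e) \<rho>" using \<rho> by (simp add: density_ops_def)
  have "psd (a * b * e) ?\<sigma>"
    using psd_apply_on[OF R, of a 1 "ptrace_mid a b e \<rho>"] psd_ptrace[OF p] by (simp add: mult.assoc)
  then have dpi: "rel_entropy (a' * b' * e') (G \<rho>) (G ?\<sigma>) \<le> rel_entropy (a * b * e) \<rho> ?\<sigma>"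
    by (rule data_processing[OF G p])
  obtain R' where R': "cptp e' (b' * e') R'"
    and eq: "G ?\<sigma> = apply_on a' e' (b' * e') 1 R' (ptrace_mid a' b' e' (G \<rho>))"
    using intertwine[OF R] by blast
  show "(INF R\<in>{R. cptp e' (b' * e') R}. rel_entropy (a' * b' * e') (G \<rho>)
      (apply_on a' e' (b' * e') 1 R (ptrace_mid a' b' e' (G \<rho>)))) \<le> rel_entropy (a * b * e) \<rho> ?\<sigma>"
    by (rule INF_lower2[of R']) (use R' dpi eq in auto)
qed

lemma cptp_linear: "cptp n m F \<Longrightarrow> linear_map n m F"
  by (simp add: cptp_def)

lemma density_ops_carrier: "\<rho> \<in> density_ops n \<Longrightarrow> \<rho> \<in> carrier_mat n n"
  by (simp add: density_ops_def psd_def)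

section \<open>Local operations of Alice and Bob\<close>

lemma ptrace_apply_on_left:
  assumes F: "linear_map a a' F" and X: "X \<in> carrier_mat (a * b * e) (a * b * e)"
  shows "ptrace_mid a' b e (apply_on 1 a a' (b * e) F X) = apply_on 1 a a' e F (ptrace_mid a b e X)"
proof (rule linear_map_ext_kron3[OF _ _ refl _ X])
  show "linear_map (a * b * e) (a' * e) (\<lambda>X. ptrace_mid a' b e (apply_on 1 a a' (b * e) F X))"
    using linear_map_comp[OF linear_map_apply_on[OF F, of 1 "b * e"]] linear_map_ptrace[of a' b e]
    by (simp add: mult.assoc)
  show "linear_map (a * b * e) (a' * e) (\<lambda>X. apply_on 1 a a' e F (ptrace_mid a b e X))"
    using linear_map_comp[OF linear_map_ptrace, of a e "a' * e"] linear_map_apply_on[OF F, of 1 e] by simp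
  fix A B C :: "complex mat"
  assume c: "A \<in> carrier_mat a a" "B \<in> carrier_mat b b" "C \<in> carrier_mat e e"
  note FA = linear_mapD(1)[OF F c(1)]
  have "ptrace_mid a' b e (apply_on 1 a a' (b * e) F (kron A (kron B C))) = mat_trace B \<cdot>\<^sub>m kron (F A) C"
    by (simp only: apply_on_kron_left[OF c(1) kron_carrier[OF c(2,3)] F] ptrace_kron[OF FA c(2,3), unfolded kron_assoc])
  moreover have "apply_on 1 a a' e F (mat_trace B \<cdot>\<^sub>m kron A C) = mat_trace B \<cdot>\<^sub>m kron (F A) C"
    using linear_mapD(3)[OF linear_map_apply_on[OF F, of 1 e], of "kron A C" "mat_trace B"] kron_carrier[OF c(1,3)]
    by (simp add: apply_on_kron_left[OF c(1,3) F, unfolded One_nat_def])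
  ultimately show "ptrace_mid a' b e (apply_on 1 a a' (b * e) F (kron (kron A B) C))
      = apply_on 1 a a' e F (ptrace_mid a b e (kron (kron A B) C))"
    by (simp only: kron_assoc ptrace_kron[OF c, unfolded kron_assoc])
qed

lemma apply_on_left_right_commute:
  assumes F: "linear_map a a' F" and R: "linear_map e f R" and X: "X \<in> carrier_mat (a * e) (a * e)"
  shows "apply_on 1 a a' f F (apply_on a e f 1 R X) = apply_on a' e f 1 R (apply_on 1 a a' e F X)"
proof (rule linear_map_ext_kron2[OF _ _ refl _ X])
  show "linear_map (a * e) (a' * f) (\<lambda>X. apply_on 1 a a' f F (apply_on a e f 1 R X))"
    using linear_map_comp[OF linear_map_apply_on[OF R, of a 1], of "a' * f"] linear_map_apply_on[OF F, of 1 f] by simp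
  show "linear_map (a * e) (a' * f) (\<lambda>X. apply_on a' e f 1 R (apply_on 1 a a' e F X))"
    using linear_map_comp[OF linear_map_apply_on[OF F, of 1 e], of "a' * f"] linear_map_apply_on[OF R, of a' 1] by simp
  fix A C :: "complex mat" assume c: "A \<in> carrier_mat a a" "C \<in> carrier_mat e e"
  show "apply_on 1 a a' f F (apply_on a e f 1 R (kron A C)) = apply_on a' e f 1 R (apply_on 1 a a' e F (kron A C))"
    by (simp only: apply_on_kron_left[OF c F] apply_on_kron_right[OF c R] apply_on_kron_right[OF linear_mapD(1)[OF F c(1)] c(2) R]
        apply_on_kron_left[OF c(1) linear_mapD(1)[OF R c(2)] F])
qed

text \<open>Alice's operation commutes with tracing out Bob and with any recovery by Eve, so the
  same \<open>R\<close> serves before and after.\<close>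

lemma D_rec_B_local_A:
  assumes F: "cptp a a' F" and \<rho>: "\<rho> \<in> density_ops (a * b * e)"
  shows "cptp (a * b * e) (a' * b * e) (apply_on 1 a a' (b * e) F)"
    and "D_rec_B a' b e (apply_on 1 a a' (b * e) F \<rho>) \<le> D_rec_B a b e \<rho>"
proof -
  show G: "cptp (a * b * e) (a' * b * e) (apply_on 1 a a' (b * e) F)"
    using cptp_apply_on[OF F, of 1 "b * e"] by (simp add: mult.assoc)
  note L = cptp_linear[OF F] and r = density_ops_carrier[OF \<rho>]
  show "D_rec_B a' b e (apply_on 1 a a' (b * e) F \<rho>) \<le> D_rec_B a b e \<rho>"
  proof (rule D_rec_B_cptp_mono[OF \<rho> G], intro exI conjI)
    fix R assume R: "cptp e (b * e) R"
    then show "cptp e (b * e) R" .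
    show "apply_on 1 a a' (b * e) F (apply_on a e (b * e) 1 R (ptrace_mid a b e \<rho>)) =
         apply_on a' e (b * e) 1 R (ptrace_mid a' b e (apply_on 1 a a' (b * e) F \<rho>))"
      unfolding ptrace_apply_on_left[OF L r]
      by (rule apply_on_left_right_commute[OF L cptp_linear[OF R] linear_mapD(1)[OF linear_map_ptrace r]])
  qed
qed

lemma ptrace_apply_on_mid:
  assumes F: "cptp b b' F" and X: "X \<in> carrier_mat (a * b * e) (a * b * e)"
  shows "ptrace_mid a b' e (apply_on a b b' e F X) = ptrace_mid a b e X"
proof (rule linear_map_ext_kron3[OF _ linear_map_ptrace refl _ X])
  note L = cptp_linear[OF F]
  show "linear_map (a * b * e) (a * e) (\<lambda>X. ptrace_mid a b' e (apply_on a b b' e F X))"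
    by (rule linear_map_comp[OF linear_map_apply_on[OF L] linear_map_ptrace])
  fix A B C :: "complex mat"
  assume c: "A \<in> carrier_mat a a" "B \<in> carrier_mat b b" "C \<in> carrier_mat e e"
  have "mat_trace (F B) = mat_trace B" using F c by (simp add: cptp_def trace_preserving_def)
  then show "ptrace_mid a b' e (apply_on a b b' e F (kron (kron A B) C)) = ptrace_mid a b e (kron (kron A B) C)"
    by (simp only: apply_on_kron[OF c L] ptrace_kron[OF c] ptrace_kron[OF c(1) linear_mapD(1)[OF L c(2)] c(3)])
qed

text \<open>Bob's operation is invisible once Bob is traced out; the new recovery map rebuilds the
  old system of Bob and then applies \<open>F\<close> to it.\<close>

lemma D_rec_B_local_B:
  assumes F: "cptp b b' F" and \<rho>: "\<rho> \<in> density_ops (a * b * e)"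
  shows "cptp (a * b * e) (a * b' * e) (apply_on a b b' e F)"
    and "D_rec_B a b' e (apply_on a b b' e F \<rho>) \<le> D_rec_B a b e \<rho>"
proof -
  show G: "cptp (a * b * e) (a * b' * e) (apply_on a b b' e F)" by (rule cptp_apply_on[OF F])
  note L = cptp_linear[OF F] and r = density_ops_carrier[OF \<rho>]
  have FB: "cptp (b * e) (b' * e) (apply_on 1 b b' e F)"
    using cptp_apply_on[OF F, of 1 e] by simp
  show "D_rec_B a b' e (apply_on a b b' e F \<rho>) \<le> D_rec_B a b e \<rho>"
  proof (rule D_rec_B_cptp_mono[OF \<rho> G], intro exI conjI)
    fix R assume R: "cptp e (b * e) R"
    show "cptp e (b' * e) (\<lambda>X. apply_on 1 b b' e F (R X))" by (rule cptp_comp[OF R FB])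
    let ?Y = "ptrace_mid a b e \<rho>"
    have Y: "?Y \<in> carrier_mat (a * e) (a * e)" by (rule linear_mapD(1)[OF linear_map_ptrace r])
    have RY: "apply_on a e (b * e) 1 R ?Y \<in> carrier_mat (a * 1 * b * e) (a * 1 * b * e)"
      using linear_mapD(1)[OF linear_map_apply_on[OF cptp_linear[OF R], of a 1], of ?Y] Y by (simp add: mult.assoc)
    have "apply_on a b b' e F (apply_on a e (b * e) 1 R ?Y)
        = apply_on a (b * e) (b' * e) 1 (apply_on 1 b b' e F) (apply_on a e (b * e) 1 R ?Y)"
      using apply_on_apply_on[OF L RY] by simp
    also have "\<dots> = apply_on a e (b' * e) 1 (\<lambda>X. apply_on 1 b b' e F (R X)) ?Y"
      by (rule apply_on_comp[OF cptp_linear[OF R] cptp_linear[OF FB] Y])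
    finally show "apply_on a b b' e F (apply_on a e (b * e) 1 R ?Y)
        = apply_on a e (b' * e) 1 (\<lambda>X. apply_on 1 b b' e F (R X)) (ptrace_mid a b' e (apply_on a b b' e F \<rho>))"
      by (simp only: ptrace_apply_on_mid[OF F r])
  qed
qed

section \<open>Reversible operations of Eve\<close>

lemma ptrace_apply_on_right:
  assumes V: "linear_map e e' V" and X: "X \<in> carrier_mat (a * b * e) (a * b * e)"
  shows "ptrace_mid a b e' (apply_on (a * b) e e' 1 V X) = apply_on a e e' 1 V (ptrace_mid a b e X)"
proof (rule linear_map_ext_kron3[OF _ _ refl _ X])
  show "linear_map (a * b * e) (a * e') (\<lambda>X. ptrace_mid a b e' (apply_on (a * b) e e' 1 V X))"
    by (rule linear_map_comp[OF linear_map_apply_on[OF V, of "a * b" 1, unfolded mult_1_right] linear_map_ptrace])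
  show "linear_map (a * b * e) (a * e') (\<lambda>X. apply_on a e e' 1 V (ptrace_mid a b e X))"
    by (rule linear_map_comp[OF linear_map_ptrace linear_map_apply_on[OF V, of a 1, unfolded mult_1_right]])
  fix A B C :: "complex mat"
  assume c: "A \<in> carrier_mat a a" "B \<in> carrier_mat b b" "C \<in> carrier_mat e e"
  show "ptrace_mid a b e' (apply_on (a * b) e e' 1 V (kron (kron A B) C))
      = apply_on a e e' 1 V (ptrace_mid a b e (kron (kron A B) C))"
    by (simp only: apply_on_kron_right[OF kron_carrier[OF c(1,2)] c(3) V] ptrace_kron[OF c]
        ptrace_kron[OF c(1,2) linear_mapD(1)[OF V c(3)]] apply_on_kron_right[OF c(1,3) V]
        linear_mapD(3)[OF linear_map_apply_on[OF V, of a 1, unfolded mult_1_right] kron_carrier[OF c(1,3)]])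
qed

lemma psd_rank_one:
  assumes "v \<in> carrier_vec n" shows "psd n (proj v)"
  unfolding psd_def
proof (intro conjI ballI)
  show c: "proj v \<in> carrier_mat n n" using assms by (simp add: proj_def)
  fix w :: "complex vec" assume w: "w \<in> carrier_vec n"
  define z where "z = (\<Sum>j<n. cnj (v $ j) * w $ j)"
  have "(proj v *\<^sub>v w) \<bullet>c w = (\<Sum>i<n. \<Sum>j<n. (v $ i * cnj (w $ i)) * (cnj (v $ j) * w $ j))"
    unfolding quad_form[OF c w] using assms by (simp add: proj_def mult_ac)
  also have "\<dots> = cnj z * z" by (simp add: z_def sum_product mult_ac)
  also have "\<dots> = of_real ((cmod z)\<^sup>2)" by (simp only: mult.commute[of "cnj z"] cmod_square)
  finally show "0 \<le> (proj v *\<^sub>v w) \<bullet>c w" by (simp add: less_eq_complex_def del: of_real_power)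
qed

text \<open>Density operators span all matrices, by polarization of rank one projections.\<close>

lemma linear_map_eq_if_eq_on_density_ops:
  assumes F: "linear_map n m F" and G: "linear_map n m G"
    and eq: "\<And>\<rho>. \<rho> \<in> density_ops n \<Longrightarrow> F \<rho> = G \<rho>"
    and X: "X \<in> carrier_mat n n"
  shows "F X = G X"
proof -
  have eq_proj: "F (proj v) = G (proj v)" if v: "v \<in> carrier_vec n" "v \<noteq> 0\<^sub>v n" for v
  proof -
    \<comment> \<open>\<open>s\<close> is the squared norm of \<open>v\<close>; dividing by it turns
      \<open>proj v\<close> into a density operator.\<close>
    define s where "s = mat_trace (proj v)"
    have "s = v \<bullet>c v" using v by (simp add: s_def mat_trace_def proj_def scalar_prod_def atLeast0LessThan)
    then have s: "s > 0" using v conjugate_square_greater_0_vec[OF v(1)] by simp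
    have pc: "proj v \<in> carrier_mat n n" using psd_rank_one[OF v(1)] by (simp add: psd_def)
    have sr: "1 / s \<ge> 0" using s by (simp add: less_complex_def less_eq_complex_def Re_divide Im_divide)
    have "psd n ((1 / s) \<cdot>\<^sub>m proj v)"
    proof -
      have "((1 / s) \<cdot>\<^sub>m proj v *\<^sub>v w) \<bullet>c w = (1 / s) * ((proj v *\<^sub>v w) \<bullet>c w)" if "w \<in> carrier_vec n" for w
        using quad_form[of "(1 / s) \<cdot>\<^sub>m proj v" n w] quad_form[OF pc that] pc that
        by (simp add: sum_divide_distrib)
      moreover have "0 \<le> (1 / s) * ((proj v *\<^sub>v w) \<bullet>c w)" if "w \<in> carrier_vec n" for w
        using sr psd_rank_one[OF v(1)] that by (intro mult_nonneg_nonneg) (auto simp: psd_def)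
      ultimately show ?thesis using pc by (auto simp: psd_def)
    qed
    then have "(1 / s) \<cdot>\<^sub>m proj v \<in> density_ops n"
      using s by (simp add: density_ops_def trace_smult[OF pc] flip: s_def)
    then have "F ((1 / s) \<cdot>\<^sub>m proj v) = G ((1 / s) \<cdot>\<^sub>m proj v)" by (rule eq)
    then have "(1 / s) \<cdot>\<^sub>m F (proj v) = (1 / s) \<cdot>\<^sub>m G (proj v)"
      by (simp add: linear_mapD(3)[OF F pc] linear_mapD(3)[OF G pc])
    then have "s \<cdot>\<^sub>m ((1 / s) \<cdot>\<^sub>m F (proj v)) = s \<cdot>\<^sub>m ((1 / s) \<cdot>\<^sub>m G (proj v))" by simp
    moreover have "s \<cdot>\<^sub>m ((1 / s) \<cdot>\<^sub>m M) = M" for M :: "complex mat"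
      using s by (intro eq_matI) auto
    ultimately show ?thesis by simp
  qed
  show ?thesis
  proof (rule linear_map_ext[OF F G _ X])
    fix i j assume ij: "i < n" "j < n"
    note Ec = matrix_unit_carrier[of n]
    let ?P = "matrix_unit n i j" and ?Q = "matrix_unit n j i"
    show "F ?P = G ?P"
    proof (cases "i = j")
      case True
      then have "?P = proj (unit_vec n i)" by (intro eq_matI) (auto simp: matrix_unit_def proj_def unit_vec_def)
      moreover have "unit_vec n i \<noteq> (0\<^sub>v n :: complex vec)" using ij by auto
      ultimately show ?thesis using eq_proj[of "unit_vec n i"] by simp
    next
      case False
      \<comment> \<open>For unimodular \<open>c\<close> the off-diagonal part of
        \<open>proj (u c)\<close> is \<open>cnj c \<cdot>\<^sub>m ?P + c \<cdot>\<^sub>m ?Q\<close>.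
        The values 1 and \<i> give two independent equations, which determine the value on
        \<open>?P\<close>.\<close>
      define u where "u c = unit_vec n i + c \<cdot>\<^sub>v unit_vec n j" for c :: complex
      let ?I = "matrix_unit n i i" and ?J = "matrix_unit n j j"
      have u: "proj (u c) = ?I + ?J + (cnj c \<cdot>\<^sub>m ?P + c \<cdot>\<^sub>m ?Q)" if "cnj c * c = 1" for c
        using ij False that by (intro eq_matI) (auto simp: matrix_unit_def proj_def u_def unit_vec_def mult.commute)
      have un: "u c \<in> carrier_vec n" "u c \<noteq> 0\<^sub>v n" for c
      proof -
        show "u c \<in> carrier_vec n" by (simp add: u_def)
        have "u c $ i = 1" using ij False by (simp add: u_def)
        then show "u c \<noteq> 0\<^sub>v n" using ij by auto
      qed
      have I: "?I = proj (unit_vec n i)" "?J = proj (unit_vec n j)"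
        by (intro eq_matI; auto simp: matrix_unit_def proj_def unit_vec_def)+
      have "unit_vec n i \<noteq> (0\<^sub>v n :: complex vec)" "unit_vec n j \<noteq> (0\<^sub>v n :: complex vec)" using ij by auto
      then have eqI: "F ?I = G ?I" "F ?J = G ?J" using eq_proj[of "unit_vec n i"] eq_proj[of "unit_vec n j"] I by auto
      have exp: "H (proj (u c)) = H ?I + H ?J + (cnj c \<cdot>\<^sub>m H ?P + c \<cdot>\<^sub>m H ?Q)"
        if "linear_map n m H" "cnj c * c = 1" for H c
        using that by (simp add: u linear_mapD(2,3)[OF that(1)])
      show "F ?P = G ?P"
      proof (rule eq_matI)
        note Gd = linear_mapD(1)[OF G Ec] and Fd = linear_mapD(1)[OF F Ec]
        fix k l assume "k < dim_row (G ?P)" "l < dim_col (G ?P)"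
        then have kl: "k < m" "l < m" using Gd[of i j] by auto
        have e: "cnj c * F ?P $$ (k,l) + c * F ?Q $$ (k,l) = cnj c * G ?P $$ (k,l) + c * G ?Q $$ (k,l)"
          if c: "cnj c * c = 1" for c
        proof -
          have "F (proj (u c)) $$ (k,l) = G (proj (u c)) $$ (k,l)" using eq_proj[OF un] by simp
          then show ?thesis
            unfolding exp[OF F c] exp[OF G c] eqI
            using kl Fd[of i j] Fd[of j i] Gd[of i j] Gd[of j i] Gd[of i i] Gd[of j j] by simp
        qed
        show "F ?P $$ (k,l) = G ?P $$ (k,l)"
          using e[of 1] e[of \<i>] by (simp add: complex_eq_iff)
      qed (use linear_mapD(1)[OF F Ec[of i j]] linear_mapD(1)[OF G Ec[of i j]] in auto)
    qed
  qed
qed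

text \<open>The new recovery map undoes \<open>V\<close>, recovers with \<open>R\<close>, and
  applies \<open>V\<close> again to Eve's part of the result.\<close>

lemma D_rec_B_reversible_E:
  assumes V: "reversible e e' V" and \<rho>: "\<rho> \<in> density_ops (a * b * e)"
  shows "cptp (a * b * e) (a * b * e') (apply_on (a * b) e e' 1 V)"
    and "D_rec_B a b e' (apply_on (a * b) e e' 1 V \<rho>) \<le> D_rec_B a b e \<rho>"
proof -
  from V obtain V' where Vc: "cptp e e' V" and V': "cptp e' e V'"
    and inv: "\<And>\<rho>. \<rho> \<in> density_ops e \<Longrightarrow> V' (V \<rho>) = \<rho>"
    unfolding reversible_def by blast
  note L = cptp_linear[OF Vc] and L' = cptp_linear[OF V'] and r = density_ops_carrier[OF \<rho>]
  show G: "cptp (a * b * e) (a * b * e') (apply_on (a * b) e e' 1 V)"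
    using cptp_apply_on[OF Vc, of "a * b" 1] by simp
  \<comment> \<open>Reversibility is given on states only, but Eve may be entangled with Alice, so
    it is needed for all operators before it can be extended by a spectator.\<close>
  have inv: "V' (V X) = X" if "X \<in> carrier_mat e e" for X
    by (rule linear_map_eq_if_eq_on_density_ops[OF linear_map_comp[OF L L'] _ inv that]) (simp_all add: linear_map_def)
  have VB: "cptp (b * e) (b * e') (apply_on b e e' 1 V)"
    using cptp_apply_on[OF Vc, of b 1] by simp
  show "D_rec_B a b e' (apply_on (a * b) e e' 1 V \<rho>) \<le> D_rec_B a b e \<rho>"
  proof (rule D_rec_B_cptp_mono[OF \<rho> G], intro exI conjI)
    fix R assume R: "cptp e (b * e) R"
    note LR = cptp_linear[OF R]
    let ?R' = "\<lambda>X. apply_on b e e' 1 V (R (V' X))"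
    note RV = cptp_comp[OF V' R]
    show "cptp e' (b * e') ?R'" by (rule cptp_comp[OF RV VB])
    let ?Y = "ptrace_mid a b e \<rho>"
    have Y: "?Y \<in> carrier_mat (a * e) (a * e)" by (rule linear_mapD(1)[OF linear_map_ptrace r])
    have VY: "apply_on a e e' 1 V ?Y \<in> carrier_mat (a * e') (a * e')"
      using linear_mapD(1)[OF linear_map_apply_on[OF L, of a 1], of ?Y] Y by simp
    have RY: "apply_on a e (b * e) 1 R ?Y \<in> carrier_mat (a * b * e * 1) (a * b * e * 1)"
      using linear_mapD(1)[OF linear_map_apply_on[OF LR, of a 1], of ?Y] Y by (simp add: mult.assoc)
    have "apply_on a e' (b * e') 1 ?R' (apply_on a e e' 1 V ?Y)
       = apply_on a (b * e) (b * e') 1 (apply_on b e e' 1 V) (apply_on a e' (b * e) 1 (\<lambda>X. R (V' X)) (apply_on a e e' 1 V ?Y))"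
      by (rule apply_on_comp[OF cptp_linear[OF RV] cptp_linear[OF VB] VY, symmetric])
    also have "apply_on a e' (b * e) 1 (\<lambda>X. R (V' X)) (apply_on a e e' 1 V ?Y)
       = apply_on a e (b * e) 1 R (apply_on a e' e 1 V' (apply_on a e e' 1 V ?Y))"
      by (rule apply_on_comp[OF L' LR VY, symmetric])
    also have "apply_on a e' e 1 V' (apply_on a e e' 1 V ?Y) = apply_on a e e 1 (\<lambda>X. V' (V X)) ?Y"
      by (rule apply_on_comp[OF L L' Y])
    also have "\<dots> = ?Y" by (rule apply_on_id[OF inv Y])
    also have "apply_on a (b * e) (b * e') 1 (apply_on b e e' 1 V) (apply_on a e (b * e) 1 R ?Y)
       = apply_on (a * b) e e' 1 V (apply_on a e (b * e) 1 R ?Y)"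
      using apply_on_apply_on[OF L RY] by simp
    finally show "apply_on (a * b) e e' 1 V (apply_on a e (b * e) 1 R ?Y)
       = apply_on a e' (b * e') 1 ?R' (ptrace_mid a b e' (apply_on (a * b) e e' 1 V \<rho>))"
      by (simp only: ptrace_apply_on_right[OF L r])
  qed
qed

text \<open>The state left after tracing out Bob is the same; only the owner of \<open>Q\<close>
  changes. The new recovery map leaves \<open>Q\<close> untouched, applies \<open>R\<close> to the
  old system of Eve and moves Bob's factor to the front.\<close>

lemma D_rec_B_send_A:
  assumes \<rho>: "\<rho> \<in> density_ops (a * q * b * e)"
  shows "cptp (a * q * b * e) (a * b * (q * e)) (swap_mid a q b e)"
    and "D_rec_B a b (q * e) (swap_mid a q b e \<rho>) \<le> D_rec_B (a * q) b e \<rho>"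
proof -
  show G: "cptp (a * q * b * e) (a * b * (q * e)) (swap_mid a q b e)"
    using cptp_swap[of a q b e] by (simp add: mult.assoc)
  note r = density_ops_carrier[OF \<rho>]
  have pt: "ptrace_mid a b (q * e) (swap_mid a q b e \<rho>) = ptrace_mid (a * q) b e \<rho>"
  proof (rule linear_map_ext_kron4[OF _ linear_map_ptrace refl _ r])
    show "linear_map (a * q * b * e) (a * q * e) (\<lambda>X. ptrace_mid a b (q * e) (swap_mid a q b e X))"
      using linear_map_comp[OF cptp_linear[OF G] linear_map_ptrace] by (simp add: mult.assoc)
    fix A Q B C :: "complex mat"
    assume c: "A \<in> carrier_mat a a" "Q \<in> carrier_mat q q" "B \<in> carrier_mat b b" "C \<in> carrier_mat e e"
    show "ptrace_mid a b (q * e) (swap_mid a q b e (kron (kron (kron A Q) B) C)) = ptrace_mid (a * q) b e (kron (kron (kron A Q) B) C)"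
      unfolding swap_kron[OF c] ptrace_kron[OF kron_carrier[OF c(1,2)] c(3,4)]
      using ptrace_kron[OF c(1,3) kron_carrier[OF c(2,4)]] by (simp add: kron_assoc)
  qed
  show "D_rec_B a b (q * e) (swap_mid a q b e \<rho>) \<le> D_rec_B (a * q) b e \<rho>"
  proof (rule D_rec_B_cptp_mono[OF \<rho> G], intro exI conjI)
    fix R assume R: "cptp e (b * e) R"
    note LR = cptp_linear[OF R]
    have S: "cptp (q * (b * e)) (b * (q * e)) (swap_mid 1 q b e)"
      using cptp_swap[of 1 q b e] by (simp add: mult.assoc)
    have QR: "cptp (q * e) (q * (b * e)) (apply_on q e (b * e) 1 R)"
      using cptp_apply_on[OF R, of q 1] by simp
    let ?R' = "\<lambda>X. swap_mid 1 q b e (apply_on q e (b * e) 1 R X)"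
    show "cptp (q * e) (b * (q * e)) ?R'" by (rule cptp_comp[OF QR S])
    let ?Y = "ptrace_mid (a * q) b e \<rho>"
    have Y: "?Y \<in> carrier_mat (a * q * e) (a * q * e)" by (rule linear_mapD(1)[OF linear_map_ptrace r])
    then have Y': "?Y \<in> carrier_mat (a * (q * e)) (a * (q * e))" and Y'': "?Y \<in> carrier_mat (a * q * e * 1) (a * q * e * 1)"
      by (simp_all add: mult.assoc)
    have RY: "apply_on (a * q) e (b * e) 1 R ?Y \<in> carrier_mat (a * 1 * q * b * e) (a * 1 * q * b * e)"
      using linear_mapD(1)[OF linear_map_apply_on[OF LR, of "a * q" 1], of ?Y] Y by (simp add: mult.assoc)
    have "apply_on a (q * e) (b * (q * e)) 1 ?R' ?Y
      = apply_on a (q * (b * e)) (b * (q * e)) 1 (swap_mid 1 q b e) (apply_on a (q * e) (q * (b * e)) 1 (apply_on q e (b * e) 1 R) ?Y)"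
      by (rule apply_on_comp[OF cptp_linear[OF QR] cptp_linear[OF S] Y', symmetric])
    also have "apply_on a (q * e) (q * (b * e)) 1 (apply_on q e (b * e) 1 R) ?Y = apply_on (a * q) e (b * e) 1 R ?Y"
      using apply_on_apply_on[OF LR Y''] by simp
    also have "apply_on a (q * (b * e)) (b * (q * e)) 1 (swap_mid 1 q b e) (apply_on (a * q) e (b * e) 1 R ?Y)
      = swap_mid a q b e (apply_on (a * q) e (b * e) 1 R ?Y)"
      using apply_on_swap[OF RY] by (simp add: mult.assoc)
    finally show "swap_mid a q b e (apply_on (a * q) e (b * e) 1 R ?Y)
       = apply_on a (q * e) (b * (q * e)) 1 ?R' (ptrace_mid a b (q * e) (swap_mid a q b e \<rho>))"
      by (simp only: pt)
  qed
qed

text \<open>\<open>R\<close> already rebuilds \<open>Q\<close> together with the rest of Bob's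
  system. The new recovery map can therefore discard the \<open>Q\<close> that Eve received and
  reinterpret the output of \<open>R\<close>.\<close>

lemma D_rec_B_send_B:
  assumes \<rho>: "\<rho> \<in> density_ops (a * b * q * e)"
  shows "D_rec_B a b (q * e) \<rho> \<le> D_rec_B a (b * q) e \<rho>"
proof -
  have \<rho>': "\<rho> \<in> density_ops (a * (b * q) * e)" using \<rho> by (simp add: mult.assoc)
  note r = density_ops_carrier[OF \<rho>]
  have idL: "linear_map n n (\<lambda>X. X)" for n by (simp add: linear_map_def)
  have id: "cptp (a * (b * q) * e) (a * b * (q * e)) (\<lambda>X. X)"
    using apply_on_id[of "a * (b * q) * e" "\<lambda>X. X"] idL
    by (intro cptpI) (simp_all add: psd_def mult.assoc)
  have Lp: "linear_map (a * b * q * e) (a * q * e) (ptrace_mid a b (q * e))"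
    using linear_map_ptrace[of a b "q * e"] by (simp add: mult.assoc)
  have pt: "ptrace_mid a (b * q) e \<rho> = ptrace_mid a q e (ptrace_mid a b (q * e) \<rho>)"
  proof (rule linear_map_ext_kron4[OF _ linear_map_comp[OF Lp linear_map_ptrace] refl _ r])
    show "linear_map (a * b * q * e) (a * e) (ptrace_mid a (b * q) e)"
      using linear_map_ptrace[of a "b * q" e] by (simp add: mult.assoc)
    fix A B Q C :: "complex mat"
    assume c: "A \<in> carrier_mat a a" "B \<in> carrier_mat b b" "Q \<in> carrier_mat q q" "C \<in> carrier_mat e e"
    have "ptrace_mid a (b * q) e (kron (kron A (kron B Q)) C) = (mat_trace B * mat_trace Q) \<cdot>\<^sub>m kron A C"
      using ptrace_kron[OF c(1) kron_carrier[OF c(2,3)] c(4)] trace_kron[OF c(2,3)] by simp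
    moreover have "ptrace_mid a b (q * e) (kron (kron A B) (kron Q C)) = mat_trace B \<cdot>\<^sub>m kron (kron A Q) C"
      using ptrace_kron[OF c(1,2) kron_carrier[OF c(3,4)]] by (simp add: kron_assoc)
    moreover have "ptrace_mid a q e (mat_trace B \<cdot>\<^sub>m kron (kron A Q) C) = mat_trace B \<cdot>\<^sub>m (mat_trace Q \<cdot>\<^sub>m kron A C)"
      using linear_mapD(3)[OF linear_map_ptrace kron_carrier[OF kron_carrier[OF c(1,3)] c(4)]] ptrace_kron[OF c(1,3,4)] by simp
    moreover have "(mat_trace B * mat_trace Q) \<cdot>\<^sub>m kron A C = mat_trace B \<cdot>\<^sub>m (mat_trace Q \<cdot>\<^sub>m kron A C)"
      by (rule eq_matI) auto
    ultimately show "ptrace_mid a (b * q) e (kron (kron (kron A B) Q) C) = ptrace_mid a q e (ptrace_mid a b (q * e) (kron (kron (kron A B) Q) C))"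
      by (simp add: kron_assoc)
  qed
  show ?thesis
  proof (rule D_rec_B_cptp_mono[OF \<rho>' id], intro exI conjI)
    fix R assume R: "cptp e (b * q * e) R"
    have T: "cptp (q * e) e (ptrace_mid 1 q e)" using cptp_ptrace[of 1 q e] by simp
    let ?R' = "\<lambda>X. R (ptrace_mid 1 q e X)"
    show "cptp (q * e) (b * (q * e)) ?R'" using cptp_comp[OF T R] by (simp add: mult.assoc)
    let ?Y = "ptrace_mid a b (q * e) \<rho>"
    have Y: "?Y \<in> carrier_mat (a * (q * e)) (a * (q * e))" and Y': "?Y \<in> carrier_mat (a * 1 * q * e) (a * 1 * q * e)"
      using linear_mapD(1)[OF Lp r] by (simp_all add: mult.assoc)
    have "apply_on a (q * e) (b * q * e) 1 ?R' ?Y = apply_on a e (b * q * e) 1 R (apply_on a (q * e) e 1 (ptrace_mid 1 q e) ?Y)"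
      by (rule apply_on_comp[OF cptp_linear[OF T] cptp_linear[OF R] Y, symmetric])
    also have "apply_on a (q * e) e 1 (ptrace_mid 1 q e) ?Y = ptrace_mid a q e ?Y"
      using apply_on_ptrace[OF Y'] by simp
    finally show "apply_on a e (b * q * e) 1 R (ptrace_mid a (b * q) e \<rho>)
       = apply_on a (q * e) (b * (q * e)) 1 ?R' ?Y"
      by (simp add: pt mult.assoc)
  qed
qed

section \<open>Broadcasting by Alice\<close>

lemma adjoint_add:
  assumes "A \<in> carrier_mat n m" "B \<in> carrier_mat n m"
  shows "mat_adjoint (A + B) = mat_adjoint A + mat_adjoint (B :: complex mat)"
  using assms by (intro eq_matI) auto

text \<open>Expresses a rank one projection through a matrix unit, so that the matrix identity
  \<open>W * A = K\<close> carries over to the projections on single columns.\<close>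

lemma mult_matrix_unit_adjoint:
  assumes M: "M \<in> carrier_mat r n" and m: "m < n"
  shows "M * matrix_unit n m m * mat_adjoint M = proj (col M m)"
proof (rule eq_matI)
  fix i j assume "i < dim_row (proj (col M m))" "j < dim_col (proj (col M m))"
  then have ij: "i < r" "j < r" using M by (auto simp: proj_def)
  have 1: "(M * matrix_unit n m m) $$ (i,k) = (if k = m then M $$ (i,m) else 0)" if "k < n" for k
    unfolding mult_index[OF M matrix_unit_carrier ij(1) that] using m that
    by (cases "k = m") (simp_all add: matrix_unit_def if_distrib[of "\<lambda>x. _ * x"] cong: if_cong)
  have "M * matrix_unit n m m \<in> carrier_mat r n" using M by auto
  then have "(M * matrix_unit n m m * mat_adjoint M) $$ (i,j) = (\<Sum>k<n. (M * matrix_unit n m m) $$ (i,k) * mat_adjoint M $$ (k,j))"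
    by (rule mult_index[OF _ carrier_adjoint[OF M] ij])
  also have "\<dots> = (\<Sum>k<n. if k = m then M $$ (i,m) * cnj (M $$ (j,m)) else 0)"
    using M ij by (intro sum.cong refl) (simp add: 1 del: index_mult_mat(1))
  also have "\<dots> = proj (col M m) $$ (i,j)" using M m ij by (simp add: proj_def)
  finally show "(M * matrix_unit n m m * mat_adjoint M) $$ (i,j) = proj (col M m) $$ (i,j)" .
qed (use M in \<open>auto simp: proj_def\<close>)

text \<open>
  The map \<open>v\<^sub>m \<mapsto> v\<^sub>m \<otimes> v\<^sub>m\<close> extends to an isometry by sending \<open>x\<close> in the orthogonal complement of
  the \<open>v\<^sub>m\<close> to \<open>e\<^sub>0 \<otimes> x\<close>, which is orthogonal to all \<open>v\<^sub>m \<otimes> v\<^sub>m\<close>.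
\<close>

lemma copy_isometry:
  assumes v: "orthonormal c n v" and c: "c > 0"
  shows "\<exists>W \<in> carrier_mat (c * c) c. mat_adjoint W * W = 1\<^sub>m c \<and>
    (\<forall>m<n. W * proj (v m) * mat_adjoint W = kron (proj (v m)) (proj (v m)))"
proof -
  have vc: "v m \<in> carrier_vec c" if "m < n" for m using v that by (simp add: orthonormal_def)
  have orth: "(\<Sum>i<c. cnj (v m $ i) * v m' $ i) = (if m = m' then 1 else 0)" if "m < n" "m' < n" for m m'
  proof -
    have "v m' \<bullet>c v m = (\<Sum>i<c. cnj (v m $ i) * v m' $ i)"
      using vc[OF that(1)] vc[OF that(2)] by (simp add: scalar_prod_def atLeast0LessThan mult.commute)
    then show ?thesis using v that by (auto simp: orthonormal_def)
  qed
  \<comment> \<open>\<open>A\<close> and \<open>K\<close> have the columns \<open>v m\<close> and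
    \<open>v m \<otimes> v m\<close>, and \<open>Q\<close> projects onto the complement of the range
    of \<open>A\<close>. Accordingly \<open>W\<close> is the sum of a part that copies and a part
    that embeds by \<open>J\<close>.\<close>
  define A where "A = mat c n (\<lambda>(i,m). v m $ i)"
  define K where "K = mat (c * c) n (\<lambda>(i,m). v m $ (i div c) * v m $ (i mod c))"
  \<comment> \<open>An index below \<open>c\<close> has quotient 0 and remainder itself, so
    \<open>J\<close> maps \<open>x\<close> to \<open>e_0 \<otimes> x\<close>.\<close>
  define J :: "complex mat" where "J = mat (c * c) c (\<lambda>(i,j). if i = j then 1 else 0)"
  define D where "D = mat n n (\<lambda>(m,m'). if m = m' then cnj (v m $ 0) else 0)"
  define Q where "Q = 1\<^sub>m c - A * mat_adjoint A"
  define W where "W = K * mat_adjoint A + J * Q"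
  have A: "A \<in> carrier_mat c n" and K: "K \<in> carrier_mat (c * c) n" and J: "J \<in> carrier_mat (c * c) c"
    and D: "D \<in> carrier_mat n n" by (simp_all add: A_def K_def J_def D_def)
  note Aa = carrier_adjoint[OF A] and Ka = carrier_adjoint[OF K] and Ja = carrier_adjoint[OF J] and Da = carrier_adjoint[OF D]
  have Q: "Q \<in> carrier_mat c c" unfolding Q_def by (rule minus_carrier_mat[OF mult_carrier_mat[OF A Aa]])
  have KA: "K * mat_adjoint A \<in> carrier_mat (c * c) c" and JQ: "J * Q \<in> carrier_mat (c * c) c"
    by (rule mult_carrier_mat[OF K Aa], rule mult_carrier_mat[OF J Q])
  have W: "W \<in> carrier_mat (c * c) c" unfolding W_def by (rule add_carrier_mat[OF JQ])
  have AA: "mat_adjoint A * A = 1\<^sub>m n"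
  proof (rule eq_matI)
    fix i j assume "i < dim_row (1\<^sub>m n :: complex mat)" "j < dim_col (1\<^sub>m n :: complex mat)"
    then have ij: "i < n" "j < n" by auto
    show "(mat_adjoint A * A) $$ (i,j) = 1\<^sub>m n $$ (i,j)"
      unfolding mult_index[OF Aa A ij] using ij by (simp add: A_def orth)
  qed (use A in auto)
  have KK: "mat_adjoint K * K = 1\<^sub>m n"
  proof (rule eq_matI)
    fix i j assume "i < dim_row (1\<^sub>m n :: complex mat)" "j < dim_col (1\<^sub>m n :: complex mat)"
    then have ij: "i < n" "j < n" by auto
    have "(mat_adjoint K * K) $$ (i,j) = (\<Sum>k<c * c. mat_adjoint K $$ (i,k) * K $$ (k,j))"
      by (rule mult_index[OF Ka K ij])
    also have "\<dots> = (\<Sum>k<c * c. (cnj (v i $ (k div c)) * v j $ (k div c)) * (cnj (v i $ (k mod c)) * v j $ (k mod c)))"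
      using ij K by (intro sum.cong refl) (simp add: K_def)
    also have "\<dots> = (\<Sum>k<c. \<Sum>l<c. (cnj (v i $ k) * v j $ k) * (cnj (v i $ l) * v j $ l))"
      by (rule sum_lessThan_mult)
    also have "\<dots> = (\<Sum>k<c. cnj (v i $ k) * v j $ k) * (\<Sum>l<c. cnj (v i $ l) * v j $ l)"
      by (simp add: sum_product)
    finally show "(mat_adjoint K * K) $$ (i,j) = 1\<^sub>m n $$ (i,j)" using ij by (simp add: orth)
  qed (use K in auto)
  have cc: "j < c * c" if "j < c" for j using that c by (metis less_le_trans le_square)
  have MJ: "(M * J) $$ (i,j) = M $$ (i,j)" if "M \<in> carrier_mat r (c * c)" "i < r" "j < c" for M r i j
    using that cc[OF that(3)] unfolding mult_index[OF that(1) J that(2,3)]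
    by (simp add: J_def if_distrib[of "\<lambda>x. _ * x"] cong: if_cong)
  have JJ: "mat_adjoint J * J = 1\<^sub>m c"
  proof (rule eq_matI)
    fix i j assume "i < dim_row (1\<^sub>m c :: complex mat)" "j < dim_col (1\<^sub>m c :: complex mat)"
    then have ij: "i < c" "j < c" by auto
    show "(mat_adjoint J * J) $$ (i,j) = 1\<^sub>m c $$ (i,j)"
      unfolding MJ[OF Ja ij] using ij cc[OF ij(1)] cc[OF ij(2)] by (simp add: J_def)
  qed (use J in auto)
  \<comment> \<open>The overlap of \<open>v m \<otimes> v m\<close> with
    \<open>e_0 \<otimes> x\<close> is a multiple of the overlap of \<open>v m\<close> with
    \<open>x\<close>. It thus factors through the adjoint of \<open>A\<close>, which annihilates the
    range of \<open>Q\<close>, and the two parts of \<open>W\<close> have orthogonal ranges.\<close>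
  have KJ: "mat_adjoint K * J = D * mat_adjoint A"
  proof (rule eq_matI)
    fix i j assume "i < dim_row (D * mat_adjoint A)" "j < dim_col (D * mat_adjoint A)"
    then have ij: "i < n" "j < c" using D A by auto
    have "(mat_adjoint K * J) $$ (i,j) = cnj (v i $ 0) * cnj (v i $ j)"
      using ij cc[OF ij(2)] K by (simp add: MJ[OF Ka ij] del: index_mult_mat(1)) (simp add: K_def)
    also have "\<dots> = (D * mat_adjoint A) $$ (i,j)"
      unfolding mult_index[OF D Aa ij] using ij A
      by (simp add: D_def A_def if_distrib[of "\<lambda>x. x * _"] cong: if_cong)
    finally show "(mat_adjoint K * J) $$ (i,j) = (D * mat_adjoint A) $$ (i,j)" .
  qed (use K J D A in auto)
  have JK: "mat_adjoint J * K = A * mat_adjoint D"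
    using arg_cong[OF KJ, of mat_adjoint] by (simp add: adjoint_mult[OF Ka J] adjoint_mult[OF D Aa])
  have AQ: "mat_adjoint A * Q = 0\<^sub>m n c"
  proof -
    have "mat_adjoint A * Q = mat_adjoint A * 1\<^sub>m c - mat_adjoint A * (A * mat_adjoint A)"
      unfolding Q_def by (rule mult_minus_distrib_mat[OF Aa one_carrier_mat mult_carrier_mat[OF A Aa]])
    also have "mat_adjoint A * (A * mat_adjoint A) = mat_adjoint A"
      using A Aa AA by (simp add: assoc_mult_mat[of _ n c _ n _ c, symmetric])
    finally show ?thesis by (simp only: right_mult_one_mat[OF Aa] minus_r_inv_mat[OF Aa])
  qed
  have QA: "Q * A = 0\<^sub>m c n"
  proof -
    have "Q * A = 1\<^sub>m c * A - A * mat_adjoint A * A"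
      unfolding Q_def by (rule minus_mult_distrib_mat[OF one_carrier_mat mult_carrier_mat[OF A Aa] A])
    also have "A * mat_adjoint A * A = A"
      using A Aa AA by (simp add: assoc_mult_mat[of _ c n _ c _ n])
    finally show ?thesis by (simp only: left_mult_one_mat[OF A] minus_r_inv_mat[OF A])
  qed
  have Qh: "mat_adjoint Q = Q"
  proof (rule eq_matI)
    have "mat_adjoint (A * mat_adjoint A) = A * mat_adjoint A" using adjoint_mult[OF A Aa] by simp
    then have h: "cnj ((A * mat_adjoint A) $$ (j,i)) = (A * mat_adjoint A) $$ (i,j)" if "i < c" "j < c" for i j
      using that A adjoint_index[of i "A * mat_adjoint A" j] by simp
    fix i j assume "i < dim_row Q" "j < dim_col Q"
    then have ij: "i < c" "j < c" using Q by auto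
    have Q_ij: "Q $$ (k,l) = (if k = l then 1 else 0) - (A * mat_adjoint A) $$ (k,l)" if "k < c" "l < c" for k l
      using that A by (simp add: Q_def del: index_mult_mat(1))
    show "mat_adjoint Q $$ (i,j) = Q $$ (i,j)"
      using ij Q h[OF ij] by (simp add: Q_ij del: index_mult_mat(1))
  qed (use Q in auto)
  have QQ: "Q * Q = Q"
  proof -
    have "Q * Q = Q * 1\<^sub>m c - Q * (A * mat_adjoint A)"
      by (subst (2) Q_def) (rule mult_minus_distrib_mat[OF Q one_carrier_mat mult_carrier_mat[OF A Aa]])
    also have "Q * (A * mat_adjoint A) = 0\<^sub>m c c"
      using A Aa Q QA by (simp add: assoc_mult_mat[of _ c c _ n _ c, symmetric])
    also have "Q * 1\<^sub>m c - 0\<^sub>m c c = Q" using Q by (intro eq_matI) auto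
    finally show ?thesis .
  qed
  have KW: "mat_adjoint K * W = mat_adjoint A"
  proof -
    have "mat_adjoint K * W = mat_adjoint K * (K * mat_adjoint A) + mat_adjoint K * (J * Q)"
      unfolding W_def by (rule mult_add_distrib_mat[OF Ka KA JQ])
    also have "mat_adjoint K * (K * mat_adjoint A) = mat_adjoint A"
      by (simp only: assoc_mult_mat[OF Ka K Aa, symmetric] KK left_mult_one_mat[OF Aa])
    also have "mat_adjoint K * (J * Q) = D * (mat_adjoint A * Q)"
      by (simp only: assoc_mult_mat[OF Ka J Q, symmetric] KJ assoc_mult_mat[OF D Aa Q])
    also have "\<dots> = 0\<^sub>m n c" by (simp only: AQ right_mult_zero_mat[OF D])
    finally show ?thesis by (simp only: right_add_zero_mat[OF Aa])
  qed
  have JW: "Q * (mat_adjoint J * W) = Q"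
  proof -
    have "mat_adjoint J * W = mat_adjoint J * (K * mat_adjoint A) + mat_adjoint J * (J * Q)"
      unfolding W_def by (rule mult_add_distrib_mat[OF Ja KA JQ])
    also have "mat_adjoint J * (K * mat_adjoint A) = A * (mat_adjoint D * mat_adjoint A)"
      by (simp only: assoc_mult_mat[OF Ja K Aa, symmetric] JK assoc_mult_mat[OF A Da Aa])
    also have "mat_adjoint J * (J * Q) = Q"
      by (simp only: assoc_mult_mat[OF Ja J Q, symmetric] JJ left_mult_one_mat[OF Q])
    finally have "Q * (mat_adjoint J * W) = Q * (A * (mat_adjoint D * mat_adjoint A)) + Q * Q"
      using mult_add_distrib_mat[OF Q mult_carrier_mat[OF A mult_carrier_mat[OF Da Aa]] Q] by simp
    also have "Q * (A * (mat_adjoint D * mat_adjoint A)) = 0\<^sub>m c c"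
      by (simp only: assoc_mult_mat[OF Q A mult_carrier_mat[OF Da Aa], symmetric] QA left_mult_zero_mat[OF mult_carrier_mat[OF Da Aa]])
    finally show ?thesis by (simp only: QQ left_add_zero_mat[OF Q])
  qed
  have "mat_adjoint W = A * mat_adjoint K + Q * mat_adjoint J"
    by (simp only: W_def adjoint_add[OF KA JQ] adjoint_mult[OF K Aa] adjoint_mult[OF J Q] Qh adjoint_adjoint)
  then have "mat_adjoint W * W = A * (mat_adjoint K * W) + Q * (mat_adjoint J * W)"
    by (simp only: add_mult_distrib_mat[OF mult_carrier_mat[OF A Ka] mult_carrier_mat[OF Q Ja] W]
        assoc_mult_mat[OF A Ka W] assoc_mult_mat[OF Q Ja W])
  also have "\<dots> = 1\<^sub>m c"
  proof -
    have "X + (1\<^sub>m c - X) = 1\<^sub>m c" if "X \<in> carrier_mat c c" for X :: "complex mat"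
      using that by (intro eq_matI) auto
    from this[OF mult_carrier_mat[OF A Aa]] show ?thesis unfolding KW JW by (simp only: Q_def)
  qed
  finally have iso: "mat_adjoint W * W = 1\<^sub>m c" .
  have WA: "W * A = K"
  proof -
    have "W * A = K * mat_adjoint A * A + J * Q * A"
      unfolding W_def by (rule add_mult_distrib_mat[OF KA JQ A])
    also have "K * mat_adjoint A * A = K"
      by (simp only: assoc_mult_mat[OF K Aa A] AA right_mult_one_mat[OF K])
    also have "J * Q * A = 0\<^sub>m (c * c) n"
      by (simp only: assoc_mult_mat[OF J Q A] QA right_mult_zero_mat[OF J])
    finally show ?thesis by (simp only: right_add_zero_mat[OF K])
  qed
  have "W * proj (v m) * mat_adjoint W = kron (proj (v m)) (proj (v m))" if m: "m < n" for m
  proof -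
    let ?E = "matrix_unit n m m"
    have "col A m = v m" using vc[OF m] m by (intro eq_vecI) (auto simp: A_def)
    then have "W * proj (v m) * mat_adjoint W = W * (A * ?E * mat_adjoint A) * mat_adjoint W"
      using mult_matrix_unit_adjoint[OF A m] by simp
    also have "\<dots> = (W * A) * ?E * (mat_adjoint A * mat_adjoint W)"
    proof -
      have E: "?E \<in> carrier_mat n n" by simp
      have AE: "A * ?E \<in> carrier_mat c n" using A by auto
      have "W * (A * ?E * mat_adjoint A) = W * (A * ?E) * mat_adjoint A"
        by (rule assoc_mult_mat[OF W AE Aa, symmetric])
      moreover have "W * (A * ?E) = W * A * ?E" by (rule assoc_mult_mat[OF W A E, symmetric])
      moreover have "W * A * ?E * mat_adjoint A * mat_adjoint W = W * A * ?E * (mat_adjoint A * mat_adjoint W)"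
        by (rule assoc_mult_mat[OF mult_carrier_mat[OF mult_carrier_mat[OF W A] E] Aa carrier_adjoint[OF W]])
      ultimately show ?thesis by simp
    qed
    also have "\<dots> = K * ?E * mat_adjoint K"
      by (simp add: WA adjoint_mult[OF W A, symmetric])
    also have "\<dots> = proj (col K m)" by (rule mult_matrix_unit_adjoint[OF K m])
    also have "\<dots> = kron (proj (v m)) (proj (v m))"
      using vc[OF m] m div_mod_less[of _ c c] by (intro eq_matI) (auto simp: proj_def kron_index' K_def)
    finally show ?thesis .
  qed
  with W iso show ?thesis by blast
qed

lemma mat_sum_cong: "(\<And>t. t < N \<Longrightarrow> f t = g t) \<Longrightarrow> mat_sum n N f = mat_sum n N g"
  by (simp add: mat_sum_def)

lemma mat_sum_Suc:
  assumes "f N \<in> carrier_mat n n"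
  shows "mat_sum n (Suc N) f = mat_sum n N f + f N"
  using carrier_matD[OF assms] by (intro eq_matI) (auto simp: mat_sum_def)

lemma linear_map_mat_sum:
  assumes F: "linear_map n m F" and f: "\<And>t. t < N \<Longrightarrow> f t \<in> carrier_mat n n"
  shows "F (mat_sum n N f) = mat_sum m N (\<lambda>t. F (f t))"
  using f
proof (induction N)
  case 0
  have z: "mat_sum k 0 g = 0\<^sub>m k k" for k g by (rule eq_matI) (auto simp: mat_sum_def)
  have "F (0 \<cdot>\<^sub>m 0\<^sub>m n n) = 0 \<cdot>\<^sub>m F (0\<^sub>m n n)" by (rule linear_mapD(3)[OF F]) simp
  moreover have "0 \<cdot>\<^sub>m X = 0\<^sub>m k k" if "X \<in> carrier_mat k k" for X :: "complex mat" and k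
    using that by (intro eq_matI) auto
  ultimately show ?case using linear_mapD(1)[OF F, of "0\<^sub>m n n"] by (simp add: z)
next
  case (Suc N)
  have "mat_sum n N f \<in> carrier_mat n n" by (simp add: mat_sum_def)
  then show ?case
    using Suc linear_mapD(1)[OF F] by (simp add: mat_sum_Suc linear_mapD(2)[OF F])
qed

text \<open>A state that is classical on the register is a combination of terms
  \<open>kron (proj (v m)) (\<tau> m)\<close>. The maps compared for broadcasting agree on these
  terms but not on all operators, so extensionality on product operators does not apply.\<close>

lemma linear_map_eq_on_combination:
  assumes F: "linear_map n m F" and G: "linear_map n m G" and f: "\<And>t. t < N \<Longrightarrow> f t \<in> carrier_mat n n"
    and eq: "\<And>t. t < N \<Longrightarrow> F (f t) = G (f t)"
  shows "F (mat_sum n N (\<lambda>t. p t \<cdot>\<^sub>m f t)) = G (mat_sum n N (\<lambda>t. p t \<cdot>\<^sub>m f t))"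
proof -
  let ?g = "\<lambda>t. p t \<cdot>\<^sub>m f t"
  have c: "?g t \<in> carrier_mat n n" if "t < N" for t using f[OF that] by simp
  have "F (mat_sum n N ?g) = mat_sum m N (\<lambda>t. F (?g t))" by (rule linear_map_mat_sum[OF F c])
  also have "\<dots> = mat_sum m N (\<lambda>t. G (?g t))"
    by (rule mat_sum_cong) (simp add: f eq linear_mapD(3)[OF F] linear_mapD(3)[OF G])
  also have "\<dots> = G (mat_sum n N ?g)" by (rule linear_map_mat_sum[OF G c, symmetric])
  finally show ?thesis .
qed

lemma swap_first_kron:
  assumes "B \<in> carrier_mat q q" "C \<in> carrier_mat r r" "D \<in> carrier_mat s s"
  shows "swap_mid 1 q r s (kron (kron B C) D) = kron (kron C B) D"
  using swap_kron[OF one_carrier_mat[of 1] assms] by (simp only: kron_one)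

text \<open>\<open>G\<close> copies the register by an isometry and agrees with broadcasting on
  classical registers. Once Bob is traced out, Eve's copy is in the state that Alice's register had,
  so \<open>?R'\<close> uses it as a substitute: it applies \<open>R\<close> to the old system of
  Eve, copies the register again and hands one copy to Bob.\<close>

lemma D_rec_B_broadcast:
  assumes v: "orthonormal c n v" and \<rho>: "\<rho> \<in> density_ops (c * a * b * e)"
    and bc: "(\<rho>, \<rho>') \<in> broadcast c n v a b e"
  shows "\<rho>' \<in> density_ops (a * (c * b) * (c * e))"
    and "D_rec_B a (c * b) (c * e) \<rho>' \<le> D_rec_B (c * a) b e \<rho>"
proof -
  note r = density_ops_carrier[OF \<rho>]
  \<comment> \<open>Matrices of dimension 0 have trace 0, so a state rules out an empty
    register.\<close>
  have c: "c > 0"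
  proof (rule ccontr)
    assume "\<not> c > 0"
    then show False using \<rho> r by (simp add: density_ops_def mat_trace_def)
  qed
  obtain W where W: "W \<in> carrier_mat (c * c) c" and iso: "mat_adjoint W * W = 1\<^sub>m c"
    and copy: "\<And>m. m < n \<Longrightarrow> W * proj (v m) * mat_adjoint W = kron (proj (v m)) (proj (v m))"
    using copy_isometry[OF v c] by blast
  define C where "C X = W * X * mat_adjoint W" for X
  have Cc: "cptp c (c * c) C" unfolding C_def by (rule cptp_isometry[OF W iso])
  note CL = cptp_linear[OF Cc]
  obtain p \<tau> where \<rho>_eq: "\<rho> = mat_sum (c * (a * b * e)) n (\<lambda>m. complex_of_real (p m) \<cdot>\<^sub>m kron (proj (v m)) (\<tau> m))"
    and \<rho>'_eq: "\<rho>' = swap_mid (a * c) c b e (swap_mid 1 (c * c) a (b * e)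
         (mat_sum (c * c * (a * b * e)) n (\<lambda>m. complex_of_real (p m) \<cdot>\<^sub>m kron (kron (proj (v m)) (proj (v m))) (\<tau> m))))"
    and \<tau>: "\<And>m. m < n \<Longrightarrow> \<tau> m \<in> density_ops (a * b * e)"
    using bc unfolding broadcast_def by blast
  have \<tau>c: "\<tau> m \<in> carrier_mat (a * b * e) (a * b * e)" if "m < n" for m
    using density_ops_carrier[OF \<tau>[OF that]] .
  have pc: "proj (v m) \<in> carrier_mat c c" and pt: "mat_trace (proj (v m)) = 1" if "m < n" for m
  proof -
    have vm: "v m \<in> carrier_vec c" and "v m \<bullet>c v m = 1" using v that by (auto simp: orthonormal_def)
    then show "proj (v m) \<in> carrier_mat c c" "mat_trace (proj (v m)) = 1"
      by (simp_all add: proj_def mat_trace_def scalar_prod_def atLeast0LessThan)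
  qed
  have kc: "kron (proj (v m)) (\<tau> m) \<in> carrier_mat (c * (a * b * e)) (c * (a * b * e))" if "m < n" for m
    by (rule kron_carrier[OF pc[OF that] \<tau>c[OF that]])

  define G1 where "G1 = apply_on 1 c (c * c) (a * b * e) C"
  have G1: "cptp (c * a * b * e) (c * c * a * b * e) G1"
    unfolding G1_def using cptp_apply_on[OF Cc, of 1 "a * b * e"] by (simp add: mult.assoc)
  have S1: "cptp (c * c * a * b * e) (a * c * c * b * e) (swap_mid 1 (c * c) a (b * e))"
    using cptp_swap[of 1 "c * c" a "b * e"] by (simp add: mult.assoc)
  have S2: "cptp (a * c * c * b * e) (a * (c * b) * (c * e)) (swap_mid (a * c) c b e)"
    using cptp_swap[of "a * c" c b e] by (simp add: mult.assoc)
  define G where "G X = swap_mid (a * c) c b e (swap_mid 1 (c * c) a (b * e) (G1 X))" for X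
  have Gc: "cptp (c * a * b * e) (a * (c * b) * (c * e)) G"
    unfolding G_def by (rule cptp_comp[OF cptp_comp[OF G1 S1] S2])
  note GL = cptp_linear[OF Gc]
  have G_kron: "G (kron K Y) = swap_mid (a * c) c b e (swap_mid 1 (c * c) a (b * e) (kron (C K) Y))"
    if "K \<in> carrier_mat c c" "Y \<in> carrier_mat (a * b * e) (a * b * e)" for K Y
    unfolding G_def G1_def by (simp only: apply_on_kron_left[OF that CL])

  have \<rho>'_G: "\<rho>' = G \<rho>"
  proof -
    have L: "linear_map (c * (a * b * e)) (c * c * (a * b * e)) G1"
      using cptp_linear[OF G1] by (simp add: mult.assoc)
    have k: "complex_of_real (p m) \<cdot>\<^sub>m kron (proj (v m)) (\<tau> m) \<in> carrier_mat (c * (a * b * e)) (c * (a * b * e))" if "m < n" for m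
      using kc[OF that] by simp
    have step: "G1 (complex_of_real (p m) \<cdot>\<^sub>m kron (proj (v m)) (\<tau> m))
      = complex_of_real (p m) \<cdot>\<^sub>m kron (kron (proj (v m)) (proj (v m))) (\<tau> m)" if m: "m < n" for m
      unfolding linear_mapD(3)[OF L kc[OF m]] unfolding G1_def
      by (simp only: apply_on_kron_left[OF pc[OF m] \<tau>c[OF m] CL]) (simp only: C_def copy[OF m])
    have "G1 \<rho> = mat_sum (c * c * (a * b * e)) n (\<lambda>m. complex_of_real (p m) \<cdot>\<^sub>m kron (kron (proj (v m)) (proj (v m))) (\<tau> m))"
      unfolding \<rho>_eq by (rule trans[OF linear_map_mat_sum[OF L k] mat_sum_cong[OF step]])
    then show ?thesis by (simp add: \<rho>'_eq G_def)
  qed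
  show "\<rho>' \<in> density_ops (a * (c * b) * (c * e))"
    unfolding \<rho>'_G by (rule cptp_density_ops[OF Gc \<rho>])

  have S0: "linear_map (c * a * e) (a * (c * e)) (swap_mid 1 c a e)"
    using linear_map_swap[of 1 c a e] by (simp add: mult.assoc)
  have traced: "ptrace_mid a (c * b) (c * e) (G \<rho>) = swap_mid 1 c a e (ptrace_mid (c * a) b e \<rho>)"
  proof -
    have L1: "linear_map (c * (a * b * e)) (a * (c * e)) (\<lambda>X. ptrace_mid a (c * b) (c * e) (G X))"
      using linear_map_comp[OF GL linear_map_ptrace] by (simp add: mult.assoc)
    have L2: "linear_map (c * (a * b * e)) (a * (c * e)) (\<lambda>X. swap_mid 1 c a e (ptrace_mid (c * a) b e X))"
      using linear_map_comp[OF linear_map_ptrace S0] by (simp add: mult.assoc)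
    \<comment> \<open>The conditions on \<open>P\<close> express that it is a classical message:
      copying gives \<open>kron P P\<close>, and tracing out Bob's copy returns \<open>P\<close>.
      For an off-diagonal \<open>P\<close>, of trace zero, the left side would vanish.\<close>
    have "ptrace_mid a (c * b) (c * e) (G (kron P Y)) = swap_mid 1 c a e (ptrace_mid (c * a) b e (kron P Y))"
      if P: "P \<in> carrier_mat c c" "mat_trace P = 1" "C P = kron P P" and Y: "Y \<in> carrier_mat (a * b * e) (a * b * e)" for P Y
    proof (rule linear_map_ext_kron3[OF linear_map_comp[OF linear_map_kron[OF P(1)] L1] linear_map_comp[OF linear_map_kron[OF P(1)] L2] refl _ Y])
      fix A B D :: "complex mat"
      assume d: "A \<in> carrier_mat a a" "B \<in> carrier_mat b b" "D \<in> carrier_mat e e"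
      have "G (kron P (kron (kron A B) D)) = swap_mid (a * c) c b e (swap_mid 1 (c * c) a (b * e) (kron (kron (kron P P) A) (kron B D)))"
        using G_kron[OF P(1) kron_carrier[OF kron_carrier[OF d(1,2)] d(3)]] by (simp add: P(3) kron_assoc)
      also have "\<dots> = swap_mid (a * c) c b e (kron (kron (kron (kron A P) P) B) D)"
        by (simp only: swap_first_kron[OF kron_carrier[OF P(1,1)] d(1) kron_carrier[OF d(2,3)], unfolded kron_assoc] kron_assoc)
      also have "\<dots> = kron (kron A (kron P B)) (kron P D)"
        by (simp only: swap_kron[OF kron_carrier[OF d(1) P(1)] P(1) d(2,3), unfolded kron_assoc] kron_assoc)
      finally have "ptrace_mid a (c * b) (c * e) (G (kron P (kron (kron A B) D))) = mat_trace B \<cdot>\<^sub>m kron A (kron P D)"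
        using ptrace_kron[OF d(1) kron_carrier[OF P(1) d(2)] kron_carrier[OF P(1) d(3)]] trace_kron[OF P(1) d(2)] P(2) by simp
      moreover have "ptrace_mid (c * a) b e (kron P (kron (kron A B) D)) = mat_trace B \<cdot>\<^sub>m kron (kron P A) D"
        using ptrace_kron[OF kron_carrier[OF P(1) d(1)] d(2,3), unfolded kron_assoc] by (simp only: kron_assoc)
      moreover have "swap_mid 1 c a e (mat_trace B \<cdot>\<^sub>m kron (kron P A) D) = mat_trace B \<cdot>\<^sub>m kron A (kron P D)"
        by (simp only: linear_mapD(3)[OF S0 kron_carrier[OF kron_carrier[OF P(1) d(1)] d(3)], unfolded kron_assoc] swap_first_kron[OF P(1) d(1,3), unfolded kron_assoc] kron_assoc)
      ultimately show "ptrace_mid a (c * b) (c * e) (G (kron P (kron (kron A B) D))) = swap_mid 1 c a e (ptrace_mid (c * a) b e (kron P (kron (kron A B) D)))"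
        by simp
    qed
    then show ?thesis
      unfolding \<rho>_eq by (intro linear_map_eq_on_combination[OF L1 L2 kc]) (use pc pt \<tau>c copy in \<open>auto simp: C_def\<close>)
  qed

  show "D_rec_B a (c * b) (c * e) \<rho>' \<le> D_rec_B (c * a) b e \<rho>"
    unfolding \<rho>'_G
  proof (rule D_rec_B_cptp_mono[OF \<rho> Gc], intro exI conjI)
    fix R assume R: "cptp e (b * e) R"
    note LR = cptp_linear[OF R]
    let ?R' = "\<lambda>X. swap_mid c c b e (apply_on 1 c (c * c) (b * e) C (apply_on c e (b * e) 1 R X))"
    have 1: "cptp (c * e) (c * (b * e)) (apply_on c e (b * e) 1 R)" using cptp_apply_on[OF R, of c 1] by simp
    have 2: "cptp (c * (b * e)) (c * c * b * e) (apply_on 1 c (c * c) (b * e) C)"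
      using cptp_apply_on[OF Cc, of 1 "b * e"] by (simp add: mult.assoc)
    have 3: "cptp (c * c * b * e) (c * b * (c * e)) (swap_mid c c b e)"
      using cptp_swap[of c c b e] by (simp add: mult.assoc)
    show R': "cptp (c * e) (c * b * (c * e)) ?R'" by (rule cptp_comp[OF cptp_comp[OF 1 2] 3])
    note LR' = cptp_linear[OF R']
    \<comment> \<open>Classicality plays no part from here on: copying Alice's register corresponds
      to copying Eve's for arbitrary \<open>Y\<close>.\<close>
    have "G (apply_on (c * a) e (b * e) 1 R Y) = apply_on a (c * e) (c * b * (c * e)) 1 ?R' (swap_mid 1 c a e Y)"
      if Y: "Y \<in> carrier_mat (c * a * e) (c * a * e)" for Y
    proof (rule linear_map_ext_kron3[OF _ _ refl _ Y])
      have "linear_map (c * a * e) (c * a * b * e) (apply_on (c * a) e (b * e) 1 R)"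
        using linear_map_apply_on[OF LR, of "c * a" 1] by (simp add: mult.assoc)
      from linear_map_comp[OF this GL]
      show "linear_map (c * a * e) (a * (c * b) * (c * e)) (\<lambda>Y. G (apply_on (c * a) e (b * e) 1 R Y))" .
      show "linear_map (c * a * e) (a * (c * b) * (c * e)) (\<lambda>Y. apply_on a (c * e) (c * b * (c * e)) 1 ?R' (swap_mid 1 c a e Y))"
        using linear_map_comp[OF S0 linear_map_apply_on[OF LR', of a 1, unfolded mult_1_right]] by (simp only: mult.assoc)
      fix K A D :: "complex mat"
      assume d: "K \<in> carrier_mat c c" "A \<in> carrier_mat a a" "D \<in> carrier_mat e e"
      note RD = linear_mapD(1)[OF LR d(3)] and CK = linear_mapD(1)[OF CL d(1)]
      \<comment> \<open>Rebracketing leaves the matrices literally the same; only the products of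
        dimensions have to be reassociated.\<close>
      have RAD: "kron A (R D) \<in> carrier_mat (a * b * e) (a * b * e)"
        using kron_carrier[OF d(2) RD] by (simp add: mult.assoc)
      have Z: "kron (C K) (R D) \<in> carrier_mat (c * c * b * e) (c * c * b * e)"
        using kron_carrier[OF CK RD] by (simp add: mult.assoc)
      have AZ: "kron A (kron (C K) (R D)) \<in> carrier_mat (a * c * c * b * e) (a * c * c * b * e)"
        using kron_carrier[OF d(2) Z] by (simp add: mult.assoc)
      have "G (apply_on (c * a) e (b * e) 1 R (kron (kron K A) D)) = G (kron K (kron A (R D)))"
        by (simp only: apply_on_kron_right[OF kron_carrier[OF d(1,2)] d(3) LR, unfolded kron_assoc] kron_assoc)
      also have "\<dots> = swap_mid (a * c) c b e (swap_mid 1 (c * c) a (b * e) (kron (kron (C K) A) (R D)))"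
        by (simp only: G_kron[OF d(1) RAD, unfolded kron_assoc] kron_assoc)
      also have "\<dots> = swap_mid (a * c) c b e (kron A (kron (C K) (R D)))"
        by (simp only: swap_first_kron[OF CK d(2) RD, unfolded kron_assoc] kron_assoc)
      \<comment> \<open>The outer swap has Alice's factor in its untouched first position, so it is
        the smaller swap with \<open>A\<close> as a spectator.\<close>
      also have "\<dots> = kron A (swap_mid c c b e (kron (C K) (R D)))"
        using apply_on_swap[OF AZ] apply_on_kron_right[OF d(2) Z linear_map_swap[of c c b e]] by simp
      also have "swap_mid c c b e (kron (C K) (R D)) = ?R' (kron K D)"
        by (simp only: apply_on_kron_right[OF d(1,3) LR] apply_on_kron_left[OF d(1) RD CL])
      also have "kron A (?R' (kron K D)) = apply_on a (c * e) (c * b * (c * e)) 1 ?R' (kron A (kron K D))"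
        by (rule apply_on_kron_right[OF d(2) kron_carrier[OF d(1,3)] LR', symmetric])
      also have "kron A (kron K D) = swap_mid 1 c a e (kron (kron K A) D)"
        by (simp only: swap_first_kron[OF d, unfolded kron_assoc] kron_assoc)
      finally show "G (apply_on (c * a) e (b * e) 1 R (kron (kron K A) D))
        = apply_on a (c * e) (c * b * (c * e)) 1 ?R' (swap_mid 1 c a e (kron (kron K A) D))" .
    qed
    from this[OF linear_mapD(1)[OF linear_map_ptrace r]]
    show "G (apply_on (c * a) e (b * e) 1 R (ptrace_mid (c * a) b e \<rho>))
      = apply_on a (c * e) (c * b * (c * e)) 1 ?R' (ptrace_mid a (c * b) (c * e) (G \<rho>))"
      by (simp only: traced)
  qed
qed

text \<open>Functions of the dimension triple allow the induction over \<open>Omega_fwd\<close>,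
  whose indices are whole triples, to be stated for composite operations as well.\<close>

fun total_dim :: "nat \<times> nat \<times> nat \<Rightarrow> nat" where
  "total_dim (a, b, e) = a * b * e"

fun D_rec_B_of :: "nat \<times> nat \<times> nat \<Rightarrow> complex mat \<Rightarrow> ereal" where
  "D_rec_B_of (a, b, e) \<rho> = D_rec_B a b e \<rho>"

text \<open>Preservation of density operators is proved along with monotonicity, since in a
  composition the second operation acts on the intermediate state.\<close>

lemma Omega_fwd_mono:
  assumes "Omega_fwd d d' \<E>" "(\<rho>, \<rho>') \<in> \<E>" "\<rho> \<in> density_ops (total_dim d)"
  shows "\<rho>' \<in> density_ops (total_dim d') \<and> D_rec_B_of d' \<rho>' \<le> D_rec_B_of d \<rho>"
  using assms
proof (induction arbitrary: \<rho> \<rho>' rule: Omega_fwd.induct)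
  case (L_A a a' F b e)
  then show ?case
    using D_rec_B_local_A[OF L_A.hyps, of \<rho> b e] cptp_density_ops by (auto simp: on_states_def)
next
  case (L_B b b' F a e)
  then show ?case
    using D_rec_B_local_B[OF L_B.hyps, of \<rho> a e] cptp_density_ops by (auto simp: on_states_def)
next
  case (R_E e e' V a b)
  then show ?case
    using D_rec_B_reversible_E[OF R_E.hyps, of \<rho> a b] cptp_density_ops by (auto simp: on_states_def)
next
  case (P_A c n v a b e)
  then show ?case
    using D_rec_B_broadcast[OF P_A.hyps, of \<rho> a b e \<rho>'] by simp
next
  case (Q_AE a q b e)
  then show ?case
    using D_rec_B_send_A[of \<rho> a q b e] cptp_density_ops by (auto simp: on_states_def)
next
  case (Q_BE a b q e)
  then show ?case
    using D_rec_B_send_B[of \<rho> a b q e] by (auto simp: on_states_def mult.assoc)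
next
  case (comp d d' \<E> d'' \<F>)
  from comp.prems(1) obtain \<tau> where \<tau>: "(\<rho>, \<tau>) \<in> \<E>" "(\<tau>, \<rho>') \<in> \<F>" by blast
  note 1 = comp.IH(1)[OF \<tau>(1) comp.prems(2)]
  note 2 = comp.IH(2)[OF \<tau>(2) 1[THEN conjunct1]]
  show ?case using 1 2 by (blast intro: order.trans)
qed

theorem mainTheorem5:
  fixes a b e a' b' e' :: nat and \<rho> \<rho>' :: "complex mat" and \<E> :: operation
  assumes "\<rho> \<in> density_ops (a * b * e)"
    and "Omega_fwd (a, b, e) (a', b', e') \<E>"
    and "(\<rho>, \<rho>') \<in> \<E>"
  shows "D_rec_B a b e \<rho> \<ge> D_rec_B a' b' e' \<rho>'"
  using Omega_fwd_mono[OF assms(2,3)] assms(1) by simp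

end
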